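(* The pair $(A,\Delta_A)$ described in the context is a discrete quantum group. That is: $A$ is a $^*$-algebra that is a direct sum of full matrix algebras; $\Delta_A:A\to M(A\otimes A)$ is a coproduct on $A$; and there exist a counit and an antipode for $(A,\Delta_A)$.
   Context: Let $t>0$ be real and $\lambda=\exp(t)$. $\mathfrak A_t$ is the unital complex $^*$-algebra generated by $e,f,q$ with $q$ invertible, subject to $qe=\lambda eq$, $qf=\lambda^{-1}fq$, $ef-fe=(\lambda-\lambda^{-1})^{-1}(q^2-q^{-2})$, with $e^*=f$, $q^*=q$. It is a Hopf $^*$-algebra with $\Delta(q)=q\otimes q$, $\Delta(e)=q\otimes e+e\otimes q^{-1}$, $\Delta(f)=q\otimes f+f\otimes q^{-1}$. Let $I=\{0,\frac12,1,\frac32,\dots\}$. For $n\in I$ let $\mathcal H_n$ be the $(2n+1)$-dimensional Hilbert space with orthonormal basis $\xi(n,j)$, $j=-n,-n+1,\dots,n$, and let $\pi_n$ be the irreducible $^*$-representation of $\mathfrak A_t$ on $\mathcal H_n$ given by $\pi_n(q)\xi(n,j)=\lambda^j\xi(n,j)$, $\pi_n(e)\xi(n,j)=r_j\xi(n,j+1)$ for $j\neq n$, $\pi_n(e)\xi(n,n)=0$, $\pi_n(f)\xi(n,j)=r_{j-1}\xi(n,j-1)$ for $j\ne -n$, $\pi_n(f)\xi(n,-n)=0$, where $r_j>0$ for $-n\le j\le n-1$ (depending on $n$) are determined by $r_n=0$ and $r_{j-1}^2-r_j^2=(\lambda-\lambda^{-1})^{-1}(\lambda^{2j}-\lambda^{-2j})$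 for $-n<j\le n$. $A_n$ is the $^*$-algebra of all linear operators on $\mathcal H_n$, and $A=\bigoplus_{n\in I}A_n$ is the algebraic direct sum. The multiplier algebra $M(A)$ is the direct product $\prod_n A_n$, and $M(A\otimes A)=\prod_{n,m}A_n\otimes A_m$. For $n,m\in I$ put $I_{nm}=\{|n-m|,|n-m|+1,\dots,n+m\}$. There is a well-defined injective $^*$-homomorphism $\phi_{nm}:\bigoplus_{k\in I_{nm}}A_k\to A_n\otimes A_m$ with $\phi_{nm}\big((\pi_k(x))_{k\in I_{nm}}\big)=(\pi_n\otimes\pi_m)\Delta(x)$ for $x\in\mathfrak A_t$ (every element of $\bigoplus_{k\in I_{nm}}A_k$ is of the form $(\pi_k(x))_{k\in I_{nm}}$). The linear map $\Delta_A:A\to M(A\otimes A)$ is defined componentwise by $\Delta_A(a)_{nm}=\phi_{nm}(a)$ if $a\in\bigoplus_{k\in I_{nm}}A_k$, and $\Delta_A(a)_{nm}=0$ if $a\in A_k$ with $k\notin I_{nm}$. Definitions. A coproduct on a direct sum $A$ of matrix algebras is a $^*$-homomorphism $\Delta:A\to M(A\otimes A)$ such that (i) $\Delta(A)(1\otimes A)\subseteq A\otimes A$ and $(A\otimes 1)\Delta(A)\subseteq A\otimes A$, and (ii) $(\iota\otimes\Delta)\Delta(a)=(\Delta\otimes\iota)\Delta(a)$ for all $a\in A$ (interpreted in $M(A\otimes A\otimes A)$ by multiplying on the left with $c\otimes1\otimes1$ and on the right with $1\otimes1\otimes b$, $b,c\in A$). A counit is a linear map $\varepsilon:A\to\mathbb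 C$ with $(\varepsilon\otimes\iota)\Delta(a)=a=(\iota\otimes\varepsilon)\Delta(a)$ for all $a$. An antipode is a linear map $S:A\to A$ with $m(S\otimes\iota)\Delta(a)=\varepsilon(a)1$ and $m(\iota\otimes S)\Delta(a)=\varepsilon(a)1$ for all $a$, where $m$ is multiplication (equations in $M(A)$, interpreted by multiplying with elements of $A$, i.e. $m(S\otimes\iota)(\Delta(a)(1\otimes b))=\varepsilon(a)b$ and $m(\iota\otimes S)((c\otimes1)\Delta(a))=\varepsilon(a)c$ for $b,c\in A$). A discrete quantum group is a pair $(A,\Delta)$ of a direct sum $A$ of full matrix algebras and a coproduct $\Delta$ on it for which a counit and an antipode exist. *)

theory Defs
  imports
    Complex_Main
    "HOL-Library.Function_Algebras"
    "HOL-Library.Product_Plus"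
    "HOL-Library.Poly_Mapping"
    "HOL-Algebra.QuotRing"
    "HOL-Algebra.Algebraic_Closure_Type"
begin

section \<open>Direct sums of full matrix algebras\<close>

text \<open>
  A family of full matrix algebras \<open>A\<^sub>i\<close>, \<open>i \<in> I\<close>, is given by finite nonempty sets \<open>B i\<close> that label an
  orthonormal basis of the Hilbert space on which \<open>A\<^sub>i\<close> acts. An operator is identified with its matrix,
  \<open>x p q\<close> being the coefficient of the basis vector \<open>p\<close> in the image of the basis vector \<open>q\<close>; it
  vanishes off \<open>B i \<times> B i\<close>. A tensor product of Hilbert spaces has the product of the label sets as
  its label set, so \<open>A\<^sub>i \<otimes> A\<^sub>j\<close> is labelled by \<open>B i \<times> B j\<close>.
  Sums, zero and (pointwise) negatives of families come from \<^theory>\<open>HOL-Library.Function_Algebras\<close>;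
  the pointwise product of that theory is never used.
\<close>

type_synonym 'b matr = "'b \<Rightarrow> 'b \<Rightarrow> complex"
type_synonym ('i, 'b) fam = "'i \<Rightarrow> 'b matr"

definition mat_mult :: "'b set \<Rightarrow> 'b matr \<Rightarrow> 'b matr \<Rightarrow> 'b matr"
  where "mat_mult K x y = (\<lambda>p q. \<Sum>k\<in>K. x p k * y k q)"

definition mat_one :: "'b set \<Rightarrow> 'b matr"
  where "mat_one K = (\<lambda>p q. if p \<in> K \<and> p = q then 1 else 0)"

definition mat_tensor :: "'b matr \<Rightarrow> 'c matr \<Rightarrow> ('b \<times> 'c) matr"
  where "mat_tensor x y = (\<lambda>(p, r) (q, s). x p q * y r s)"

definition full_matrix_family :: "'i set \<Rightarrow> ('i \<Rightarrow> 'b set) \<Rightarrow> bool"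
  where "full_matrix_family I B \<longleftrightarrow> (\<forall>i\<in>I. finite (B i) \<and> B i \<noteq> {})"

text \<open>The direct product \<open>M(A)\<close> and the algebraic direct sum \<open>A\<close>.\<close>

definition dprod :: "'i set \<Rightarrow> ('i \<Rightarrow> 'b set) \<Rightarrow> ('i, 'b) fam set"
  where "dprod I B = {x. \<forall>i p q. x i p q \<noteq> 0 \<longrightarrow> i \<in> I \<and> p \<in> B i \<and> q \<in> B i}"

definition dsum :: "'i set \<Rightarrow> ('i \<Rightarrow> 'b set) \<Rightarrow> ('i, 'b) fam set"
  where "dsum I B = {x \<in> dprod I B. finite {i. x i \<noteq> 0}}"

definition fscale :: "complex \<Rightarrow> ('i, 'b) fam \<Rightarrow> ('i, 'b) fam"
  where "fscale c x = (\<lambda>i p q. c * x i p q)"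

definition fmult :: "('i \<Rightarrow> 'b set) \<Rightarrow> ('i, 'b) fam \<Rightarrow> ('i, 'b) fam \<Rightarrow> ('i, 'b) fam"
  where "fmult B x y = (\<lambda>i. mat_mult (B i) (x i) (y i))"

definition fone :: "'i set \<Rightarrow> ('i \<Rightarrow> 'b set) \<Rightarrow> ('i, 'b) fam"
  where "fone I B = (\<lambda>i. if i \<in> I then mat_one (B i) else 0)"

definition fstar :: "('i, 'b) fam \<Rightarrow> ('i, 'b) fam"
  where "fstar x = (\<lambda>i p q. cnj (x i q p))"

definition ftensor :: "('i, 'b) fam \<Rightarrow> ('j, 'c) fam \<Rightarrow> ('i \<times> 'j, 'b \<times> 'c) fam"
  where "ftensor x y = (\<lambda>(i, j). mat_tensor (x i) (y j))"

definition pair_family :: "('i \<Rightarrow> 'b set) \<Rightarrow> ('j \<Rightarrow> 'c set) \<Rightarrow> 'i \<times> 'j \<Rightarrow> ('b \<times> 'c) set"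
  where "pair_family B C = (\<lambda>(i, j). B i \<times> C j)"

text \<open>The algebraic tensor product \<open>A \<otimes> A\<close>, as a subspace of \<open>M(A \<otimes> A)\<close>.\<close>

definition tensor_square :: "'i set \<Rightarrow> ('i \<Rightarrow> 'b set) \<Rightarrow> ('i \<times> 'i, 'b \<times> 'b) fam set"
  where "tensor_square I B =
    Modules.module.span fscale {ftensor a b |a b. a \<in> dsum I B \<and> b \<in> dsum I B}"

definition linear_map_on ::
    "(complex \<Rightarrow> 'v \<Rightarrow> 'v) \<Rightarrow> (complex \<Rightarrow> 'w \<Rightarrow> 'w) \<Rightarrow> 'v set \<Rightarrow> ('v::plus \<Rightarrow> 'w::plus) \<Rightarrow> bool"
  where "linear_map_on s1 s2 V T \<longleftrightarrow>
    (\<forall>x\<in>V. \<forall>y\<in>V. T (x + y) = T x + T y) \<and> (\<forall>c. \<forall>x\<in>V. T (s1 c x) = s2 c (T x))"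

definition star_algebra ::
    "(complex \<Rightarrow> 'v \<Rightarrow> 'v) \<Rightarrow> 'v::ab_group_add set \<Rightarrow> ('v \<Rightarrow> 'v \<Rightarrow> 'v) \<Rightarrow> ('v \<Rightarrow> 'v) \<Rightarrow> bool"
  where "star_algebra s V mul star \<longleftrightarrow>
    Modules.module s \<and> Modules.module.subspace s V \<and>
    (\<forall>x\<in>V. \<forall>y\<in>V. mul x y \<in> V) \<and>
    (\<forall>x\<in>V. \<forall>y\<in>V. \<forall>z\<in>V. mul (mul x y) z = mul x (mul y z)) \<and>
    (\<forall>x\<in>V. linear_map_on s s V (\<lambda>y. mul x y) \<and> linear_map_on s s V (\<lambda>y. mul y x)) \<and>
    (\<forall>x\<in>V. star x \<in> V \<and> star (star x) = x) \<and>
    linear_map_on s (\<lambda>c. s (cnj c)) V star \<and>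
    (\<forall>x\<in>V. \<forall>y\<in>V. star (mul x y) = mul (star y) (star x))"


section \<open>Slice maps\<close>

text \<open>
  For a linear map \<open>T\<close> on \<open>A\<close>, the map \<open>T \<otimes> \<iota>\<close> on \<open>A \<otimes> A\<close> is computed by applying \<open>T\<close> to the slices
  obtained by fixing a matrix entry in the second leg, and similarly for \<open>\<iota> \<otimes> T\<close>. The lemmas
  below record that these are the maps \<open>a \<otimes> b \<mapsto> T(a) \<otimes> b\<close> and \<open>a \<otimes> b \<mapsto> a \<otimes> T(b)\<close>.
\<close>

definition slice1 :: "('i \<times> 'k, 'b \<times> 'd) fam \<Rightarrow> 'k \<Rightarrow> 'd \<Rightarrow> 'd \<Rightarrow> ('i, 'b) fam"
  where "slice1 x k r s = (\<lambda>i p q. x (i, k) (p, r) (q, s))"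

definition slice2 :: "('k \<times> 'i, 'd \<times> 'b) fam \<Rightarrow> 'k \<Rightarrow> 'd \<Rightarrow> 'd \<Rightarrow> ('i, 'b) fam"
  where "slice2 x k r s = (\<lambda>i p q. x (k, i) (r, p) (s, q))"

definition apply1 ::
    "(('i, 'b) fam \<Rightarrow> ('j, 'c) fam) \<Rightarrow> ('i \<times> 'k, 'b \<times> 'd) fam \<Rightarrow> ('j \<times> 'k, 'c \<times> 'd) fam"
  where "apply1 T x = (\<lambda>(j, k) (p, r) (q, s). T (slice1 x k r s) j p q)"

definition apply2 ::
    "(('i, 'b) fam \<Rightarrow> ('j, 'c) fam) \<Rightarrow> ('k \<times> 'i, 'd \<times> 'b) fam \<Rightarrow> ('k \<times> 'j, 'd \<times> 'c) fam"
  where "apply2 T x = (\<lambda>(k, j) (r, p) (s, q). T (slice2 x k r s) j p q)"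

definition functional1 :: "(('i, 'b) fam \<Rightarrow> complex) \<Rightarrow> ('i \<times> 'k, 'b \<times> 'd) fam \<Rightarrow> ('k, 'd) fam"
  where "functional1 \<omega> x = (\<lambda>k r s. \<omega> (slice1 x k r s))"

definition functional2 :: "(('i, 'b) fam \<Rightarrow> complex) \<Rightarrow> ('k \<times> 'i, 'd \<times> 'b) fam \<Rightarrow> ('k, 'd) fam"
  where "functional2 \<omega> x = (\<lambda>k r s. \<omega> (slice2 x k r s))"

lemma slice1_ftensor: "slice1 (ftensor a b) k r s = fscale (b k r s) a"
  by (simp add: slice1_def ftensor_def mat_tensor_def fscale_def mult.commute)

lemma slice2_ftensor: "slice2 (ftensor a b) k r s = fscale (a k r s) b"
  by (simp add: slice2_def ftensor_def mat_tensor_def fscale_def)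

lemma apply1_ftensor:
  assumes "linear_map_on fscale fscale V T" and "a \<in> V"
  shows "apply1 T (ftensor a b) = ftensor (T a) b"
proof -
  have "T (fscale c a) = fscale c (T a)" for c
    using assms by (simp add: linear_map_on_def)
  then show ?thesis
    by (auto simp: apply1_def slice1_ftensor fun_eq_iff)
      (simp_all add: fscale_def ftensor_def mat_tensor_def)
qed

lemma apply2_ftensor:
  assumes "linear_map_on fscale fscale V T" and "b \<in> V"
  shows "apply2 T (ftensor a b) = ftensor a (T b)"
proof -
  have "T (fscale c b) = fscale c (T b)" for c
    using assms by (simp add: linear_map_on_def)
  then show ?thesis
    by (auto simp: apply2_def slice2_ftensor fun_eq_iff)
      (simp_all add: fscale_def ftensor_def mat_tensor_def)
qed

lemma functional1_ftensor:
  assumes "linear_map_on fscale (*) V \<omega>" and "a \<in> V"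
  shows "functional1 \<omega> (ftensor a b) = fscale (\<omega> a) b"
  using assms by (auto simp: functional1_def slice1_ftensor linear_map_on_def fun_eq_iff fscale_def)

lemma functional2_ftensor:
  assumes "linear_map_on fscale (*) V \<omega>" and "b \<in> V"
  shows "functional2 \<omega> (ftensor a b) = fscale (\<omega> b) a"
  using assms by (auto simp: functional2_def slice2_ftensor linear_map_on_def fun_eq_iff fscale_def)

text \<open>The identification of \<open>(A \<otimes> A) \<otimes> A\<close> with \<open>A \<otimes> (A \<otimes> A)\<close>.\<close>

definition reassoc ::
    "(('i \<times> 'j) \<times> 'k, ('b \<times> 'c) \<times> 'd) fam \<Rightarrow> ('i \<times> 'j \<times> 'k, 'b \<times> 'c \<times> 'd) fam"
  where "reassoc x = (\<lambda>(i, j, k) (p, p', p'') (q, q', q''). x ((i, j), k) ((p, p'), p'') ((q, q'), q''))"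

lemma reassoc_ftensor: "reassoc (ftensor (ftensor a b) c) = ftensor a (ftensor b c)"
  by (auto simp: reassoc_def ftensor_def mat_tensor_def fun_eq_iff)

text \<open>The linear extension of \<open>a \<otimes> b \<mapsto> ab\<close>.\<close>

definition mult_map :: "('i \<Rightarrow> 'b set) \<Rightarrow> ('i \<times> 'i, 'b \<times> 'b) fam \<Rightarrow> ('i, 'b) fam"
  where "mult_map B x = (\<lambda>i p q. \<Sum>k\<in>B i. x (i, i) (p, k) (k, q))"

lemma mult_map_ftensor: "mult_map B (ftensor a b) = fmult B a b"
  by (simp add: mult_map_def ftensor_def mat_tensor_def fmult_def mat_mult_def)


section \<open>Discrete quantum groups\<close>

text \<open>\<open>a \<mapsto> \<Delta>(a)(1 \<otimes> b)\<close> and \<open>a \<mapsto> (c \<otimes> 1)\<Delta>(a)\<close>.\<close>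

definition cover_right ::
    "'i set \<Rightarrow> ('i \<Rightarrow> 'b set) \<Rightarrow> (('i, 'b) fam \<Rightarrow> ('i \<times> 'i, 'b \<times> 'b) fam) \<Rightarrow>
      ('i, 'b) fam \<Rightarrow> ('i, 'b) fam \<Rightarrow> ('i \<times> 'i, 'b \<times> 'b) fam"
  where "cover_right I B \<Delta> a b = fmult (pair_family B B) (\<Delta> a) (ftensor (fone I B) b)"

definition cover_left ::
    "'i set \<Rightarrow> ('i \<Rightarrow> 'b set) \<Rightarrow> (('i, 'b) fam \<Rightarrow> ('i \<times> 'i, 'b \<times> 'b) fam) \<Rightarrow>
      ('i, 'b) fam \<Rightarrow> ('i, 'b) fam \<Rightarrow> ('i \<times> 'i, 'b \<times> 'b) fam"
  where "cover_left I B \<Delta> c a = fmult (pair_family B B) (ftensor c (fone I B)) (\<Delta> a)"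

text \<open>
  In the coassociativity condition, \<open>(c \<otimes> 1 \<otimes> 1)((\<iota> \<otimes> \<Delta>)\<Delta>(a))(1 \<otimes> 1 \<otimes> b)\<close> is
  \<open>(\<iota> \<otimes> \<Delta>)((c \<otimes> 1)\<Delta>(a)) (1 \<otimes> 1 \<otimes> b)\<close>, and \<open>(c \<otimes> 1 \<otimes> 1)((\<Delta> \<otimes> \<iota>)\<Delta>(a))(1 \<otimes> 1 \<otimes> b)\<close> is
  \<open>(c \<otimes> 1 \<otimes> 1) (\<Delta> \<otimes> \<iota>)(\<Delta>(a)(1 \<otimes> b))\<close>. The counit equations are read in the same manner,
  as \<open>(\<epsilon> \<otimes> \<iota>)(\<Delta>(a)(1 \<otimes> b)) = ab\<close> and \<open>(\<iota> \<otimes> \<epsilon>)((c \<otimes> 1)\<Delta>(a)) = ca\<close>.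
\<close>

definition is_coproduct ::
    "'i set \<Rightarrow> ('i \<Rightarrow> 'b set) \<Rightarrow> (('i, 'b) fam \<Rightarrow> ('i \<times> 'i, 'b \<times> 'b) fam) \<Rightarrow> bool"
  where "is_coproduct I B \<Delta> \<longleftrightarrow>
    (\<forall>a\<in>dsum I B. \<Delta> a \<in> dprod (I \<times> I) (pair_family B B)) \<and>
    linear_map_on fscale fscale (dsum I B) \<Delta> \<and>
    (\<forall>a\<in>dsum I B. \<forall>b\<in>dsum I B. \<Delta> (fmult B a b) = fmult (pair_family B B) (\<Delta> a) (\<Delta> b)) \<and>
    (\<forall>a\<in>dsum I B. \<Delta> (fstar a) = fstar (\<Delta> a)) \<and>
    (\<forall>a\<in>dsum I B. \<forall>b\<in>dsum I B. cover_right I B \<Delta> a b \<in> tensor_square I B) \<and>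
    (\<forall>a\<in>dsum I B. \<forall>c\<in>dsum I B. cover_left I B \<Delta> c a \<in> tensor_square I B) \<and>
    (\<forall>a\<in>dsum I B. \<forall>b\<in>dsum I B. \<forall>c\<in>dsum I B.
      fmult (pair_family B (pair_family B B))
        (apply2 \<Delta> (cover_left I B \<Delta> c a))
        (ftensor (fone I B) (ftensor (fone I B) b)) =
      fmult (pair_family B (pair_family B B))
        (ftensor c (ftensor (fone I B) (fone I B)))
        (reassoc (apply1 \<Delta> (cover_right I B \<Delta> a b))))"

definition is_counit ::
    "'i set \<Rightarrow> ('i \<Rightarrow> 'b set) \<Rightarrow> (('i, 'b) fam \<Rightarrow> ('i \<times> 'i, 'b \<times> 'b) fam) \<Rightarrow>
      (('i, 'b) fam \<Rightarrow> complex) \<Rightarrow> bool"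
  where "is_counit I B \<Delta> \<epsilon> \<longleftrightarrow>
    linear_map_on fscale (*) (dsum I B) \<epsilon> \<and>
    (\<forall>a\<in>dsum I B. \<forall>b\<in>dsum I B. functional1 \<epsilon> (cover_right I B \<Delta> a b) = fmult B a b) \<and>
    (\<forall>a\<in>dsum I B. \<forall>c\<in>dsum I B. functional2 \<epsilon> (cover_left I B \<Delta> c a) = fmult B c a)"

definition is_antipode ::
    "'i set \<Rightarrow> ('i \<Rightarrow> 'b set) \<Rightarrow> (('i, 'b) fam \<Rightarrow> ('i \<times> 'i, 'b \<times> 'b) fam) \<Rightarrow>
      (('i, 'b) fam \<Rightarrow> complex) \<Rightarrow> (('i, 'b) fam \<Rightarrow> ('i, 'b) fam) \<Rightarrow> bool"
  where "is_antipode I B \<Delta> \<epsilon> S \<longleftrightarrow>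
    (\<forall>a\<in>dsum I B. S a \<in> dsum I B) \<and>
    linear_map_on fscale fscale (dsum I B) S \<and>
    (\<forall>a\<in>dsum I B. \<forall>b\<in>dsum I B. mult_map B (apply1 S (cover_right I B \<Delta> a b)) = fscale (\<epsilon> a) b) \<and>
    (\<forall>a\<in>dsum I B. \<forall>c\<in>dsum I B. mult_map B (apply2 S (cover_left I B \<Delta> c a)) = fscale (\<epsilon> a) c)"

definition discrete_quantum_group ::
    "'i set \<Rightarrow> ('i \<Rightarrow> 'b set) \<Rightarrow> (('i, 'b) fam \<Rightarrow> ('i \<times> 'i, 'b \<times> 'b) fam) \<Rightarrow> bool"
  where "discrete_quantum_group I B \<Delta> \<longleftrightarrow>
    full_matrix_family I B \<and> is_coproduct I B \<Delta> \<and>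
    (\<exists>\<epsilon>. is_counit I B \<Delta> \<epsilon> \<and> (\<exists>S. is_antipode I B \<Delta> \<epsilon> S))"


section \<open>The Hopf algebra \<open>\<AA>\<^sub>t\<close>\<close>

text \<open>
  \<open>\<AA>\<^sub>t\<close> is the quotient of the free unital algebra on \<open>e\<close>, \<open>f\<close>, \<open>q\<close>, \<open>q\<^sup>-\<^sup>1\<close>, i.e. the monoid algebra of
  the words in these letters, by the two-sided ideal generated by the relations and their adjoints.
\<close>

datatype letter = Let_e | Let_f | Let_q | Let_qinv

datatype word = Word (letters: "letter list")

instantiation word :: monoid_add
begin

definition zero_word :: word
  where "0 = Word []"

definition plus_word :: "word \<Rightarrow> word \<Rightarrow> word"
  where "u + v = Word (letters u @ letters v)"

instance
  by standard (simp_all add: zero_word_def plus_word_def)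

end

type_synonym free_alg = "word \<Rightarrow>\<^sub>0 complex"

text \<open>The monoid algebra of pairs of words is the tensor square of the free algebra.\<close>

type_synonym free_alg2 = "(word \<times> word) \<Rightarrow>\<^sub>0 complex"

definition scalar :: "complex \<Rightarrow> ('w::monoid_add \<Rightarrow>\<^sub>0 complex)"
  where "scalar c = Poly_Mapping.single 0 c"

definition gen :: "letter \<Rightarrow> free_alg"
  where "gen g = Poly_Mapping.single (Word [g]) 1"

definition free_tensor :: "free_alg \<Rightarrow> free_alg \<Rightarrow> free_alg2"
  where "free_tensor x y =
    (\<Sum>u\<in>Poly_Mapping.keys x. \<Sum>v\<in>Poly_Mapping.keys y.
      Poly_Mapping.single (u, v) (Poly_Mapping.lookup x u * Poly_Mapping.lookup y v))"

text \<open>The conjugate linear antimultiplicative involution with \<open>e\<^sup>* = f\<close> and \<open>q\<^sup>* = q\<close>.\<close>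

fun letter_star :: "letter \<Rightarrow> letter"
  where
    "letter_star Let_e = Let_f"
  | "letter_star Let_f = Let_e"
  | "letter_star Let_q = Let_q"
  | "letter_star Let_qinv = Let_qinv"

definition free_star :: "free_alg \<Rightarrow> free_alg"
  where "free_star x =
    (\<Sum>w\<in>Poly_Mapping.keys x.
      Poly_Mapping.single (Word (rev (map letter_star (letters w)))) (cnj (Poly_Mapping.lookup x w)))"

definition lam :: "real \<Rightarrow> real"
  where "lam t = exp t"

definition relators :: "real \<Rightarrow> free_alg set"
  where "relators t =
    (let e = gen Let_e; f = gen Let_f; q = gen Let_q; q' = gen Let_qinv;
         l = complex_of_real (lam t)
     in {q * q' - 1,
         q' * q - 1,
         q * e - scalar l * (e * q),
         q * f - scalar (inverse l) * (f * q),
         e * f - f * e - scalar (inverse (l - inverse l)) * (q ^ 2 - q' ^ 2)})"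

definition rel_ideal :: "real \<Rightarrow> free_alg set"
  where "rel_ideal t = Idl\<^bsub>ring_of_type_algebra\<^esub> (relators t \<union> free_star ` relators t)"

definition At :: "real \<Rightarrow> free_alg set ring"
  where "At t = ring_of_type_algebra Quot rel_ideal t"

text \<open>\<open>\<AA>\<^sub>t \<otimes> \<AA>\<^sub>t\<close> is the quotient of the tensor square of the free algebra by \<open>J \<otimes> F + F \<otimes> J\<close>, where
  \<open>F\<close> is the free algebra and \<open>J\<close> the ideal of relations.\<close>

definition rel_ideal2 :: "real \<Rightarrow> free_alg2 set"
  where "rel_ideal2 t = Idl\<^bsub>ring_of_type_algebra\<^esub>
    ((\<lambda>x. free_tensor x 1) ` rel_ideal t \<union> (\<lambda>x. free_tensor 1 x) ` rel_ideal t)"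

definition At2 :: "real \<Rightarrow> free_alg2 set ring"
  where "At2 t = ring_of_type_algebra Quot rel_ideal2 t"

text \<open>The map induced on a quotient by a map that is constant on cosets.\<close>

definition on_coset :: "('a \<Rightarrow> 'b) \<Rightarrow> 'a set \<Rightarrow> 'b"
  where "on_coset h C = the_elem (h ` C)"

fun comult_letter :: "letter \<Rightarrow> free_alg2"
  where
    "comult_letter Let_q = free_tensor (gen Let_q) (gen Let_q)"
  | "comult_letter Let_qinv = free_tensor (gen Let_qinv) (gen Let_qinv)"
  | "comult_letter Let_e = free_tensor (gen Let_q) (gen Let_e) + free_tensor (gen Let_e) (gen Let_qinv)"
  | "comult_letter Let_f = free_tensor (gen Let_q) (gen Let_f) + free_tensor (gen Let_f) (gen Let_qinv)"

definition comult_free :: "free_alg \<Rightarrow> free_alg2"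
  where "comult_free x =
    (\<Sum>w\<in>Poly_Mapping.keys x.
      scalar (Poly_Mapping.lookup x w) * prod_list (map comult_letter (letters w)))"

definition comult :: "real \<Rightarrow> free_alg set \<Rightarrow> free_alg2 set"
  where "comult t = on_coset (\<lambda>x. rel_ideal2 t +>\<^bsub>ring_of_type_algebra\<^esub> comult_free x)"


section \<open>The representations \<open>\<pi>\<^sub>n\<close>\<close>

definition spins :: "real set"
  where "spins = {n. \<exists>i::nat. n = real i / 2}"

text \<open>The label \<open>j \<in> weights n\<close> stands for the basis vector \<open>\<xi>(n, j)\<close> of \<open>\<H>\<^sub>n\<close>.\<close>

definition weights :: "real \<Rightarrow> real set"
  where "weights n = {j. \<exists>i::nat. j = - n + real i \<and> j \<le> n}"

definition is_ladder :: "real \<Rightarrow> real \<Rightarrow> (real \<Rightarrow> real) \<Rightarrow> bool"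
  where "is_ladder t n r \<longleftrightarrow>
    r n = 0 \<and>
    (\<forall>j\<in>weights n. j \<le> n - 1 \<longrightarrow> r j > 0) \<and>
    (\<forall>j\<in>weights n. - n < j \<longrightarrow>
      (r (j - 1))\<^sup>2 - (r j)\<^sup>2 =
        inverse (lam t - inverse (lam t)) * (lam t powr (2 * j) - lam t powr (- 2 * j)))"

text \<open>Only the values on \<open>weights n\<close>, which are unique, are ever used.\<close>

definition ladder :: "real \<Rightarrow> real \<Rightarrow> real \<Rightarrow> real"
  where "ladder t n = (SOME r. is_ladder t n r)"

fun rep_letter :: "real \<Rightarrow> real \<Rightarrow> letter \<Rightarrow> real matr"
  where
    "rep_letter t n Let_q =
      (\<lambda>i j. if j \<in> weights n \<and> i = j then complex_of_real (lam t powr j) else 0)"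
  | "rep_letter t n Let_qinv =
      (\<lambda>i j. if j \<in> weights n \<and> i = j then complex_of_real (lam t powr (- j)) else 0)"
  | "rep_letter t n Let_e =
      (\<lambda>i j. if j \<in> weights n \<and> j \<noteq> n \<and> i = j + 1 then complex_of_real (ladder t n j) else 0)"
  | "rep_letter t n Let_f =
      (\<lambda>i j. if j \<in> weights n \<and> j \<noteq> - n \<and> i = j - 1 then complex_of_real (ladder t n (j - 1)) else 0)"

definition rep_word :: "real \<Rightarrow> real \<Rightarrow> word \<Rightarrow> real matr"
  where "rep_word t n w =
    foldr (\<lambda>g x. mat_mult (weights n) (rep_letter t n g) x) (letters w) (mat_one (weights n))"

definition rep_free :: "real \<Rightarrow> real \<Rightarrow> free_alg \<Rightarrow> real matr"
  where "rep_free t n x =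
    (\<lambda>i j. \<Sum>w\<in>Poly_Mapping.keys x. Poly_Mapping.lookup x w * rep_word t n w i j)"

definition rep :: "real \<Rightarrow> real \<Rightarrow> free_alg set \<Rightarrow> real matr"
  where "rep t n = on_coset (rep_free t n)"

definition rep2_free :: "real \<Rightarrow> real \<Rightarrow> real \<Rightarrow> free_alg2 \<Rightarrow> (real \<times> real) matr"
  where "rep2_free t n m x =
    (\<lambda>i j. \<Sum>(u, v)\<in>Poly_Mapping.keys x.
      Poly_Mapping.lookup x (u, v) * mat_tensor (rep_word t n u) (rep_word t m v) i j)"

text \<open>\<open>\<pi>\<^sub>n \<otimes> \<pi>\<^sub>m\<close>\<close>

definition rep2 :: "real \<Rightarrow> real \<Rightarrow> real \<Rightarrow> free_alg2 set \<Rightarrow> (real \<times> real) matr"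
  where "rep2 t n m = on_coset (rep2_free t n m)"


section \<open>The coproduct \<open>\<Delta>\<^sub>A\<close>\<close>

text \<open>The direct sum of the operator algebras \<open>A\<^sub>n\<close> is \<open>dsum spins weights\<close>.\<close>

definition cg_spins :: "real \<Rightarrow> real \<Rightarrow> real set"
  where "cg_spins n m = {k. \<exists>i::nat. k = \<bar>n - m\<bar> + real i \<and> k \<le> n + m}"

definition phi :: "real \<Rightarrow> real \<Rightarrow> real \<Rightarrow> (real, real) fam \<Rightarrow> (real \<times> real) matr"
  where "phi t n m b =
    (THE y. \<exists>x\<in>carrier (At t). (\<forall>k\<in>cg_spins n m. rep t k x = b k) \<and> y = rep2 t n m (comult t x))"

text \<open>By linearity, the two clauses defining \<open>\<Delta>\<^sub>A(a)\<^sub>n\<^sub>m\<close> amount to applying \<open>\<phi>\<^sub>n\<^sub>m\<close> to the component of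
  \<open>a\<close> in the direct sum of the \<open>A\<^sub>k\<close> with \<open>k\<close> in \<open>cg_spins n m\<close>.\<close>

definition Delta_A :: "real \<Rightarrow> (real, real) fam \<Rightarrow> (real \<times> real, real \<times> real) fam"
  where "Delta_A t a = (\<lambda>(n, m).
    if n \<in> spins \<and> m \<in> spins then phi t n m (\<lambda>k. if k \<in> cg_spins n m then a k else 0) else 0)"

end

(* For each pair n, m the tensor representation of the free algebra on H_n (x) H_m decomposes according to
   Clebsch-Gordan: every k in I_nm contributes an explicit highest weight vector, whose descendants span a
   copy of H_k, and a vector orthogonal to all these copies is zero. Hence (pi_n (x) pi_m) Delta(x) depends
   only on the pi_k(x) with k in I_nm. Conversely, any finite collection of matrices is of the form
   (pi_k(x))_k, since e^(2k) is a multiple of a matrix unit on H_k and vanishes on all smaller H_k'. So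
   Delta_A(a)_nm can be computed from any x that represents a on I_nm, and the axioms for Delta_A follow from
   those of the Hopf *-algebra. The counit is the component of a in A_0, and the antipode equations come
   down to an invariant vector of pi_n (x) pi_n. *)

theory Submission
  imports Defs
begin

section \<open>Two-sided ideals and linear extensions\<close>

text \<open>Quotients are handled once: everything is proved for representations of the free algebra
  that kill the relators, and only \<open>phi_eq\<close> passes to cosets. There a
  \<open>THE\<close> has to be evaluated, which fixes the form in which the decomposition is needed:
  the kernel of (\<pi>_n \<otimes> \<pi>_m)\<Delta> contains the intersection of the kernels of the
  \<pi>_k, k in I_nm. Neither dimension counts nor complete reducibility enter. The matrices of e
  and f are real, so f is the transpose of e; hence the annihilator of all the copies, for a
  bilinear pairing, is stable under e and, if nonzero, would contain a highest weight vector. The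
  freedom in the choice of x drives the axioms. For three spins, one x represents a on all spins up
  to their sum, and slices of \<Delta>(x) represent the slices of \<Delta>_A(a), so that
  coassociativity comes down to comparing generators. The scalars (-1/\<lambda>)^(n+j) in the
  antipode are, up to normalisation, forced by the condition that e kill a vector supported on the
  \<xi>(n,j) \<otimes> \<xi>(n,-j).\<close>

lemma ring_of_type_ring: "ring (ring_of_type_algebra :: 'a::ring_1 ring)"
proof -
  have "\<exists>y. x + y = 0" for x :: 'a
    using add.right_inverse by blast
  thus ?thesis
    unfolding ring_of_type_algebra_def using add.right_inverse
    by unfold_locales (auto simp:algebra_simps Units_def)
qed

definition two_sided :: "'a::ring_1 set \<Rightarrow> bool"
  where "two_sided J \<longleftrightarrow> 0 \<in> J \<and> (\<forall>x\<in>J. \<forall>y\<in>J. x + y \<in> J) \<and> (\<forall>a. \<forall>x\<in>J. a * x \<in> J \<and> x * a \<in> J)"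

lemma two_sided_0: "two_sided J \<Longrightarrow> 0 \<in> J"
  and two_sided_add: "two_sided J \<Longrightarrow> x \<in> J \<Longrightarrow> y \<in> J \<Longrightarrow> x + y \<in> J"
  and two_sided_left: "two_sided J \<Longrightarrow> x \<in> J \<Longrightarrow> a * x \<in> J"
  and two_sided_right: "two_sided J \<Longrightarrow> x \<in> J \<Longrightarrow> x * a \<in> J"
  by (auto simp: two_sided_def)

lemma two_sided_uminus: "two_sided J \<Longrightarrow> x \<in> J \<Longrightarrow> - x \<in> J"
  using two_sided_left[of J x "- 1"] by simp

lemma two_sided_diff: "two_sided J \<Longrightarrow> x \<in> J \<Longrightarrow> y \<in> J \<Longrightarrow> x - y \<in> J"
  using two_sided_add[of J x "- y"] two_sided_uminus[of J y] by simp

text \<open>\<open>rel_ideal\<close> and \<open>rel_ideal2\<close> are ideals with explicit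
  carriers, taken in the ring of a whole type. This translation lets membership in them be treated
  with type class arithmetic.\<close>

lemma two_sided_ideal:
  fixes J :: "'a::ring_1 set"
  shows "two_sided J \<longleftrightarrow> ideal J ring_of_type_algebra"
proof
  assume J: "two_sided J"
  interpret R: ring "ring_of_type_algebra :: 'a ring" by (rule ring_of_type_ring)
  have inv: "\<ominus>\<^bsub>ring_of_type_algebra\<^esub> x = - x" for x :: 'a
    by (rule R.minus_equality) (simp_all add: ring_of_type_algebra_def)
  show "ideal J ring_of_type_algebra"
  proof (rule idealI[OF ring_of_type_ring])
    show "subgroup J (add_monoid (ring_of_type_algebra :: 'a ring))"
    proof (rule R.add.subgroupI)
      fix a assume "a \<in> J"
      then show "\<ominus>\<^bsub>ring_of_type_algebra\<^esub> a \<in> J"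
        using two_sided_uminus[OF J] inv by simp
    qed (use J in \<open>auto simp: two_sided_def ring_of_type_algebra_def\<close>)
  qed (use J in \<open>auto simp: two_sided_def ring_of_type_algebra_def\<close>)
next
  assume "ideal J (ring_of_type_algebra :: 'a ring)"
  then interpret ideal J "ring_of_type_algebra :: 'a ring" .
  show "two_sided J"
    using additive_subgroup.zero_closed[OF additive_subgroup_axioms]
      additive_subgroup.a_closed[OF additive_subgroup_axioms] I_l_closed I_r_closed
    by (auto simp: two_sided_def ring_of_type_algebra_def)
qed

lemma two_sided_Idl: "two_sided (Idl\<^bsub>ring_of_type_algebra\<^esub> (S :: 'a::ring_1 set))"
  using ring.genideal_ideal[OF ring_of_type_ring, of S]
  by (simp add: two_sided_ideal ring_of_type_algebra_def)

lemma Idl_minimal: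
  fixes S :: "'a::ring_1 set"
  shows "two_sided J \<Longrightarrow> S \<subseteq> J \<Longrightarrow> Idl\<^bsub>ring_of_type_algebra\<^esub> S \<subseteq> J"
  using ring.genideal_minimal[OF ring_of_type_ring, of J S] by (simp add: two_sided_ideal)

lemma Idl_gen:
  fixes S :: "'a::ring_1 set"
  shows "x \<in> S \<Longrightarrow> x \<in> Idl\<^bsub>ring_of_type_algebra\<^esub> S"
  using ring.genideal_self[OF ring_of_type_ring, of S] by (auto simp: ring_of_type_algebra_def)

lemma mem_type_coset: "y \<in> J +>\<^bsub>ring_of_type_algebra\<^esub> x \<longleftrightarrow> y - x \<in> J"
  for x y :: "'a::ring_1"
  by (force simp: a_r_coset_def' ring_of_type_algebra_def)

text \<open>If h is constant on cosets, the image of a coset is a singleton and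
  \<open>the_elem\<close> returns its element. All evaluations of \<open>rep\<close>,
  \<open>rep2\<close> and \<open>comult\<close> go through this.\<close>

lemma on_coset_eq:
  fixes x :: "'a::ring_1"
  assumes "two_sided J" and "\<And>y z. y - z \<in> J \<Longrightarrow> h y = h z"
  shows "on_coset h (J +>\<^bsub>ring_of_type_algebra\<^esub> x) = h x"
proof -
  have "h ` (J +>\<^bsub>ring_of_type_algebra\<^esub> x) = {h x}"
    using assms(2) two_sided_0[OF assms(1)] by (auto simp: mem_type_coset intro!: image_eqI[of _ _ x])
  then show ?thesis by (simp add: on_coset_def)
qed

lemma type_coset_eq:
  fixes x y :: "'a::ring_1"
  assumes J: "two_sided J" and d: "x - y \<in> J"
  shows "J +>\<^bsub>ring_of_type_algebra\<^esub> x = J +>\<^bsub>ring_of_type_algebra\<^esub> y"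
proof -
  have "z - x \<in> J \<longleftrightarrow> z - y \<in> J" for z
    using two_sided_add[OF J _ d, of "z - x"] two_sided_diff[OF J _ d, of "z - y"] by auto
  then show ?thesis by (auto simp: mem_type_coset)
qed

section \<open>Linear extension from a monoid to its monoid algebra\<close>

lemma poly_mapping_eq_sum_single:
  "x = (\<Sum>w\<in>Poly_Mapping.keys x. Poly_Mapping.single w (Poly_Mapping.lookup x w))"
  for x :: "'w \<Rightarrow>\<^sub>0 'a::comm_monoid_add"
  by (rule poly_mapping_eqI)
    (auto simp: lookup_sum lookup_single when_def in_keys_iff if_distrib sum.delta cong: if_cong)

lemma poly_mapping_single_induct [case_names zero single add]:
  fixes x :: "'w \<Rightarrow>\<^sub>0 'a::comm_monoid_add"
  assumes "P 0" "\<And>w c. P (Poly_Mapping.single w c)" "\<And>x y. P x \<Longrightarrow> P y \<Longrightarrow> P (x + y)"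
  shows "P x"
proof -
  have "P (\<Sum>w\<in>A. Poly_Mapping.single w (Poly_Mapping.lookup x w))" if "finite A" for A
    using that by (induction A rule: finite_induct) (auto intro: assms)
  then show ?thesis
    by (subst poly_mapping_eq_sum_single) simp
qed

definition lext :: "('w \<Rightarrow> complex) \<Rightarrow> ('w \<Rightarrow>\<^sub>0 complex) \<Rightarrow> complex"
  where "lext f x = (\<Sum>w\<in>Poly_Mapping.keys x. Poly_Mapping.lookup x w * f w)"

text \<open>Cancellation can make the keys of x + y fewer than those of x and y. Over a common
  finite superset additivity is termwise; the later \<open>_superset\<close> lemmas serve the same
  purpose.\<close>

lemma lext_superset:
  assumes "finite A" "Poly_Mapping.keys x \<subseteq> A"
  shows "lext f x = (\<Sum>w\<in>A. Poly_Mapping.lookup x w * f w)"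
  unfolding lext_def by (rule sum.mono_neutral_left) (use assms in \<open>auto simp: in_keys_iff\<close>)

lemma lext_0 [simp]: "lext f 0 = 0"
  by (simp add: lext_def)

lemma lext_single [simp]: "lext f (Poly_Mapping.single w c) = c * f w"
  by (simp add: lext_def)

lemma lext_add: "lext f (x + y) = lext f x + lext f y"
proof -
  let ?A = "Poly_Mapping.keys x \<union> Poly_Mapping.keys y"
  show ?thesis
    using lext_superset[of ?A x f] lext_superset[of ?A y f] lext_superset[of ?A "x + y" f] keys_add[of x y]
    by (simp add: lookup_add distrib_right sum.distrib)
qed

lemma lext_sum: "lext f (sum g A) = (\<Sum>a\<in>A. lext f (g a))"
  by (induction A rule: infinite_finite_induct) (auto simp: lext_add)

lemma lext_uminus: "lext f (- x) = - lext f x"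
  using lext_add[of f x "- x"] by (simp add: eq_neg_iff_add_eq_0 add.commute)

lemma lext_diff: "lext f (x - y) = lext f x - lext f y"
  using lext_add[of f x "- y"] by (simp add: lext_uminus)

lemma scalar_single: "scalar c * Poly_Mapping.single w d = Poly_Mapping.single w (c * d)"
  and single_scalar: "Poly_Mapping.single w d * scalar c = Poly_Mapping.single w (c * d)"
  by (simp_all add: scalar_def mult_single mult.commute)

lemma scalar_commute: "scalar c * x = x * scalar c"
  by (induction x rule: poly_mapping_single_induct)
    (simp_all add: scalar_single single_scalar distrib_left distrib_right)

lemma scalar_mult: "scalar (c * d) = scalar c * scalar d"
  by (simp add: scalar_def mult_single)

lemma scalar_1 [simp]: "scalar 1 = 1"
  by (simp add: scalar_def)

lemma scalar_add: "scalar (c + d) = scalar c + scalar d"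
  by (simp add: scalar_def single_add)

lemma scalar_uminus: "scalar (- c) = - scalar c"
  by (simp add: scalar_def single_uminus)

lemma lext_scalar: "lext f (scalar c * x) = c * lext f x"
  by (induction x rule: poly_mapping_single_induct)
    (simp_all add: scalar_single distrib_left lext_add)

text \<open>Extending entry by entry reduces linearity of matrix-valued maps to that of the
  functionals \<open>lext\<close>. Both \<open>rep_free\<close> and \<open>rep2_free\<close> are of
  this form.\<close>

definition lin :: "('w \<Rightarrow> 'b matr) \<Rightarrow> ('w \<Rightarrow>\<^sub>0 complex) \<Rightarrow> 'b matr"
  where "lin \<psi> x = (\<lambda>p q. lext (\<lambda>w. \<psi> w p q) x)"

lemma lin_0 [simp]: "lin \<psi> 0 = 0"
  by (simp add: lin_def fun_eq_iff)

lemma lin_single: "lin \<psi> (Poly_Mapping.single w c) = (\<lambda>p q. c * \<psi> w p q)"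
  by (simp add: lin_def)

lemma lin_single_1 [simp]: "lin \<psi> (Poly_Mapping.single w 1) = \<psi> w"
  by (simp add: lin_def)

lemma lin_add: "lin \<psi> (x + y) = lin \<psi> x + lin \<psi> y"
  by (simp add: lin_def fun_eq_iff lext_add)

lemma lin_diff: "lin \<psi> (x - y) = lin \<psi> x - lin \<psi> y"
  by (simp add: lin_def fun_eq_iff lext_diff)

lemma lin_sum: "lin \<psi> (sum g A) = (\<lambda>p q. \<Sum>a\<in>A. lin \<psi> (g a) p q)"
  by (simp add: lin_def fun_eq_iff lext_sum)

lemma lin_scalar: "lin \<psi> (scalar c * x) = (\<lambda>p q. c * lin \<psi> x p q)"
  by (simp add: lin_def fun_eq_iff lext_scalar)

section \<open>Matrix algebra and matrix representations of monoids\<close>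

lemma mat_mult_one_right: "finite K \<Longrightarrow> mat_mult K x (mat_one K) p q = (if q \<in> K then x p q else 0)"
  by (auto simp: mat_mult_def mat_one_def if_distrib sum.delta' cong: if_cong intro!: sum.neutral)

lemma mat_mult_one_left: "finite K \<Longrightarrow> mat_mult K (mat_one K) x p q = (if p \<in> K then x p q else 0)"
  by (auto simp: mat_mult_def mat_one_def if_distrib[of "\<lambda>y. y * _"] sum.delta cong: if_cong intro!: sum.neutral)

lemma mat_mult_assoc: "mat_mult K (mat_mult K x y) z = mat_mult K x (mat_mult K y z)"
proof (intro ext)
  fix p q
  have "mat_mult K (mat_mult K x y) z p q = (\<Sum>k\<in>K. \<Sum>j\<in>K. x p j * y j k * z k q)"
    by (simp add: mat_mult_def sum_distrib_right)
  also have "\<dots> = (\<Sum>j\<in>K. \<Sum>k\<in>K. x p j * y j k * z k q)" by (rule sum.swap)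
  also have "\<dots> = mat_mult K x (mat_mult K y z) p q"
    by (simp add: mat_mult_def sum_distrib_left mult.assoc)
  finally show "mat_mult K (mat_mult K x y) z p q = mat_mult K x (mat_mult K y z) p q" .
qed

lemma mat_mult_tensor:
  "mat_mult (K \<times> L) (mat_tensor x y) (mat_tensor x' y') = mat_tensor (mat_mult K x x') (mat_mult L y y')"
  by (auto simp: mat_mult_def mat_tensor_def fun_eq_iff sum_product sum.cartesian_product mult_ac
    intro!: sum.cong)

lemma mat_one_tensor: "mat_tensor (mat_one K) (mat_one L) = mat_one (K \<times> L)"
  by (auto simp: mat_one_def mat_tensor_def fun_eq_iff)

lemma mat_mult_add_left: "mat_mult K (x + y) z = mat_mult K x z + mat_mult K y z"
  and mat_mult_add_right: "mat_mult K z (x + y) = mat_mult K z x + mat_mult K z y"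
  by (simp_all add: mat_mult_def fun_eq_iff distrib_right distrib_left sum.distrib)

lemma mat_mult_0 [simp]: "mat_mult K 0 z = 0" "mat_mult K z 0 = 0"
  by (simp_all add: mat_mult_def fun_eq_iff)

text \<open>An arbitrary monoid is allowed so that words and pairs of words are treated alike. That
  the matrices are supported on K \<times> K follows from \<psi>(u) = \<psi>(0) \<psi>(u)
  \<psi>(0).\<close>

locale matrix_rep =
  fixes K :: "'b set" and \<psi> :: "'w::monoid_add \<Rightarrow> 'b matr"
  assumes fin: "finite K"
    and one: "\<psi> 0 = mat_one K"
    and mult: "\<psi> (u + v) = mat_mult K (\<psi> u) (\<psi> v)"
begin

lemma supp: "\<psi> u p q \<noteq> 0 \<Longrightarrow> p \<in> K \<and> q \<in> K"
  using mult[of u 0] mult[of 0 u] mat_mult_one_right[OF fin, of "\<psi> u" p q]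
    mat_mult_one_left[OF fin, of "\<psi> u" p q]
  by (auto simp: one split: if_splits)

lemma lin_supp: "lin \<psi> x p q \<noteq> 0 \<Longrightarrow> p \<in> K \<and> q \<in> K"
proof (rule ccontr)
  assume *: "\<not> (p \<in> K \<and> q \<in> K)"
  then have "\<psi> w p q = 0" for w using supp by blast
  then have "lin \<psi> x p q = 0" by (simp add: lin_def lext_def)
  moreover assume "lin \<psi> x p q \<noteq> 0"
  ultimately show False by simp
qed

lemma lin_1: "lin \<psi> 1 = mat_one K"
  using lin_single_1[of \<psi> 0] by (simp add: one)

lemma lin_mult: "lin \<psi> (x * y) = mat_mult K (lin \<psi> x) (lin \<psi> y)"
proof (induction x rule: poly_mapping_single_induct)
  case (single u c)
  show ?case
  proof (induction y rule: poly_mapping_single_induct)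
    case (single v d)
    show ?case
      by (simp add: mult_single lin_single mult fun_eq_iff mat_mult_def sum_distrib_left mult_ac)
  qed (simp_all only: distrib_left lin_add mat_mult_add_right mult_zero_right lin_0 mat_mult_0)
qed (simp_all only: distrib_right lin_add mat_mult_add_left mult_zero_left lin_0 mat_mult_0)

text \<open>To show that a representation kills a generated ideal, it then suffices to look at the
  generators.\<close>

lemma two_sided_kernel: "two_sided {x. lin \<psi> x = 0}"
  by (simp add: two_sided_def lin_add lin_mult)

end

definition pair_rep :: "('w \<Rightarrow> 'b matr) \<Rightarrow> ('v \<Rightarrow> 'c matr) \<Rightarrow> 'w \<times> 'v \<Rightarrow> ('b \<times> 'c) matr"
  where "pair_rep \<psi> \<chi> = (\<lambda>(u, v). mat_tensor (\<psi> u) (\<chi> v))"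

lemma matrix_rep_pair:
  assumes "matrix_rep K \<psi>" "matrix_rep L \<chi>"
  shows "matrix_rep (K \<times> L) (pair_rep \<psi> \<chi>)"
proof -
  interpret a: matrix_rep K \<psi> by fact
  interpret b: matrix_rep L \<chi> by fact
  show ?thesis
    by standard (auto simp: pair_rep_def zero_prod_def a.fin b.fin a.one b.one a.mult b.mult
      mat_mult_tensor mat_one_tensor)
qed

definition word_rep :: "'b set \<Rightarrow> (letter \<Rightarrow> 'b matr) \<Rightarrow> word \<Rightarrow> 'b matr"
  where "word_rep K L w = foldr (\<lambda>g x. mat_mult K (L g) x) (letters w) (mat_one K)"

lemma matrix_rep_word_rep:
  assumes "finite K"
    and "\<And>g p q. L g p q \<noteq> 0 \<Longrightarrow> p \<in> K"
  shows "matrix_rep K (word_rep K L)"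
proof
  fix u v :: word
  \<comment> \<open>Starting the fold at z instead of the identity multiplies by z from the right;
    the row support of z absorbs the identity matrix. For z the matrix of v this is
    multiplicativity.\<close>
  have "foldr (\<lambda>g x. mat_mult K (L g) x) us z = mat_mult K (word_rep K L (Word us)) z"
    if "\<And>p q. z p q \<noteq> 0 \<Longrightarrow> p \<in> K" for us and z :: "'a matr"
  proof (induction us)
    case Nil
    show ?case using that by (auto simp: word_rep_def mat_mult_one_left[OF assms(1)] fun_eq_iff)
  qed (simp add: word_rep_def mat_mult_assoc)
  moreover have "word_rep K L v p q \<noteq> 0 \<Longrightarrow> p \<in> K" for p q
  proof (cases "letters v")
    case (Cons g l)
    assume "word_rep K L v p q \<noteq> 0"
    then have "(\<Sum>k\<in>K. L g p k * word_rep K L (Word l) k q) \<noteq> 0"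
      by (simp add: Cons word_rep_def mat_mult_def)
    then obtain k where "L g p k \<noteq> 0"
      by (metis (mono_tags, lifting) mult_eq_0_iff sum.neutral)
    then show ?thesis by (rule assms(2))
  qed (auto simp: word_rep_def mat_one_def split: if_splits)
  ultimately show "word_rep K L (u + v) = mat_mult K (word_rep K L u) (word_rep K L v)"
    by (simp add: plus_word_def word_rep_def)
qed (auto simp: assms word_rep_def zero_word_def)

lemma word_induct [case_names Nil Cons]:
  assumes "P 0" "\<And>g w. P w \<Longrightarrow> P (Word [g] + w)"
  shows "P w"
proof (cases w)
  case (Word l)
  have "P (Word l)"
    by (induction l) (use assms in \<open>force simp: zero_word_def plus_word_def\<close>)+
  then show ?thesis using Word by simp
qed

section \<open>The coproduct on the free algebra\<close>

lemma free_tensor_superset: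
  assumes "finite A" "Poly_Mapping.keys x \<subseteq> A" "finite B" "Poly_Mapping.keys y \<subseteq> B"
  shows "free_tensor x y =
    (\<Sum>u\<in>A. \<Sum>v\<in>B. Poly_Mapping.single (u, v) (Poly_Mapping.lookup x u * Poly_Mapping.lookup y v))"
proof -
  have "free_tensor x y = (\<Sum>u\<in>Poly_Mapping.keys x. \<Sum>v\<in>B.
      Poly_Mapping.single (u, v) (Poly_Mapping.lookup x u * Poly_Mapping.lookup y v))"
    unfolding free_tensor_def
    by (intro sum.cong refl sum.mono_neutral_left) (use assms in \<open>auto simp: in_keys_iff\<close>)
  also have "\<dots> = (\<Sum>u\<in>A. \<Sum>v\<in>B.
      Poly_Mapping.single (u, v) (Poly_Mapping.lookup x u * Poly_Mapping.lookup y v))"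
    by (rule sum.mono_neutral_left) (use assms in \<open>auto simp: in_keys_iff\<close>)
  finally show ?thesis .
qed

lemma free_tensor_add_left: "free_tensor (x + x') y = free_tensor x y + free_tensor x' y"
proof -
  let ?A = "Poly_Mapping.keys x \<union> Poly_Mapping.keys x'" and ?B = "Poly_Mapping.keys y"
  show ?thesis
    using free_tensor_superset[of ?A x ?B y] free_tensor_superset[of ?A x' ?B y]
      free_tensor_superset[of ?A "x + x'" ?B y] keys_add[of x x']
    by (simp add: lookup_add distrib_right single_add sum.distrib)
qed

lemma free_tensor_add_right: "free_tensor x (y + y') = free_tensor x y + free_tensor x y'"
proof -
  let ?A = "Poly_Mapping.keys x" and ?B = "Poly_Mapping.keys y \<union> Poly_Mapping.keys y'"
  show ?thesis
    using free_tensor_superset[of ?A x ?B y] free_tensor_superset[of ?A x ?B y']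
      free_tensor_superset[of ?A x ?B "y + y'"] keys_add[of y y']
    by (simp add: lookup_add distrib_left single_add sum.distrib)
qed

lemma free_tensor_0 [simp]: "free_tensor 0 y = 0" "free_tensor x 0 = 0"
  by (simp_all add: free_tensor_def)

lemma free_tensor_single:
  "free_tensor (Poly_Mapping.single u c) (Poly_Mapping.single v d) = Poly_Mapping.single (u, v) (c * d)"
  by (simp add: free_tensor_def)

text \<open>The legs are commuting ring embeddings with
  \<open>free_tensor x y = leg1 x * leg2 y\<close>, so computations with tensors become computations
  in a ring, open to simplification.\<close>

definition leg1 :: "free_alg \<Rightarrow> free_alg2" where "leg1 x = free_tensor x 1"
definition leg2 :: "free_alg \<Rightarrow> free_alg2" where "leg2 x = free_tensor 1 x"

lemma leg_single: "leg1 (Poly_Mapping.single u c) = Poly_Mapping.single (u, 0) c"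
    "leg2 (Poly_Mapping.single u c) = Poly_Mapping.single (0, u) c"
  using free_tensor_single[of u c 0 1] free_tensor_single[of 0 1 u c] by (simp_all add: leg1_def leg2_def)

lemma leg_0 [simp]: "leg1 0 = 0" "leg2 0 = 0"
  by (simp_all add: leg1_def leg2_def)

lemma leg_1 [simp]: "leg1 1 = 1" "leg2 1 = 1"
  using leg_single[of 0 1] by (simp_all flip: zero_prod_def)

lemma leg_add: "leg1 (x + y) = leg1 x + leg1 y" "leg2 (x + y) = leg2 x + leg2 y"
  by (simp_all add: leg1_def leg2_def free_tensor_add_left free_tensor_add_right)

lemma leg_scalar: "leg1 (scalar c) = scalar c" "leg2 (scalar c) = scalar c"
  by (simp_all add: scalar_def leg_single zero_prod_def)

lemma leg_uminus: "leg1 (- x) = - leg1 x" "leg2 (- x) = - leg2 x"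
  using leg_add(1)[of x "- x"] leg_add(2)[of x "- x"] by (simp_all add: eq_neg_iff_add_eq_0 add.commute)

lemma leg_diff: "leg1 (x - y) = leg1 x - leg1 y" "leg2 (x - y) = leg2 x - leg2 y"
  using leg_add(1)[of x "- y"] leg_add(2)[of x "- y"] by (simp_all add: leg_uminus)

lemma leg1_mult: "leg1 (x * y) = leg1 x * leg1 y"
proof (induction x rule: poly_mapping_single_induct)
  case (single u c)
  show ?case
    by (induction y rule: poly_mapping_single_induct)
      (simp_all add: distrib_left leg_add leg_single mult_single)
qed (simp_all add: distrib_right leg_add)

lemma leg2_mult: "leg2 (x * y) = leg2 x * leg2 y"
proof (induction x rule: poly_mapping_single_induct)
  case (single u c)
  show ?case
    by (induction y rule: poly_mapping_single_induct)
      (simp_all add: distrib_left leg_add leg_single mult_single)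
qed (simp_all add: distrib_right leg_add)

lemma leg_power: "leg1 (x ^ k) = leg1 x ^ k" "leg2 (x ^ k) = leg2 x ^ k"
  by (induction k) (simp_all add: leg1_mult leg2_mult)

lemma free_tensor_legs: "free_tensor x y = leg1 x * leg2 y"
proof (induction x rule: poly_mapping_single_induct)
  case (single u c)
  show ?case
    by (induction y rule: poly_mapping_single_induct)
      (simp_all add: distrib_left leg_add leg_single mult_single free_tensor_add_right free_tensor_single)
qed (simp_all add: distrib_right leg_add free_tensor_add_left)

lemma leg_commute: "leg2 y * leg1 x = leg1 x * leg2 y"
proof (induction x rule: poly_mapping_single_induct)
  case (single u c)
  show ?case
    by (induction y rule: poly_mapping_single_induct)
      (simp_all add: distrib_left distrib_right leg_add leg_single mult_single mult.commute)
qed (simp_all add: distrib_right distrib_left leg_add)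

text \<open>Together with associativity this sorts any product so that the first-leg factors precede
  the second-leg factors.\<close>

lemma leg_commute_left: "leg2 y * (leg1 x * z) = leg1 x * (leg2 y * z)"
  by (metis leg_commute mult.assoc)

section \<open>The comultiplication of the free algebra is a ring homomorphism\<close>

definition comult_word :: "word \<Rightarrow> free_alg2"
  where "comult_word w = prod_list (map comult_letter (letters w))"

lemma comult_word_0 [simp]: "comult_word 0 = 1"
  by (simp add: comult_word_def zero_word_def)

lemma comult_word_add: "comult_word (u + v) = comult_word u * comult_word v"
  by (simp add: comult_word_def plus_word_def)

lemma comult_word_letter [simp]: "comult_word (Word [g]) = comult_letter g"
  by (simp add: comult_word_def)

lemma comult_free_superset:
  assumes "finite A" "Poly_Mapping.keys x \<subseteq> A"
  shows "comult_free x = (\<Sum>w\<in>A. scalar (Poly_Mapping.lookup x w) * comult_word w)"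
  unfolding comult_free_def comult_word_def
  by (rule sum.mono_neutral_left) (use assms in \<open>auto simp: in_keys_iff scalar_def\<close>)

lemma comult_free_add: "comult_free (x + y) = comult_free x + comult_free y"
proof -
  let ?A = "Poly_Mapping.keys x \<union> Poly_Mapping.keys y"
  show ?thesis
    using comult_free_superset[of ?A x] comult_free_superset[of ?A y] comult_free_superset[of ?A "x + y"]
      keys_add[of x y]
    by (simp add: lookup_add scalar_add distrib_right sum.distrib)
qed

lemma comult_free_0 [simp]: "comult_free 0 = 0"
  by (simp add: comult_free_def)

lemma comult_free_single: "comult_free (Poly_Mapping.single w c) = scalar c * comult_word w"
  by (simp add: comult_free_def comult_word_def scalar_def)

lemma comult_free_scalar: "comult_free (scalar c) = scalar c"
  by (simp add: scalar_def[of c, where 'w=word] comult_free_single)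

lemma comult_free_1 [simp]: "comult_free 1 = 1"
  using comult_free_scalar[of 1] by simp

lemma comult_free_gen: "comult_free (gen g) = comult_letter g"
  by (simp add: gen_def comult_free_single)

lemma comult_free_mult: "comult_free (x * y) = comult_free x * comult_free y"
proof (induction x rule: poly_mapping_single_induct)
  case (single u c)
  show ?case
  proof (induction y rule: poly_mapping_single_induct)
    case (single v d)
    show ?case
      by (simp add: comult_free_single mult_single comult_word_add scalar_mult mult.assoc)
        (metis mult.assoc scalar_commute)
  qed (simp_all add: distrib_left comult_free_add)
qed (simp_all add: distrib_right comult_free_add)

lemma comult_free_uminus: "comult_free (- x) = - comult_free x"
  using comult_free_add[of x "- x"] by (simp add: eq_neg_iff_add_eq_0 add.commute)

lemma comult_free_diff: "comult_free (x - y) = comult_free x - comult_free y"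
  using comult_free_add[of x "- y"] by (simp add: comult_free_uminus)

lemma comult_free_power: "comult_free (x ^ k) = comult_free x ^ k"
  by (induction k) (simp_all add: comult_free_mult)

section \<open>The involution and the ideal of relations\<close>

lemma free_star_superset:
  assumes "finite A" "Poly_Mapping.keys x \<subseteq> A"
  shows "free_star x = (\<Sum>w\<in>A.
    Poly_Mapping.single (Word (rev (map letter_star (letters w)))) (cnj (Poly_Mapping.lookup x w)))"
  unfolding free_star_def
  by (rule sum.mono_neutral_left) (use assms in \<open>auto simp: in_keys_iff\<close>)

lemma free_star_add: "free_star (x + y) = free_star x + free_star y"
proof -
  let ?A = "Poly_Mapping.keys x \<union> Poly_Mapping.keys y"
  show ?thesis
    using free_star_superset[of ?A x] free_star_superset[of ?A y] free_star_superset[of ?A "x + y"]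
      keys_add[of x y]
    by (simp add: lookup_add single_add sum.distrib)
qed

lemma free_star_single:
  "free_star (Poly_Mapping.single w c) = Poly_Mapping.single (Word (rev (map letter_star (letters w)))) (cnj c)"
  by (simp add: free_star_def)

lemma free_star_0 [simp]: "free_star 0 = 0"
  by (simp add: free_star_def)

lemma free_star_diff: "free_star (x - y) = free_star x - free_star y"
  using free_star_add[of "x - y" y] by (simp add: algebra_simps)

text \<open>The involution swaps the two inverse relations and, up to a scalar, the relations for q
  e and q f; since \<lambda> is real it fixes the commutator relation.\<close>

lemma free_star_relators:
  assumes "r \<in> relators t"
  shows "\<exists>c. \<exists>r'\<in>relators t. free_star r = scalar c * r'"
proof -
  define l where "l = complex_of_real (lam t)"
  define s where "s = inverse (l - inverse l)"
  have l: "l \<noteq> 0" "cnj l = l" "cnj s = s" by (simp_all add: l_def lam_def s_def)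
  define r1 where "r1 = gen Let_q * gen Let_qinv - 1"
  define r2 where "r2 = gen Let_qinv * gen Let_q - 1"
  define r3 where "r3 = gen Let_q * gen Let_e - scalar l * (gen Let_e * gen Let_q)"
  define r4 where "r4 = gen Let_q * gen Let_f - scalar (inverse l) * (gen Let_f * gen Let_q)"
  define r5 where "r5 = gen Let_e * gen Let_f - gen Let_f * gen Let_e -
    scalar s * (gen Let_q ^ 2 - gen Let_qinv ^ 2)"
  have R: "relators t = {r1, r2, r3, r4, r5}"
    by (simp add: relators_def Let_def r1_def r2_def r3_def r4_def r5_def l_def s_def)
  have one: "(1 :: free_alg) = Poly_Mapping.single 0 1" by simp
  note simps = free_star_diff free_star_single scalar_single gen_def mult_single plus_word_def
    power2_eq_square right_diff_distrib l
  have "free_star r1 = scalar 1 * r2" "free_star r2 = scalar 1 * r1"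
    by (simp_all add: r1_def r2_def simps one zero_word_def del: single_one)
  moreover have "free_star r3 = scalar (- l) * r4" "free_star r4 = scalar (- inverse l) * r3"
    by (simp_all add: r3_def r4_def simps scalar_uminus single_uminus)
  moreover have "free_star r5 = scalar 1 * r5"
    by (simp add: r5_def simps)
  ultimately show ?thesis using assms unfolding R by blast
qed

text \<open>The adjoints among the generators of \<open>rel_ideal\<close> are multiples of relators,
  so that only the five relators have to be checked.\<close>

lemma rel_ideal_subset:
  assumes "two_sided J" "relators t \<subseteq> J"
  shows "rel_ideal t \<subseteq> J"
  unfolding rel_ideal_def
proof (rule Idl_minimal[OF assms(1)])
  show "relators t \<union> free_star ` relators t \<subseteq> J"
    using assms(2) free_star_relators[of _ t] two_sided_left[OF assms(1)] by fastforce
qed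

lemma two_sided_rel_ideal: "two_sided (rel_ideal t)" "two_sided (rel_ideal2 t)"
  by (simp_all add: rel_ideal_def rel_ideal2_def two_sided_Idl)

lemma relators_rel_ideal: "r \<in> relators t \<Longrightarrow> r \<in> rel_ideal t"
  by (simp add: rel_ideal_def Idl_gen)

lemma leg_rel_ideal: "x \<in> rel_ideal t \<Longrightarrow> leg1 x \<in> rel_ideal2 t" "x \<in> rel_ideal t \<Longrightarrow> leg2 x \<in> rel_ideal2 t"
  by (auto simp: rel_ideal2_def leg1_def leg2_def intro!: Idl_gen)

section \<open>The comultiplication respects the relations\<close>

definition cong2 :: "real \<Rightarrow> free_alg2 \<Rightarrow> free_alg2 \<Rightarrow> bool"
  where "cong2 t x y \<longleftrightarrow> x - y \<in> rel_ideal2 t"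

lemma cong2_refl: "cong2 t x x"
  by (simp add: cong2_def two_sided_0[OF two_sided_rel_ideal(2)])

lemma cong2_sym: "cong2 t x y \<Longrightarrow> cong2 t y x"
  using two_sided_uminus[OF two_sided_rel_ideal(2), of "x - y" t] by (simp add: cong2_def)

lemma cong2_add: "cong2 t x x' \<Longrightarrow> cong2 t y y' \<Longrightarrow> cong2 t (x + y) (x' + y')"
  using two_sided_add[OF two_sided_rel_ideal(2), of "x - x'" t "y - y'"]
  by (simp add: cong2_def algebra_simps)

lemma cong2_diff: "cong2 t x x' \<Longrightarrow> cong2 t y y' \<Longrightarrow> cong2 t (x - y) (x' - y')"
  using two_sided_diff[OF two_sided_rel_ideal(2), of "x - x'" t "y - y'"]
  by (simp add: cong2_def algebra_simps)

lemma cong2_trans [trans]: "cong2 t x y \<Longrightarrow> cong2 t y z \<Longrightarrow> cong2 t x z"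
  using two_sided_add[OF two_sided_rel_ideal(2), of "x - y" t "y - z"]
  by (simp add: cong2_def)

lemma cong2_mult:
  assumes "cong2 t x x'" "cong2 t y y'"
  shows "cong2 t (x * y) (x' * y')"
proof -
  have "(x - x') * y \<in> rel_ideal2 t" "x' * (y - y') \<in> rel_ideal2 t"
    using assms two_sided_left[OF two_sided_rel_ideal(2)] two_sided_right[OF two_sided_rel_ideal(2)]
    by (auto simp: cong2_def)
  from two_sided_add[OF two_sided_rel_ideal(2) this] show ?thesis
    by (simp add: cong2_def algebra_simps)
qed

lemma cong2_legs:
  assumes "x - y \<in> rel_ideal t"
  shows "cong2 t (leg1 x) (leg1 y)" "cong2 t (leg2 x) (leg2 y)"
  using leg_rel_ideal[OF assms] by (simp_all add: cong2_def leg_diff)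

lemma comult_relators:
  assumes "r \<in> relators t"
  shows "comult_free r \<in> rel_ideal2 t"
proof -
  define l where "l = complex_of_real (lam t)"
  define s where "s = inverse (l - inverse l)"
  have l: "l \<noteq> 0" by (simp add: l_def lam_def)
  define e f q q' where "e = gen Let_e" and "f = gen Let_f" and "q = gen Let_q" and "q' = gen Let_qinv"
  note gens = e_def f_def q_def q'_def
  have R: "relators t = {q * q' - 1, q' * q - 1, q * e - scalar l * (e * q), q * f - scalar (inverse l) * (f * q),
      e * f - f * e - scalar s * (q ^ 2 - q' ^ 2)}"
    by (simp add: relators_def Let_def gens l_def s_def)
  have q: "q * q' - 1 \<in> rel_ideal t" "q' * q - 1 \<in> rel_ideal t"
    and qe: "q * e - scalar l * (e * q) \<in> rel_ideal t"
    and qf: "q * f - scalar (inverse l) * (f * q) \<in> rel_ideal t"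
    and ef: "e * f - f * e - scalar s * (q ^ 2 - q' ^ 2) \<in> rel_ideal t"
    by (rule relators_rel_ideal, simp add: R)+
  have comm: "scalar c * (x * y) = x * (scalar c * y)" for c and x y :: "'w::monoid_add \<Rightarrow>\<^sub>0 complex"
    by (metis mult.assoc scalar_commute)
  \<comment> \<open>These rules move scalars to the front. They are instantiated at the generators
    because the general rule would permute scalars among themselves without end.\<close>
  note sc = comm[of _ e, symmetric] comm[of _ f, symmetric] comm[of _ q, symmetric] comm[of _ q', symmetric]
    scalar_commute[of _ e, symmetric] scalar_commute[of _ f, symmetric]
    scalar_commute[of _ q, symmetric] scalar_commute[of _ q', symmetric]
  note sc2 = comm[of _ "leg1 e", symmetric] comm[of _ "leg1 f", symmetric] comm[of _ "leg1 q", symmetric] comm[of _ "leg1 q'", symmetric]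
    comm[of _ "leg2 e", symmetric] comm[of _ "leg2 f", symmetric] comm[of _ "leg2 q", symmetric] comm[of _ "leg2 q'", symmetric]
  \<comment> \<open>The relation e q' = \<lambda> q' e arises from q e = \<lambda> e q by
    multiplying with q' on both sides; the other two summands remove q' q and q q'. The next
    identity does the same for f.\<close>
  have "q' * (q * e - scalar l * (e * q)) * q' - (q' * q - 1) * (e * q') + scalar l * q' * e * (q * q' - 1)
      = e * q' - scalar l * (q' * e)"
    by (simp add: algebra_simps sc)
  then have eq': "e * q' - scalar l * (q' * e) \<in> rel_ideal t"
    using q qe by (metis two_sided_add two_sided_diff two_sided_left two_sided_right two_sided_rel_ideal(1))
  have "scalar l * ((q' * q - 1) * (f * q') - q' * (q * f - scalar (inverse l) * (f * q)) * q')
      - q' * f * (q * q' - 1) = q' * f - scalar l * (f * q')"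
  proof -
    have "scalar l * (scalar (inverse l) * x) = x" for x :: free_alg
      using l by (simp flip: mult.assoc scalar_mult)
    then show ?thesis by (simp add: algebra_simps sc)
  qed
  then have q'f: "q' * f - scalar l * (f * q') \<in> rel_ideal t"
    using q qf by (metis two_sided_add two_sided_diff two_sided_left two_sided_right two_sided_rel_ideal(1))
  have D: "comult_free e = leg1 q * leg2 e + leg1 e * leg2 q'" "comult_free f = leg1 q * leg2 f + leg1 f * leg2 q'"
    "comult_free q = leg1 q * leg2 q" "comult_free q' = leg1 q' * leg2 q'"
    by (simp_all add: gens comult_free_gen free_tensor_legs)
  note comult = comult_free_diff comult_free_mult comult_free_scalar comult_free_power D
  note legs = leg1_mult leg2_mult leg_diff leg_scalar leg_power
  have c1: "cong2 t (comult_free (q * q')) 1"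
  proof -
    have "comult_free (q * q') = leg1 (q * q') * leg2 (q * q')"
      by (simp add: comult legs mult.assoc leg_commute_left)
    also have "cong2 t \<dots> (leg1 1 * leg2 1)" by (intro cong2_mult cong2_legs q)
    finally show ?thesis by simp
  qed
  have c2: "cong2 t (comult_free (q' * q)) 1"
  proof -
    have "comult_free (q' * q) = leg1 (q' * q) * leg2 (q' * q)"
      by (simp add: comult legs mult.assoc leg_commute_left)
    also have "cong2 t \<dots> (leg1 1 * leg2 1)" by (intro cong2_mult cong2_legs q)
    finally show ?thesis by simp
  qed
  \<comment> \<open>\<Delta>(e) and \<Delta>(f) have the same shape, so one argument serves both,
    with c = \<lambda> and c = 1/\<lambda>.\<close>
  have qx: "cong2 t (comult_free (q * x)) (comult_free (scalar c * (x * q)))"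
    if x: "comult_free x = leg1 q * leg2 x + leg1 x * leg2 q'" and "q * x - scalar c * (x * q) \<in> rel_ideal t"
    for x c
  proof -
    have "comult_free (q * x) = leg1 (q * q) * leg2 (q * x) + leg1 (q * x) * leg2 (q * q')"
      by (simp add: comult x legs algebra_simps leg_commute_left)
    also have "cong2 t \<dots> (leg1 (q * q) * leg2 (scalar c * (x * q)) + leg1 (scalar c * (x * q)) * leg2 1)"
      by (intro cong2_add cong2_mult cong2_refl cong2_legs that q)
    \<comment> \<open>In \<Delta>(q x) the second leg of the last term is q q', in \<Delta>(x q) it
      is q' q; the passage goes through 1.\<close>
    also have "cong2 t \<dots> (leg1 (q * q) * leg2 (scalar c * (x * q)) + leg1 (scalar c * (x * q)) * leg2 (q' * q))"
      by (intro cong2_add cong2_mult cong2_refl cong2_sym[OF cong2_legs(2)] that q)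
    also have "\<dots> = comult_free (scalar c * (x * q))"
      by (simp add: comult x legs algebra_simps leg_commute_left sc2)
    finally show ?thesis .
  qed
  have c5: "cong2 t (comult_free (e * f - f * e)) (comult_free (scalar s * (q ^ 2 - q' ^ 2)))"
  proof -
    \<comment> \<open>The terms are grouped so that a relation applies in each leg. The two cross
      differences cancel because the factors \<lambda> and 1/\<lambda> meet, and the first two terms
      telescope: q^2 \<otimes> (q^2 - q'^2) + (q^2 - q'^2) \<otimes> q'^2 = q^2 \<otimes> q^2 - q'^2
      \<otimes> q'^2.\<close>
    have "comult_free (e * f - f * e) = leg1 (q * q) * leg2 (e * f - f * e) + leg1 (e * f - f * e) * leg2 (q' * q')
        + (leg1 (q * f) * leg2 (e * q') - leg1 (f * q) * leg2 (q' * e))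
        + (leg1 (e * q) * leg2 (q' * f) - leg1 (q * e) * leg2 (f * q'))"
      by (simp add: comult legs algebra_simps leg_commute_left)
    also have "cong2 t \<dots> (leg1 (q * q) * leg2 (scalar s * (q ^ 2 - q' ^ 2)) + leg1 (scalar s * (q ^ 2 - q' ^ 2)) * leg2 (q' * q')
        + (leg1 (scalar (inverse l) * (f * q)) * leg2 (scalar l * (q' * e)) - leg1 (f * q) * leg2 (q' * e))
        + (leg1 (e * q) * leg2 (scalar l * (f * q')) - leg1 (scalar l * (e * q)) * leg2 (f * q')))"
      by (intro cong2_add cong2_diff cong2_mult cong2_refl cong2_legs ef qf qe eq' q'f)
    also have "\<dots> = comult_free (scalar s * (q ^ 2 - q' ^ 2))"
    proof -
      have "scalar (inverse l) * (scalar l * x) = x" for x :: free_alg2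
        using l by (simp flip: mult.assoc scalar_mult)
      then show ?thesis
        by (simp add: comult legs algebra_simps leg_commute_left sc2 power2_eq_square)
    qed
    finally show ?thesis .
  qed
  show ?thesis
    using assms c1 c2 qx[OF D(1) qe] qx[OF D(2) qf] c5 by (auto simp: R cong2_def comult_free_diff)
qed

lemma comult_rel_ideal: "x \<in> rel_ideal t \<Longrightarrow> comult_free x \<in> rel_ideal2 t"
proof -
  have "two_sided {x. comult_free x \<in> rel_ideal2 t}"
    using two_sided_rel_ideal(2)[of t]
    by (auto simp: two_sided_def comult_free_add comult_free_mult)
  from rel_ideal_subset[OF this, of t] comult_relators
  show "x \<in> rel_ideal t \<Longrightarrow> comult_free x \<in> rel_ideal2 t" by blast
qed

section \<open>Products of matrix representations\<close>

lemma lin_comult_free: "lin \<Psi> (comult_free x) = lin (\<lambda>w. lin \<Psi> (comult_word w)) x"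
  by (induction x rule: poly_mapping_single_induct)
    (simp_all only: comult_free_0 lin_0 comult_free_single lin_scalar lin_single comult_free_add lin_add)

text \<open>This is (\<psi> \<otimes> \<chi>)\<Delta> on words. It is again a family of matrices
  indexed by words, so the construction can be iterated.\<close>

definition cprod :: "(word \<Rightarrow> 'b matr) \<Rightarrow> (word \<Rightarrow> 'c matr) \<Rightarrow> word \<Rightarrow> ('b \<times> 'c) matr"
  where "cprod \<psi> \<chi> w = lin (pair_rep \<psi> \<chi>) (comult_word w)"

lemma lin_cprod: "lin (cprod \<psi> \<chi>) x = lin (pair_rep \<psi> \<chi>) (comult_free x)"
  by (simp add: lin_comult_free cprod_def[abs_def])

lemma matrix_rep_cprod:
  assumes "matrix_rep K \<psi>" "matrix_rep L \<chi>"
  shows "matrix_rep (K \<times> L) (cprod \<psi> \<chi>)"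
proof -
  interpret matrix_rep "K \<times> L" "pair_rep \<psi> \<chi>" by (rule matrix_rep_pair[OF assms])
  show ?thesis
    by standard (simp_all only: fin cprod_def comult_word_0 lin_1 comult_word_add lin_mult)
qed

lemma lin_pair_gen: "lin (pair_rep \<psi> \<chi>) (free_tensor (gen g) (gen h)) = mat_tensor (\<psi> (Word [g])) (\<chi> (Word [h]))"
  by (simp add: gen_def free_tensor_single pair_rep_def)

lemma cprod_letter:
  "cprod \<psi> \<chi> (Word [Let_q]) = mat_tensor (\<psi> (Word [Let_q])) (\<chi> (Word [Let_q]))"
  "cprod \<psi> \<chi> (Word [Let_qinv]) = mat_tensor (\<psi> (Word [Let_qinv])) (\<chi> (Word [Let_qinv]))"
  "cprod \<psi> \<chi> (Word [Let_e]) = mat_tensor (\<psi> (Word [Let_q])) (\<chi> (Word [Let_e]))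
     + mat_tensor (\<psi> (Word [Let_e])) (\<chi> (Word [Let_qinv]))"
  "cprod \<psi> \<chi> (Word [Let_f]) = mat_tensor (\<psi> (Word [Let_q])) (\<chi> (Word [Let_f]))
     + mat_tensor (\<psi> (Word [Let_f])) (\<chi> (Word [Let_qinv]))"
  by (simp_all only: cprod_def comult_word_letter comult_letter.simps lin_add lin_pair_gen)

text \<open>Multiplicativity reduces the comparison of two representations to single letters; the
  bijection matches the intermediate indices. Used for reassociating triple products and for
  tensoring with the trivial representation.\<close>

lemma matrix_rep_relabel:
  assumes "matrix_rep K \<psi>" "matrix_rep L \<chi>" "bij_betw h K L"
    and "\<And>g p q. p \<in> K \<Longrightarrow> q \<in> K \<Longrightarrow> \<psi> (Word [g]) p q = \<chi> (Word [g]) (h p) (h q)"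
    and "p \<in> K" "q \<in> K"
  shows "\<psi> w p q = \<chi> w (h p) (h q)"
  using assms(5,6)
proof (induction w arbitrary: p q rule: word_induct)
  case Nil
  then show ?case
    using bij_betw_imp_inj_on[OF assms(3)] bij_betwE[OF assms(3)]
    by (auto simp: matrix_rep.one[OF assms(1)] matrix_rep.one[OF assms(2)] mat_one_def inj_on_def)
next
  case (Cons g w)
  have "\<psi> (Word [g] + w) p q = (\<Sum>k\<in>K. \<chi> (Word [g]) (h p) (h k) * \<chi> w (h k) (h q))"
    using Cons by (simp add: matrix_rep.mult[OF assms(1)] mat_mult_def assms(4))
  also have "\<dots> = (\<Sum>k\<in>L. \<chi> (Word [g]) (h p) k * \<chi> w k (h q))"
    by (rule sum.reindex_bij_betw[OF assms(3)])
  finally show ?case by (simp add: matrix_rep.mult[OF assms(2)] mat_mult_def)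
qed

text \<open>Coassociativity of \<Delta> on generators: both bracketings send e to q \<otimes> q
  \<otimes> e + q \<otimes> e \<otimes> q' + e \<otimes> q' \<otimes> q', likewise f, and q and q'
  are group-like.\<close>

lemma cprod_assoc:
  assumes a: "matrix_rep K a" and b: "matrix_rep L b" and c: "matrix_rep M c"
  shows "cprod (cprod a b) c w ((p, p'), p'') ((q, q'), q'') = cprod a (cprod b c) w (p, p', p'') (q, q', q'')"
proof -
  note l = matrix_rep_cprod[OF matrix_rep_cprod[OF a b] c] and r = matrix_rep_cprod[OF a matrix_rep_cprod[OF b c]]
  let ?h = "\<lambda>((x, y), z). (x, y, z)"
  have bij: "bij_betw ?h ((K \<times> L) \<times> M) (K \<times> L \<times> M)"
    by (rule bij_betw_byWitness[where f' = "\<lambda>(x, y, z). ((x, y), z)"]) auto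
  have "cprod (cprod a b) c w P Q = cprod a (cprod b c) w (?h P) (?h Q)"
    if "P \<in> (K \<times> L) \<times> M" "Q \<in> (K \<times> L) \<times> M" for P Q
  proof (rule matrix_rep_relabel[OF l r bij _ that])
    fix g P Q
    show "cprod (cprod a b) c (Word [g]) P Q = cprod a (cprod b c) (Word [g]) (?h P) (?h Q)"
      by (cases P; cases Q; cases g) (auto simp: cprod_letter mat_tensor_def algebra_simps)
  qed
  \<comment> \<open>Off the index sets both entries are 0 by \<open>supp\<close>.\<close>
  from this[of "((p, p'), p'')" "((q, q'), q'')"]
  show ?thesis
    using matrix_rep.supp[OF l, of w "((p, p'), p'')" "((q, q'), q'')"]
      matrix_rep.supp[OF r, of w "(p, p', p'')" "(q, q', q'')"] by fastforce
qed

section \<open>Representations compatible with the involution\<close>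

definition word_star :: "word \<Rightarrow> word"
  where "word_star w = Word (rev (map letter_star (letters w)))"

lemma word_star_add: "word_star (u + v) = word_star v + word_star u"
  by (simp add: word_star_def plus_word_def)

definition star_rep :: "(word \<Rightarrow> 'b matr) \<Rightarrow> bool"
  where "star_rep \<psi> \<longleftrightarrow> (\<forall>w p q. \<psi> (word_star w) p q = cnj (\<psi> w q p))"

lemma star_repI:
  assumes "matrix_rep K \<psi>"
    and "\<And>g p q. \<psi> (Word [letter_star g]) p q = cnj (\<psi> (Word [g]) q p)"
  shows "star_rep \<psi>"
proof -
  interpret matrix_rep K \<psi> by fact
  have "\<psi> (word_star w) p q = cnj (\<psi> w q p)" for w p q
  proof (induction w arbitrary: p q rule: word_induct)
    case Nil
    have "word_star 0 = 0" by (simp add: word_star_def zero_word_def)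
    then show ?case by (auto simp: one mat_one_def)
  next
    case (Cons g w)
    have "word_star (Word [g]) = Word [letter_star g]" by (simp add: word_star_def)
    then show ?case by (simp add: word_star_add mult mat_mult_def Cons assms(2) mult.commute)
  qed
  then show ?thesis by (simp add: star_rep_def)
qed

lemma lin_free_star:
  assumes "star_rep \<psi>"
  shows "lin \<psi> (free_star x) p q = cnj (lin \<psi> x q p)"
proof (induction x rule: poly_mapping_single_induct)
  case (single w c)
  have "\<psi> (Word (rev (map letter_star (letters w)))) p q = cnj (\<psi> w q p)"
    using assms by (simp add: star_rep_def word_star_def)
  then show ?case by (simp add: free_star_single lin_single)
qed (simp_all add: free_star_add lin_add)

lemma star_rep_cprod:
  assumes "matrix_rep K \<psi>" "matrix_rep L \<chi>" "star_rep \<psi>" "star_rep \<chi>"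
  shows "star_rep (cprod \<psi> \<chi>)"
proof (rule star_repI[OF matrix_rep_cprod[OF assms(1,2)]])
  have *: "\<psi> (Word [letter_star g]) p q = cnj (\<psi> (Word [g]) q p)"
    "\<chi> (Word [letter_star g]) p' q' = cnj (\<chi> (Word [g]) q' p')" for g p q p' q'
    using assms(3,4)[unfolded star_rep_def, rule_format, of "Word [g]"] by (simp_all add: word_star_def)
  show "cprod \<psi> \<chi> (Word [letter_star g]) p q = cnj (cprod \<psi> \<chi> (Word [g]) q p)" for g p q
    by (cases p; cases q; cases g) (simp_all add: cprod_letter mat_tensor_def *[symmetric])
qed

section \<open>Slices of the comultiplication\<close>

definition slice_left :: "(word \<Rightarrow> complex) \<Rightarrow> free_alg2 \<Rightarrow> free_alg"
  where "slice_left f y = (\<Sum>(u, v)\<in>Poly_Mapping.keys y.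
    Poly_Mapping.single v (Poly_Mapping.lookup y (u, v) * f u))"

definition slice_right :: "(word \<Rightarrow> complex) \<Rightarrow> free_alg2 \<Rightarrow> free_alg"
  where "slice_right f y = (\<Sum>(u, v)\<in>Poly_Mapping.keys y.
    Poly_Mapping.single u (Poly_Mapping.lookup y (u, v) * f v))"

lemma lin_slice_left:
  "lin \<psi> (slice_left f y) p q = lext (\<lambda>(u, v). f u * \<psi> v p q) y"
  by (simp add: lin_def slice_left_def lext_sum case_prod_beta mult.assoc)
    (simp add: lext_def case_prod_beta)

lemma lin_slice_right:
  "lin \<psi> (slice_right f y) p q = lext (\<lambda>(u, v). f v * \<psi> u p q) y"
  by (simp add: lin_def slice_right_def lext_sum case_prod_beta mult.assoc)
    (simp add: lext_def case_prod_beta)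

text \<open>Fixing an entry in the first leg of (\<psi> \<otimes> \<chi>)\<Delta>(x) gives \<chi> of
  an element of the free algebra that does not depend on \<chi>. Hence one element realises the
  slice in all representations \<chi> at once.\<close>

lemma lin_cprod_slice_left:
  "lin (cprod \<psi> \<chi>) x (r, p) (s, q) = lin \<chi> (slice_left (\<lambda>u. \<psi> u r s) (comult_free x)) p q"
  unfolding lin_slice_left lin_cprod unfolding lin_def by (simp add: pair_rep_def mat_tensor_def case_prod_unfold)

lemma lin_cprod_slice_right:
  "lin (cprod \<psi> \<chi>) x (p, r) (q, s) = lin \<psi> (slice_right (\<lambda>v. \<chi> v r s) (comult_free x)) p q"
  unfolding lin_slice_right lin_cprod unfolding lin_def
  by (simp add: pair_rep_def mat_tensor_def case_prod_unfold mult.commute)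

section \<open>Spins, weights and ladder coefficients\<close>

text \<open>Here and in the next two lemmas an index set is described by inequalities and an
  integrality condition, so that half-integer arguments become arithmetic in
  \<open>Ints\<close>.\<close>

lemma spins_iff: "n \<in> spins \<longleftrightarrow> 0 \<le> n \<and> 2 * n \<in> \<int>"
proof
  assume "n \<in> spins"
  then obtain i :: nat where "n = real i / 2" by (auto simp: spins_def)
  then have "2 * n = real i" "0 \<le> n" by simp_all
  then show "0 \<le> n \<and> 2 * n \<in> \<int>" by (metis Ints_of_nat)
next
  assume *: "0 \<le> n \<and> 2 * n \<in> \<int>"
  then obtain k :: int where k: "2 * n = of_int k" by (auto elim: Ints_cases)
  with * have "k \<ge> 0" by linarith
  then have "n = real (nat k) / 2" using k by simp
  then show "n \<in> spins" unfolding spins_def by blast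
qed

lemma weights_iff: "j \<in> weights n \<longleftrightarrow> - n \<le> j \<and> j \<le> n \<and> n + j \<in> \<int>"
proof
  assume *: "- n \<le> j \<and> j \<le> n \<and> n + j \<in> \<int>"
  then obtain k :: int where k: "n + j = of_int k" by (auto elim: Ints_cases)
  with * have "k \<ge> 0" by linarith
  then have "j = - n + real (nat k)" using k by simp
  then show "j \<in> weights n" unfolding weights_def using * by blast
qed (auto simp: weights_def)

lemma cg_spins_iff: "k \<in> cg_spins n m \<longleftrightarrow> \<bar>n - m\<bar> \<le> k \<and> k \<le> n + m \<and> k - \<bar>n - m\<bar> \<in> \<int>"
proof
  assume *: "\<bar>n - m\<bar> \<le> k \<and> k \<le> n + m \<and> k - \<bar>n - m\<bar> \<in> \<int>"
  then obtain i :: int where i: "k - \<bar>n - m\<bar> = of_int i" by (auto elim: Ints_cases)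
  with * have "i \<ge> 0" by linarith
  then have "k = \<bar>n - m\<bar> + real (nat i)" using i by simp
  then show "k \<in> cg_spins n m" unfolding cg_spins_def using * by blast
qed (auto simp: cg_spins_def)

lemma finite_weights [simp]: "finite (weights n)"
proof -
  have "weights n \<subseteq> (\<lambda>i. - n + real i) ` {..nat \<lceil>2 * n\<rceil>}"
  proof
    fix j assume "j \<in> weights n"
    then obtain i :: nat where i: "j = - n + real i" "j \<le> n" by (auto simp: weights_def)
    then have "real i \<le> 2 * n" by simp
    then have "i \<le> nat \<lceil>2 * n\<rceil>" by linarith
    then show "j \<in> (\<lambda>i. - n + real i) ` {..nat \<lceil>2 * n\<rceil>}" using i by auto
  qed
  then show ?thesis by (rule finite_subset) simp
qed

lemma weights_top: "n \<in> spins \<Longrightarrow> n \<in> weights n"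
  and weights_bot: "n \<in> spins \<Longrightarrow> - n \<in> weights n"
  by (auto simp: weights_iff spins_iff)

lemma weights_uminus: "n \<in> spins \<Longrightarrow> j \<in> weights n \<Longrightarrow> - j \<in> weights n"
proof -
  assume "n \<in> spins" "j \<in> weights n"
  then show ?thesis
    using Ints_diff[of "2 * n" "n + j"] by (auto simp: weights_iff spins_iff)
qed

lemma weights_uminus_iff: "n \<in> spins \<Longrightarrow> - j \<in> weights n \<longleftrightarrow> j \<in> weights n"
  using weights_uminus[of n j] weights_uminus[of n "- j"] by auto

lemma weights_less_top:
  assumes "n \<in> spins" "j \<in> weights n" "j \<noteq> n"
  shows "j + 1 \<le> n"
proof -
  obtain k l :: int where kl: "2 * n = of_int k" "n + j = of_int l"
    using assms by (auto simp: weights_iff spins_iff elim!: Ints_cases)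
  moreover have "j < n" using assms by (auto simp: weights_iff)
  ultimately have "l < k" by linarith
  then have "real_of_int l + 1 \<le> of_int k" by linarith
  then show ?thesis using kl by linarith
qed

lemma weights_Suc: "n \<in> spins \<Longrightarrow> j \<in> weights n \<Longrightarrow> j \<noteq> n \<Longrightarrow> j + 1 \<in> weights n"
  using weights_less_top[of n j] Ints_add[of "n + j" 1]
  by (auto simp: weights_iff add.assoc)

lemma weights_pred: "n \<in> spins \<Longrightarrow> j \<in> weights n \<Longrightarrow> j \<noteq> - n \<Longrightarrow> j - 1 \<in> weights n"
  using weights_Suc[of n "- j"] weights_uminus[of n "- j + 1"] weights_uminus[of n j] by auto

lemma weights_0: "weights 0 = {0}"
  by (auto simp: weights_iff)

lemma cg_spins_spin:
  assumes "n \<in> spins" "m \<in> spins" "k \<in> cg_spins n m"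
  shows "k \<in> spins"
proof -
  obtain a b c :: int where "2 * n = of_int a" "2 * m = of_int b" "k - \<bar>n - m\<bar> = of_int c"
    using assms by (auto simp: spins_iff cg_spins_iff elim!: Ints_cases)
  then have "2 * k = of_int (2 * c + \<bar>a - b\<bar>)" by (simp add: abs_if split: if_splits)
  then have "2 * k \<in> \<int>" by (metis Ints_of_int)
  then show ?thesis using assms by (auto simp: spins_iff cg_spins_iff)
qed

lemma cg_spins_0: "m \<in> spins \<Longrightarrow> cg_spins 0 m = {m}" "m \<in> spins \<Longrightarrow> cg_spins m 0 = {m}"
  by (auto simp: cg_spins_iff spins_iff)

section \<open>Quantum integers and the closed form of the ladder coefficients\<close>

definition qint :: "real \<Rightarrow> real \<Rightarrow> real"
  where "qint t x = sinh (t * x) / sinh t"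

text \<open>With [x] = \<open>qint t x\<close> = (\<lambda>^x - \<lambda>^(-x)) / (\<lambda> -
  1/\<lambda>) this is the classical solution r_j = sqrt([n-j][n+j+1]) of the recursion. It vanishes
  at j = n and at j = -n-1, which takes care of both ends of the ladder.\<close>

definition rung :: "real \<Rightarrow> real \<Rightarrow> real \<Rightarrow> real"
  where "rung t n j = sqrt (qint t (n - j) * qint t (n + j + 1))"

lemma qint_0 [simp]: "qint t 0 = 0"
  by (simp add: qint_def)

lemma rung_top [simp]: "rung t n n = 0"
  by (simp add: rung_def)

lemma rung_bot [simp]: "rung t n (- n - 1) = 0"
  by (simp add: rung_def)

lemma rung_reflect: "rung t n (- j - 1) = rung t n j"
  by (simp add: rung_def algebra_simps)

lemma powr_lam: "lam t powr x = exp (t * x)"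
  by (simp add: lam_def powr_def mult.commute)

lemma lam_inverse: "lam t - inverse (lam t) = 2 * sinh t"
  by (simp add: lam_def sinh_def exp_minus scaleR_conv_of_real)

lemma qint_lam: "inverse (lam t - inverse (lam t)) * (lam t powr (2 * j) - lam t powr (- 2 * j)) = qint t (2 * j)"
  unfolding powr_lam lam_inverse qint_def sinh_def[of "t * (2 * j)"]
  by (simp add: scaleR_conv_of_real inverse_eq_divide)

lemma qint_nonneg: "t > 0 \<Longrightarrow> x \<ge> 0 \<Longrightarrow> qint t x \<ge> 0"
  by (simp add: qint_def)

lemma qint_pos: "t > 0 \<Longrightarrow> x > 0 \<Longrightarrow> qint t x > 0"
  by (simp add: qint_def)

lemma rung_pos: "t > 0 \<Longrightarrow> - n - 1 < j \<Longrightarrow> j < n \<Longrightarrow> rung t n j > 0"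
  by (simp add: rung_def qint_pos)

lemma rung_nonneg: "t > 0 \<Longrightarrow> - n - 1 \<le> j \<Longrightarrow> j \<le> n \<Longrightarrow> rung t n j \<ge> 0"
  by (simp add: rung_def qint_nonneg)

lemma rung_square: "t > 0 \<Longrightarrow> - n - 1 \<le> j \<Longrightarrow> j \<le> n \<Longrightarrow> (rung t n j)\<^sup>2 = qint t (n - j) * qint t (n + j + 1)"
  by (simp add: rung_def qint_nonneg)

lemma sinh_product: "sinh (x + y) * sinh (x - y) = (sinh x)\<^sup>2 - (sinh y)\<^sup>2" for x y :: real
proof -
  have "sinh (x + y) * sinh (x - y) = (sinh x)\<^sup>2 * (cosh y)\<^sup>2 - (cosh x)\<^sup>2 * (sinh y)\<^sup>2"
    unfolding sinh_add sinh_diff by (simp add: algebra_simps power2_eq_square)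
  also have "\<dots> = (sinh x)\<^sup>2 - (sinh y)\<^sup>2"
    unfolding cosh_square_eq by (simp add: algebra_simps)
  finally show ?thesis .
qed

lemma qint_ladder:
  assumes "t > 0"
  shows "qint t (n - j + 1) * qint t (n + j) - qint t (n - j) * qint t (n + j + 1) = qint t (2 * j)"
proof -
  have s: "sinh t \<noteq> 0" using assms by simp
  \<comment> \<open>Chosen so that the arguments are a+b, a-b, a+c and a-c. By
    \<open>sinh_product\<close> the squares of sinh a cancel, and the rest factors with c+b = 2tj
    and c-b = t.\<close>
  define a b c where "a = t * n + t / 2" and "b = t * j - t / 2" and "c = t * j + t / 2"
  have "sinh (t * (n - j + 1)) * sinh (t * (n + j)) - sinh (t * (n - j)) * sinh (t * (n + j + 1))
      = sinh (a + b) * sinh (a - b) - sinh (a + c) * sinh (a - c)"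
    by (simp add: a_def b_def c_def algebra_simps)
  also have "\<dots> = sinh (c + b) * sinh (c - b)"
    by (simp add: sinh_product)
  also have "\<dots> = sinh (t * (2 * j)) * sinh t"
    by (simp add: b_def c_def algebra_simps)
  finally have "(sinh (t * (n - j + 1)) * sinh (t * (n + j)) - sinh (t * (n - j)) * sinh (t * (n + j + 1)))
      / (sinh t * sinh t) = sinh (t * (2 * j)) * sinh t / (sinh t * sinh t)"
    by simp
  then show ?thesis
    using s by (simp add: qint_def diff_divide_distrib)
qed

lemma rung_step:
  assumes "t > 0" "- n \<le> j" "j \<le> n"
  shows "(rung t n (j - 1))\<^sup>2 - (rung t n j)\<^sup>2 = qint t (2 * j)"
  using rung_square[of t n "j - 1"] rung_square[of t n j] qint_ladder[of t n j] assms
  by (simp add: algebra_simps)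

lemma is_ladder_rung:
  assumes "t > 0" "n \<in> spins"
  shows "is_ladder t n (rung t n)"
  using assms rung_step[of t n] unfolding is_ladder_def qint_lam
  by (auto simp: weights_iff intro!: rung_pos)

lemma ladder_eq:
  assumes t: "t > 0" and n: "n \<in> spins" and "j \<in> weights n"
  shows "ladder t n j = rung t n j"
proof -
  define r where "r = ladder t n"
  have r: "is_ladder t n r"
    unfolding r_def ladder_def by (rule someI[of "is_ladder t n", OF is_ladder_rung[OF t n]])
  \<comment> \<open>Induction runs down from the top: r n = 0 is the initial value, and the
    recursion yields the square of r (j-1) from that of r j.\<close>
  have "r (n - real i) = rung t n (n - real i)" if "n - real i \<in> weights n" for i
    using that
  proof (induction i)
    case 0
    then show ?case using r by (simp add: is_ladder_def)
  next
    case (Suc i)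
    let ?j = "n - real i"
    have w: "?j \<in> weights n" "- n < ?j"
      using Suc.prems n weights_Suc[OF n Suc.prems] by (auto simp: weights_iff algebra_simps)
    have "(r (?j - 1))\<^sup>2 - (r ?j)\<^sup>2 = qint t (2 * ?j)"
      using r w unfolding is_ladder_def qint_lam by blast
    then have "(r (?j - 1))\<^sup>2 = (rung t n (?j - 1))\<^sup>2"
      using rung_step[OF t, of n ?j] w Suc.IH[OF w(1)] by (simp add: weights_iff)
    moreover have "r (?j - 1) > 0"
      using r Suc.prems unfolding is_ladder_def by (auto simp: algebra_simps)
    moreover have "rung t n (?j - 1) \<ge> 0"
      using Suc.prems by (intro rung_nonneg[OF t]) (auto simp: weights_iff algebra_simps)
    \<comment> \<open>The squares agree, and the sign conditions single out the same root.\<close>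
    ultimately have "r (?j - 1) = rung t n (?j - 1)" by (simp add: power2_eq_iff)
    then show ?case by (simp add: algebra_simps)
  qed
  moreover obtain i :: nat where "j = n - real i"
  proof -
    obtain k l :: int where kl: "2 * n = of_int k" "n + j = of_int l"
      using assms by (auto simp: weights_iff spins_iff elim!: Ints_cases)
    then have "j = n - of_int (k - l)" by simp
    moreover have "k - l \<ge> 0" using assms kl by (simp add: weights_iff)
    ultimately have "j = n - real (nat (k - l))" by simp
    then show thesis by (rule that)
  qed
  ultimately show ?thesis using assms by (simp add: r_def)
qed

section \<open>The matrices of the generators and the relations they satisfy\<close>

lemma rep_letter_eq:
  assumes "t > 0" "n \<in> spins"
  shows "rep_letter t n Let_q = (\<lambda>i j. if i \<in> weights n \<and> i = j then complex_of_real (exp (t * i)) else 0)"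
    and "rep_letter t n Let_qinv = (\<lambda>i j. if i \<in> weights n \<and> i = j then complex_of_real (exp (- t * i)) else 0)"
    and "rep_letter t n Let_e = (\<lambda>i j. if i \<in> weights n \<and> j \<in> weights n \<and> i = j + 1
      then complex_of_real (rung t n j) else 0)"
    and "rep_letter t n Let_f = (\<lambda>i j. if i \<in> weights n \<and> j \<in> weights n \<and> i = j - 1
      then complex_of_real (rung t n i) else 0)"
proof -
  have "j \<in> weights n \<and> j \<noteq> n \<and> i = j + 1 \<longleftrightarrow> i \<in> weights n \<and> j \<in> weights n \<and> i = j + 1" for i j
    using weights_Suc[OF assms(2), of j] by (auto simp: weights_iff)
  then show "rep_letter t n Let_e = (\<lambda>i j. if i \<in> weights n \<and> j \<in> weights n \<and> i = j + 1
      then complex_of_real (rung t n j) else 0)"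
    using ladder_eq[OF assms] by (auto simp: fun_eq_iff)
  have "j \<in> weights n \<and> j \<noteq> - n \<and> i = j - 1 \<longleftrightarrow> i \<in> weights n \<and> j \<in> weights n \<and> i = j - 1" for i j
    using weights_pred[OF assms(2), of j] by (auto simp: weights_iff)
  then show "rep_letter t n Let_f = (\<lambda>i j. if i \<in> weights n \<and> j \<in> weights n \<and> i = j - 1
      then complex_of_real (rung t n i) else 0)"
    using ladder_eq[OF assms] by (auto simp: fun_eq_iff)
qed (auto simp: fun_eq_iff powr_lam)

declare rep_letter.simps [simp del]

lemma rep_word_eq: "rep_word t n = word_rep (weights n) (rep_letter t n)"
  by (simp add: fun_eq_iff rep_word_def word_rep_def)

lemma matrix_rep_rep_word:
  assumes "t > 0" "n \<in> spins"
  shows "matrix_rep (weights n) (rep_word t n)"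
  unfolding rep_word_eq
proof (rule matrix_rep_word_rep)
  show "rep_letter t n g p q \<noteq> 0 \<Longrightarrow> p \<in> weights n" for g p q
    by (cases g) (auto simp: rep_letter_eq[OF assms] split: if_splits)
qed simp

lemma rep_word_letter:
  assumes "t > 0" "n \<in> spins"
  shows "rep_word t n (Word [g]) = rep_letter t n g"
proof -
  have "rep_letter t n g p q \<noteq> 0 \<Longrightarrow> q \<in> weights n" for p q
    by (cases g) (auto simp: rep_letter_eq[OF assms] split: if_splits)
  then show ?thesis
    by (auto simp: rep_word_def mat_mult_one_right fun_eq_iff)
qed

lemma rep_free_eq: "rep_free t n = lin (rep_word t n)"
  by (simp add: fun_eq_iff rep_free_def lin_def lext_def)

lemma rep2_free_eq: "rep2_free t n m = lin (pair_rep (rep_word t n) (rep_word t m))"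
  by (simp add: fun_eq_iff rep2_free_def lin_def lext_def pair_rep_def case_prod_beta)

lemma star_rep_rep_word:
  assumes "t > 0" "n \<in> spins"
  shows "star_rep (rep_word t n)"
proof (rule star_repI[OF matrix_rep_rep_word[OF assms]])
  show "rep_word t n (Word [letter_star g]) p q = cnj (rep_word t n (Word [g]) q p)" for g p q
    by (cases g) (auto simp: rep_word_letter[OF assms] rep_letter_eq[OF assms])
qed

lemma mat_mult_diag_left:
  assumes "finite K"
  shows "mat_mult K (\<lambda>i j. if i \<in> K \<and> i = j then d i else 0) y = (\<lambda>i j. if i \<in> K then d i * y i j else 0)"
proof (intro ext)
  fix i j
  have "mat_mult K (\<lambda>i j. if i \<in> K \<and> i = j then d i else 0) y i j
      = (\<Sum>k\<in>K. if i = k then (if i \<in> K then d i * y i j else 0) else 0)"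
    unfolding mat_mult_def by (rule sum.cong) auto
  then show "mat_mult K (\<lambda>i j. if i \<in> K \<and> i = j then d i else 0) y i j = (if i \<in> K then d i * y i j else 0)"
    by (simp add: sum.delta'[OF assms])
qed

text \<open>The ends of the ladder need no extra clause: where i-1 or i+1 leaves the weights,
  \<open>rung\<close> is 0 and the stray entry of y is multiplied by 0.\<close>

lemma rep_letter_relations:
  assumes "t > 0" "n \<in> spins"
  defines "M \<equiv> mat_mult (weights n)"
    and "L \<equiv> rep_letter t n"
  shows "M (L Let_q) y = (\<lambda>i j. if i \<in> weights n then complex_of_real (exp (t * i)) * y i j else 0)"
    and "M (L Let_qinv) y = (\<lambda>i j. if i \<in> weights n then complex_of_real (exp (- t * i)) * y i j else 0)"
    and "M (L Let_e) y = (\<lambda>i j. if i \<in> weights n then complex_of_real (rung t n (i - 1)) * y (i - 1) j else 0)"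
    and "M (L Let_f) y = (\<lambda>i j. if i \<in> weights n then complex_of_real (rung t n i) * y (i + 1) j else 0)"
proof -
  show "M (L Let_q) y = (\<lambda>i j. if i \<in> weights n then complex_of_real (exp (t * i)) * y i j else 0)"
    "M (L Let_qinv) y = (\<lambda>i j. if i \<in> weights n then complex_of_real (exp (- t * i)) * y i j else 0)"
    unfolding M_def L_def rep_letter_eq[OF assms(1,2)] by (simp_all add: mat_mult_diag_left)
  show "M (L Let_e) y = (\<lambda>i j. if i \<in> weights n then complex_of_real (rung t n (i - 1)) * y (i - 1) j else 0)"
  proof (intro ext)
    fix i j
    have "M (L Let_e) y i j = (\<Sum>k\<in>weights n. if i - 1 = k
        then (if i \<in> weights n then complex_of_real (rung t n (i - 1)) * y (i - 1) j else 0) else 0)"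
      unfolding M_def L_def mat_mult_def rep_letter_eq[OF assms(1,2)] by (rule sum.cong) auto
    also have "\<dots> = (if i - 1 \<in> weights n then
        (if i \<in> weights n then complex_of_real (rung t n (i - 1)) * y (i - 1) j else 0) else 0)"
      by (simp add: sum.delta')
    also have "\<dots> = (if i \<in> weights n then complex_of_real (rung t n (i - 1)) * y (i - 1) j else 0)"
      using weights_pred[OF assms(2), of i] by (cases "i = - n") auto
    finally show "M (L Let_e) y i j = (if i \<in> weights n then complex_of_real (rung t n (i - 1)) * y (i - 1) j else 0)" .
  qed
  show "M (L Let_f) y = (\<lambda>i j. if i \<in> weights n then complex_of_real (rung t n i) * y (i + 1) j else 0)"
  proof (intro ext)
    fix i j
    have "M (L Let_f) y i j = (\<Sum>k\<in>weights n. if i + 1 = k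
        then (if i \<in> weights n then complex_of_real (rung t n i) * y (i + 1) j else 0) else 0)"
      unfolding M_def L_def mat_mult_def rep_letter_eq[OF assms(1,2)] by (rule sum.cong) auto
    also have "\<dots> = (if i + 1 \<in> weights n then
        (if i \<in> weights n then complex_of_real (rung t n i) * y (i + 1) j else 0) else 0)"
      by (simp add: sum.delta')
    also have "\<dots> = (if i \<in> weights n then complex_of_real (rung t n i) * y (i + 1) j else 0)"
      using weights_Suc[OF assms(2), of i] by (cases "i = n") auto
    finally show "M (L Let_f) y i j = (if i \<in> weights n then complex_of_real (rung t n i) * y (i + 1) j else 0)" .
  qed
qed

lemma exp_pow_simps:
  "complex_of_real (exp (t * j)) * (complex_of_real (exp (- t * j)) * z) = z"
  "complex_of_real (exp (- t * j)) * (complex_of_real (exp (t * j)) * z) = z"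
  by (simp_all add: exp_minus flip: mult.assoc of_real_mult)

lemma lin_gen: "lin \<psi> (gen g) = \<psi> (Word [g])"
  by (simp add: gen_def)

lemma rep_relators:
  assumes t: "t > 0" and n: "n \<in> spins" and "r \<in> relators t"
  shows "lin (rep_word t n) r = 0"
proof -
  interpret matrix_rep "weights n" "rep_word t n" by (rule matrix_rep_rep_word[OF t n])
  let ?l = "complex_of_real (lam t)"
  define s where "s = inverse (?l - inverse ?l)"
  note simps = lin_diff lin_mult lin_gen rep_word_letter[OF t n] lin_1 rep_letter_relations[OF t n]
    power2_eq_square lin_scalar mat_one_def
  note L = rep_letter_eq[OF t n]
  have "lin (rep_word t n) (gen Let_q * gen Let_qinv - 1) = 0"
    "lin (rep_word t n) (gen Let_qinv * gen Let_q - 1) = 0"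
    by (auto simp: simps fun_eq_iff) (auto simp: L exp_minus fun_eq_iff simp flip: of_real_mult)
  moreover have "lin (rep_word t n) (gen Let_q * gen Let_e - scalar ?l * (gen Let_e * gen Let_q)) = 0"
    by (auto simp: simps fun_eq_iff) (auto simp: L lam_def algebra_simps simp flip: of_real_mult exp_add)
  moreover have "lin (rep_word t n) (gen Let_q * gen Let_f - scalar (inverse ?l) * (gen Let_f * gen Let_q)) = 0"
    by (auto simp: simps fun_eq_iff)
      (auto simp: L lam_def algebra_simps exp_minus[symmetric] simp flip: of_real_mult of_real_inverse exp_add)
  moreover have "lin (rep_word t n) (gen Let_e * gen Let_f - gen Let_f * gen Let_e
      - scalar s * (gen Let_q ^ 2 - gen Let_qinv ^ 2)) = 0"
  proof -
    \<comment> \<open>The diagonal entry of the commutator relation is exactly the ladder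
      recursion.\<close>
    have *: "complex_of_real ((rung t n (j - 1))\<^sup>2 - (rung t n j)\<^sup>2)
       = s * complex_of_real (exp (t * (2 * j)) - exp (- t * (2 * j)))" if "j \<in> weights n" for j
      using that rung_step[OF t, of n j] qint_lam[of t j]
      by (simp add: s_def weights_iff powr_lam flip: of_real_inverse of_real_diff of_real_mult)
    show ?thesis
    proof (intro ext)
      fix i j
      show "lin (rep_word t n) (gen Let_e * gen Let_f - gen Let_f * gen Let_e
        - scalar s * (gen Let_q ^ 2 - gen Let_qinv ^ 2)) i j = 0 i j"
      proof (cases "i \<in> weights n \<and> i = j")
        case True
        \<comment> \<open>At an end of the ladder the neighbouring weight is missing, but then its
          coefficient vanishes, so the products below are squares in all cases.\<close>
        have "i - 1 \<in> weights n \<or> rung t n (i - 1) = 0"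
          using weights_pred[OF n, of i] True by (cases "i = - n") auto
        moreover have "i + 1 \<in> weights n \<or> rung t n i = 0"
          using weights_Suc[OF n, of i] True by (cases "i = n") auto
        ultimately have e: "complex_of_real (rung t n (i - 1)) * rep_letter t n Let_f (i - 1) i
            = complex_of_real ((rung t n (i - 1))\<^sup>2)"
          "complex_of_real (rung t n i) * rep_letter t n Let_e (i + 1) i = complex_of_real ((rung t n i)\<^sup>2)"
          using True by (auto simp: L power2_eq_square)
        have i: "i \<in> weights n" and ji: "j = i" using True by auto
        have "lin (rep_word t n) (gen Let_e * gen Let_f - gen Let_f * gen Let_e
          - scalar s * (gen Let_q ^ 2 - gen Let_qinv ^ 2)) i i
          = complex_of_real (rung t n (i - 1)) * rep_letter t n Let_f (i - 1) i
            - complex_of_real (rung t n i) * rep_letter t n Let_e (i + 1) i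
            - s * (complex_of_real (exp (t * i)) * rep_letter t n Let_q i i
              - complex_of_real (exp (- t * i)) * rep_letter t n Let_qinv i i)"
          using i by (simp add: simps)
        also have "\<dots> = complex_of_real ((rung t n (i - 1))\<^sup>2) - complex_of_real ((rung t n i)\<^sup>2)
            - s * (complex_of_real (exp (t * i) * exp (t * i)) - complex_of_real (exp (- t * i) * exp (- t * i)))"
          unfolding e using i by (simp add: L)
        also have "\<dots> = complex_of_real ((rung t n (i - 1))\<^sup>2 - (rung t n i)\<^sup>2)
            - s * complex_of_real (exp (t * (2 * i)) - exp (- t * (2 * i)))"
          by (simp add: algebra_simps flip: exp_add)
        also have "\<dots> = 0" by (simp only: right_minus_eq *[OF i])
        finally show ?thesis using ji by simp
      next
        case False
        then have "i \<notin> weights n \<or> i \<noteq> j" by simp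
        then show ?thesis
          by (simp only: simps fun_diff_def zero_fun_def) (auto simp: L)
      qed
    qed
  qed
  ultimately show ?thesis
    using assms(3) unfolding relators_def Let_def s_def by blast
qed

section \<open>Highest weight vectors and intertwiners\<close>

definition act :: "'b set \<Rightarrow> 'b matr \<Rightarrow> ('b \<Rightarrow> complex) \<Rightarrow> 'b \<Rightarrow> complex"
  where "act K x v = (\<lambda>a. \<Sum>c\<in>K. x a c * v c)"

lemma act_mult: "act K (mat_mult K x y) v = act K x (act K y v)"
proof
  fix a
  have "act K (mat_mult K x y) v a = (\<Sum>c\<in>K. \<Sum>k\<in>K. x a k * y k c * v c)"
    by (simp add: act_def mat_mult_def sum_distrib_right)
  also have "\<dots> = (\<Sum>k\<in>K. \<Sum>c\<in>K. x a k * y k c * v c)" by (rule sum.swap)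
  also have "\<dots> = act K x (act K y v) a"
    by (simp add: act_def sum_distrib_left mult.assoc)
  finally show "act K (mat_mult K x y) v a = act K x (act K y v) a" .
qed

lemma act_scale: "act K x (\<lambda>a. c * v a) = (\<lambda>a. c * act K x v a)"
  by (simp add: act_def fun_eq_iff sum_distrib_left mult_ac)

lemma act_sum: "act K x (\<lambda>a. \<Sum>i\<in>I. c i * v i a) = (\<lambda>a. \<Sum>i\<in>I. c i * act K x (v i) a)"
proof
  fix a
  have "act K x (\<lambda>a. \<Sum>i\<in>I. c i * v i a) a = (\<Sum>d\<in>K. \<Sum>i\<in>I. c i * (x a d * v i d))"
    by (simp add: act_def sum_distrib_left mult_ac)
  also have "\<dots> = (\<Sum>i\<in>I. \<Sum>d\<in>K. c i * (x a d * v i d))" by (rule sum.swap)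
  finally show "act K x (\<lambda>a. \<Sum>i\<in>I. c i * v i a) a = (\<Sum>i\<in>I. c i * act K x (v i) a)"
    by (simp add: act_def sum_distrib_left)
qed

lemma act_minus: "act K (x - y) v = (\<lambda>a. act K x v a - act K y v a)"
  by (simp add: act_def fun_eq_iff left_diff_distrib sum_subtractf)

lemma act_zero [simp]: "act K 0 v = (\<lambda>a. 0)" "act K x (\<lambda>a. 0) = (\<lambda>a. 0)"
  by (simp_all add: act_def)

definition supported :: "'b set \<Rightarrow> ('b \<Rightarrow> complex) \<Rightarrow> bool"
  where "supported K v \<longleftrightarrow> (\<forall>a. v a \<noteq> 0 \<longrightarrow> a \<in> K)"

lemma act_one: "finite K \<Longrightarrow> supported K v \<Longrightarrow> act K (mat_one K) v = v"
proof
  fix a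
  assume *: "finite K" "supported K v"
  have "act K (mat_one K) v a = (\<Sum>c\<in>K. if a = c then v a else 0)"
    unfolding act_def by (rule sum.cong) (auto simp: mat_one_def)
  then show "act K (mat_one K) v a = v a"
    using * by (auto simp: supported_def)
qed

text \<open>An intertwiner is given by the images \<open>W j\<close> of the basis vectors \<open>j \<in> L\<close>.\<close>

definition intertwiner ::
    "'b set \<Rightarrow> (word \<Rightarrow> 'b matr) \<Rightarrow> 'c set \<Rightarrow> (word \<Rightarrow> 'c matr) \<Rightarrow> ('c \<Rightarrow> 'b \<Rightarrow> complex) \<Rightarrow> bool"
  where "intertwiner K \<psi> L \<chi> W \<longleftrightarrow>
    (\<forall>x. \<forall>j\<in>L. act K (lin \<psi> x) (W j) = (\<lambda>a. \<Sum>i\<in>L. lin \<chi> x i j * W i a))"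

text \<open>It suffices to check letters. The support condition is what the empty word demands: the
  identity matrix on K has to fix each W j.\<close>

lemma intertwinerI:
  assumes "matrix_rep K \<psi>" "matrix_rep L \<chi>" "\<And>j. j \<in> L \<Longrightarrow> supported K (W j)"
    and gen: "\<And>g j. j \<in> L \<Longrightarrow> act K (\<psi> (Word [g])) (W j) = (\<lambda>a. \<Sum>i\<in>L. \<chi> (Word [g]) i j * W i a)"
  shows "intertwiner K \<psi> L \<chi> W"
proof -
  interpret a: matrix_rep K \<psi> by fact
  interpret b: matrix_rep L \<chi> by fact
  have w: "act K (\<psi> w) (W j) = (\<lambda>a. \<Sum>i\<in>L. \<chi> w i j * W i a)" if "j \<in> L" for w j
    using that
  proof (induction w arbitrary: j rule: word_induct)
    case Nil
    have "(\<Sum>i\<in>L. \<chi> 0 i j * W i a) = (\<Sum>i\<in>L. if i = j then W i a else 0)" for a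
      using Nil by (intro sum.cong) (auto simp: b.one mat_one_def)
    then show ?case
      using Nil by (simp add: a.one act_one[OF a.fin assms(3)] b.fin)
  next
    case (Cons g w)
    have "act K (\<psi> (Word [g] + w)) (W j) = (\<lambda>a. \<Sum>i\<in>L. \<chi> w i j * (\<Sum>l\<in>L. \<chi> (Word [g]) l i * W l a))"
      using Cons by (simp add: a.mult act_mult act_sum gen)
    also have "\<dots> = (\<lambda>a. \<Sum>i\<in>L. \<Sum>l\<in>L. \<chi> (Word [g]) l i * \<chi> w i j * W l a)"
      by (simp add: sum_distrib_left mult_ac)
    also have "\<dots> = (\<lambda>a. \<Sum>l\<in>L. \<chi> (Word [g] + w) l j * W l a)"
      by (rule ext, subst sum.swap) (simp add: b.mult mat_mult_def sum_distrib_right)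
    finally show ?case .
  qed
  show ?thesis
    unfolding intertwiner_def
  proof (intro allI ballI)
    fix x j assume j: "j \<in> L"
    show "act K (lin \<psi> x) (W j) = (\<lambda>a. \<Sum>i\<in>L. lin \<chi> x i j * W i a)"
    proof (induction x rule: poly_mapping_single_induct)
      case (single u c)
      show ?case
        using w[OF j, of u] by (simp add: lin_single act_def fun_eq_iff mult.assoc flip: sum_distrib_left)
    next
      case (add x y)
      then show ?case by (simp add: lin_add act_def fun_eq_iff distrib_right sum.distrib)
    qed (simp add: act_def)
  qed
qed

text \<open>The common setting for \<pi>_n and for the tensor products (\<pi>_n \<otimes>
  \<pi>_m)\<Delta>, both viewed as representations of the free algebra.\<close>

locale At_rep = matrix_rep K \<psi> for t :: real and K :: "'b set" and \<psi> :: "word \<Rightarrow> 'b matr" +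
  assumes t: "t > 0"
    and star: "star_rep \<psi>"
    and relators: "r \<in> relators t \<Longrightarrow> lin \<psi> r = 0"
begin

abbreviation "E \<equiv> act K (\<psi> (Word [Let_e]))"
abbreviation "F \<equiv> act K (\<psi> (Word [Let_f]))"
abbreviation "Q \<equiv> act K (\<psi> (Word [Let_q]))"
abbreviation "Q' \<equiv> act K (\<psi> (Word [Let_qinv]))"

lemma rel_ideal_0: "x \<in> rel_ideal t \<Longrightarrow> lin \<psi> x = 0"
  using rel_ideal_subset[OF two_sided_kernel, of t] relators by auto

lemma act_supported: "supported K (act K (\<psi> w) v)"
  unfolding supported_def
proof (intro allI impI)
  fix a assume "act K (\<psi> w) v a \<noteq> 0"
  then obtain c where "\<psi> w a c \<noteq> 0"
    unfolding act_def by (metis (mono_tags, lifting) mult_eq_0_iff sum.neutral)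
  then show "a \<in> K" using supp by blast
qed

lemma Q_inverse: "supported K v \<Longrightarrow> Q' (Q v) = v"
proof -
  assume v: "supported K v"
  have "lin \<psi> (gen Let_qinv * gen Let_q - 1) = 0"
    by (rule relators) (simp add: relators_def Let_def)
  then have "mat_mult K (\<psi> (Word [Let_qinv])) (\<psi> (Word [Let_q])) = mat_one K"
    by (simp add: lin_diff lin_mult lin_gen lin_1)
  then show ?thesis
    using act_mult[of K "\<psi> (Word [Let_qinv])" "\<psi> (Word [Let_q])" v] act_one[OF fin v] by simp
qed

lemma QF: "Q (F v) = (\<lambda>a. complex_of_real (exp (- t)) * F (Q v) a)"
proof -
  have "lin \<psi> (gen Let_q * gen Let_f - scalar (inverse (complex_of_real (lam t))) * (gen Let_f * gen Let_q)) = 0"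
    by (rule relators) (simp add: relators_def Let_def)
  then have "act K (lin \<psi> (gen Let_q * gen Let_f - scalar (inverse (complex_of_real (lam t))) * (gen Let_f * gen Let_q))) v
     = (\<lambda>a. 0)" by simp
  then have "Q (F v) = act K (\<lambda>p q. complex_of_real (exp (- t)) * lin \<psi> (gen Let_f * gen Let_q) p q) v"
    by (simp add: lin_diff lin_mult lin_gen lin_scalar act_minus act_mult fun_eq_iff lam_def exp_minus)
  also have "\<dots> = (\<lambda>a. complex_of_real (exp (- t)) * act K (lin \<psi> (gen Let_f * gen Let_q)) v a)"
    by (simp add: act_def fun_eq_iff sum_distrib_left mult.assoc)
  finally show ?thesis by (simp add: lin_mult lin_gen act_mult)
qed

lemma EF:
  assumes v: "supported K v" and Qv: "Q v = (\<lambda>a. complex_of_real (exp (t * j)) * v a)"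
  shows "E (F v) = (\<lambda>a. F (E v) a + complex_of_real (qint t (2 * j)) * v a)"
proof -
  let ?l = "complex_of_real (lam t)"
  let ?s = "inverse (?l - inverse ?l)"
  \<comment> \<open>The eigenvalue of q' is the inverse of that of q because q' undoes q on
    supported vectors. With both eigenvalues, q^2 - q'^2 acts on v as a scalar.\<close>
  have Q'v: "Q' v = (\<lambda>a. complex_of_real (exp (- (t * j))) * v a)"
  proof -
    have "Q' (Q v) = (\<lambda>a. complex_of_real (exp (t * j)) * Q' v a)" by (simp add: Qv act_scale)
    then have "v = (\<lambda>a. complex_of_real (exp (t * j)) * Q' v a)" by (simp add: Q_inverse[OF v])
    then have "(\<lambda>a. complex_of_real (exp (- t * j)) * v a)
      = (\<lambda>a. complex_of_real (exp (- t * j)) * (complex_of_real (exp (t * j)) * Q' v a))" by metis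
    then show ?thesis by (simp only: exp_pow_simps) simp
  qed
  have "lin \<psi> (gen Let_e * gen Let_f - gen Let_f * gen Let_e - scalar ?s * (gen Let_q ^ 2 - gen Let_qinv ^ 2)) = 0"
    by (rule relators) (simp add: relators_def Let_def)
  then have "act K (lin \<psi> (gen Let_e * gen Let_f - gen Let_f * gen Let_e - scalar ?s * (gen Let_q ^ 2 - gen Let_qinv ^ 2))) v
     = (\<lambda>a. 0)" by simp
  then have "E (F v) = (\<lambda>a. F (E v) a + act K (\<lambda>p q. ?s * lin \<psi> (gen Let_q ^ 2 - gen Let_qinv ^ 2) p q) v a)"
    by (simp add: lin_diff lin_mult lin_gen lin_scalar act_minus act_mult fun_eq_iff diff_eq_eq add.commute)
  also have "act K (\<lambda>p q. ?s * lin \<psi> (gen Let_q ^ 2 - gen Let_qinv ^ 2) p q) v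
      = (\<lambda>a. ?s * act K (lin \<psi> (gen Let_q ^ 2 - gen Let_qinv ^ 2)) v a)"
    by (simp add: act_def fun_eq_iff sum_distrib_left mult.assoc)
  also have "act K (lin \<psi> (gen Let_q ^ 2 - gen Let_qinv ^ 2)) v = (\<lambda>a. Q (Q v) a - Q' (Q' v) a)"
    by (simp add: power2_eq_square lin_diff lin_mult lin_gen act_minus act_mult)
  also have "Q' (Q' v) = (\<lambda>a. complex_of_real (exp (- (t * (2 * j)))) * v a)"
  proof -
    have "Q' (Q' v) = (\<lambda>a. complex_of_real (exp (- (t * j)) * exp (- (t * j))) * v a)"
      by (simp only: Q'v act_scale of_real_mult mult.assoc)
    then show ?thesis by (simp add: algebra_simps flip: exp_add)
  qed
  also have "Q (Q v) = (\<lambda>a. complex_of_real (exp (t * (2 * j))) * v a)"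
  proof -
    have "Q (Q v) = (\<lambda>a. complex_of_real (exp (t * j) * exp (t * j)) * v a)"
      by (simp only: Qv act_scale of_real_mult mult.assoc)
    then show ?thesis by (simp add: algebra_simps flip: exp_add)
  qed
  also have "(\<lambda>a. ?s * (complex_of_real (exp (t * (2 * j))) * v a - complex_of_real (exp (- (t * (2 * j)))) * v a))
     = (\<lambda>a. complex_of_real (qint t (2 * j)) * v a)"
  proof
    fix a
    have "?s * (complex_of_real (exp (t * (2 * j))) * v a - complex_of_real (exp (- (t * (2 * j)))) * v a)
       = complex_of_real (inverse (lam t - inverse (lam t)) * (lam t powr (2 * j) - lam t powr (- 2 * j))) * v a"
      by (simp add: powr_lam algebra_simps)
    then show "?s * (complex_of_real (exp (t * (2 * j))) * v a - complex_of_real (exp (- (t * (2 * j)))) * v a)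
     = complex_of_real (qint t (2 * j)) * v a"
      by (simp only: qint_lam)
  qed
  finally show ?thesis .
qed

text \<open>Since f is the adjoint of e, the squared norm of f v is the inner product of e f v with
  v. This ends the string of a highest weight vector without a dimension argument.\<close>

lemma EF_0:
  assumes "E (F v) = (\<lambda>a. 0)"
  shows "F v = (\<lambda>a. 0)"
proof -
  have adj: "\<psi> (Word [Let_f]) a c = cnj (\<psi> (Word [Let_e]) c a)" for a c
    using star[unfolded star_rep_def, rule_format, of "Word [Let_e]" a c] by (simp add: word_star_def)
  have "(\<Sum>a\<in>K. F v a * cnj (F v a)) = (\<Sum>a\<in>K. \<Sum>c\<in>K. F v a * (\<psi> (Word [Let_e]) c a * cnj (v c)))"
    by (subst (2) act_def) (simp add: adj sum_distrib_left)
  also have "\<dots> = (\<Sum>c\<in>K. \<Sum>a\<in>K. F v a * (\<psi> (Word [Let_e]) c a * cnj (v c)))"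
    by (rule sum.swap)
  also have "\<dots> = (\<Sum>c\<in>K. E (F v) c * cnj (v c))"
    by (subst (2) act_def) (simp add: sum_distrib_right sum_distrib_left mult_ac)
  also have "\<dots> = 0" using assms by simp
  finally have "complex_of_real (\<Sum>a\<in>K. (cmod (F v a))\<^sup>2) = 0"
    by (simp only: of_real_sum complex_norm_square)
  then have "(\<Sum>a\<in>K. (cmod (F v a))\<^sup>2) = 0" by (simp only: of_real_eq_0_iff)
  then have "\<forall>a\<in>K. F v a = 0" by (simp add: sum_nonneg_eq_0_iff fin)
  moreover have "F v a = 0" if "a \<notin> K" for a
    using act_supported[of "Word [Let_f]" v] that by (auto simp: supported_def)
  ultimately show ?thesis by auto
qed

text \<open>Dividing by the ladder coefficient makes the i-th vector the counterpart of \<xi>(k,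
  k-i). At i = 2k the divisor is 0, so by \<open>inverse 0 = 0\<close> the sequence continues with
  zero vectors.\<close>

primrec descend :: "real \<Rightarrow> ('b \<Rightarrow> complex) \<Rightarrow> nat \<Rightarrow> 'b \<Rightarrow> complex"
  where
    "descend k v 0 = v"
  | "descend k v (Suc i) = (\<lambda>a. inverse (complex_of_real (rung t k (k - real i - 1))) * F (descend k v i) a)"

text \<open>The usual sl(2) string argument: the commutator relation and the ladder recursion
  determine e f on every descendant, so e and f act on the string with the coefficients of
  \<pi>_k.\<close>

lemma highest_weight_intertwiner:
  assumes k: "k \<in> spins" and v: "supported K v" and Qv: "Q v = (\<lambda>a. complex_of_real (exp (t * k)) * v a)"
    and Ev: "E v = (\<lambda>a. 0)"
  shows "intertwiner K \<psi> (weights k) (rep_word t k) (\<lambda>j. descend k v (nat \<lfloor>k - j\<rfloor>))"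
proof -
  let ?w = "descend k v"
  have sup: "supported K (?w i)" for i
    using v act_supported[of "Word [Let_f]" "?w (i - 1)"] by (cases i) (auto simp: supported_def)
  have Qw: "Q (?w i) = (\<lambda>a. complex_of_real (exp (t * (k - real i))) * ?w i a)" for i
  proof (induction i)
    case (Suc i)
    have "Q (?w (Suc i)) = (\<lambda>a. inverse (complex_of_real (rung t k (k - real i - 1))) * (complex_of_real (exp (- t)) *
       (complex_of_real (exp (t * (k - real i))) * F (?w i) a)))"
      by (simp only: descend.simps act_scale QF Suc)
    also have "\<dots> = (\<lambda>a. complex_of_real (exp (- t) * exp (t * (k - real i))) * ?w (Suc i) a)"
      by (simp add: mult_ac)
    also have "exp (- t) * exp (t * (k - real i)) = exp (t * (k - real (Suc i)))"
      by (simp add: algebra_simps flip: exp_add)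
    finally show ?case .
  qed (simp add: Qv)
  have Fw: "F (?w i) = (\<lambda>a. complex_of_real (rung t k (k - real i - 1)) * ?w (Suc i) a)" if "real i + 1 \<le> 2 * k" for i
  proof -
    have "rung t k (k - real i - 1) > 0" using that by (intro rung_pos t) auto
    then show ?thesis by (simp add: fun_eq_iff)
  qed
  have step: "complex_of_real ((rung t k (k - real i))\<^sup>2) + complex_of_real (qint t (2 * (k - real i)))
      = complex_of_real ((rung t k (k - real i - 1))\<^sup>2)" if "real i \<le> 2 * k" for i
  proof -
    have "(rung t k (k - real i))\<^sup>2 + qint t (2 * (k - real i)) = (rung t k (k - real i - 1))\<^sup>2"
      using rung_step[OF t, of k "k - real i"] that by simp
    then show ?thesis by (simp only: flip: of_real_add)
  qed
  have EFw: "E (F (?w i)) = (\<lambda>a. complex_of_real ((rung t k (k - real i - 1))\<^sup>2) * ?w i a)"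
    and Ew: "real i + 1 \<le> 2 * k \<Longrightarrow> E (?w (Suc i)) = (\<lambda>a. complex_of_real (rung t k (k - real i - 1)) * ?w i a)"
    if "real i \<le> 2 * k" for i
  proof -
    \<comment> \<open>Only f e needs an induction. At the top it is 0, in accordance with
      \<open>rung t k k = 0\<close>; each step adds the quantum integer of the commutator, which by
      \<open>step\<close> gives the next square.\<close>
    have FE: "F (E (?w i)) = (\<lambda>a. complex_of_real ((rung t k (k - real i))\<^sup>2) * ?w i a)" if "real i \<le> 2 * k" for i
      using that
    proof (induction i)
      case (Suc i)
      then have i: "real i + 1 \<le> 2 * k" by simp
      have "E (F (?w i)) = (\<lambda>a. complex_of_real ((rung t k (k - real i))\<^sup>2) * ?w i a + complex_of_real (qint t (2 * (k - real i))) * ?w i a)"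
        using EF[OF sup Qw] Suc.IH i by simp
      also have "\<dots> = (\<lambda>a. complex_of_real ((rung t k (k - real i - 1))\<^sup>2) * ?w i a)"
        using i by (simp only: step[symmetric] distrib_right)
      finally have 1: "E (F (?w i)) = \<dots>" .
      have "E (?w (Suc i)) = (\<lambda>a. inverse (complex_of_real (rung t k (k - real i - 1))) * E (F (?w i)) a)"
        by (simp add: act_scale)
      also have "\<dots> = (\<lambda>a. complex_of_real (rung t k (k - real i - 1)) * ?w i a)"
        by (auto simp: 1 fun_eq_iff power2_eq_square)
      finally have "F (E (?w (Suc i))) = (\<lambda>a. complex_of_real (rung t k (k - real i - 1)) * F (?w i) a)"
        by (simp add: act_scale)
      then show ?case
        by (simp only: Fw[OF i]) (simp add: power2_eq_square algebra_simps)
    qed (simp add: Ev)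
    have "E (F (?w i)) = (\<lambda>a. complex_of_real ((rung t k (k - real i))\<^sup>2) * ?w i a + complex_of_real (qint t (2 * (k - real i))) * ?w i a)"
      using EF[OF sup Qw] FE[OF that] by simp
    also have "\<dots> = (\<lambda>a. complex_of_real ((rung t k (k - real i - 1))\<^sup>2) * ?w i a)"
      by (simp only: step[OF that, symmetric] distrib_right)
    finally show 1: "E (F (?w i)) = \<dots>" .
    show "E (?w (Suc i)) = (\<lambda>a. complex_of_real (rung t k (k - real i - 1)) * ?w i a)"
      by (auto simp: 1 act_scale fun_eq_iff power2_eq_square)
  qed
  \<comment> \<open>At i = 2k the coefficient is \<open>rung t k (- k - 1) = 0\<close>, so e f kills
    the lowest vector, and then f does.\<close>
  have Fbot: "F (?w (nat \<lfloor>2 * k\<rfloor>)) = (\<lambda>a. 0)"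
  proof -
    have "2 * k \<in> \<int>" "k \<ge> 0" using k by (auto simp: spins_iff)
    then have r: "real (nat \<lfloor>2 * k\<rfloor>) = 2 * k" by (auto elim!: Ints_cases)
    have "E (F (?w (nat \<lfloor>2 * k\<rfloor>))) = (\<lambda>a. 0)"
      using EFw[of "nat \<lfloor>2 * k\<rfloor>"] by (simp add: r)
    then show ?thesis by (rule EF_0)
  qed
  show ?thesis
  proof (rule intertwinerI[OF matrix_rep_axioms matrix_rep_rep_word[OF t k]])
    fix g j assume j: "j \<in> weights k"
    let ?W = "\<lambda>j. ?w (nat \<lfloor>k - j\<rfloor>)"
    define i where "i = nat \<lfloor>k - j\<rfloor>"
    have kj: "real i = k - j"
    proof -
      have "k - j \<in> \<int>" using j weights_uminus[OF k, of j] by (auto simp: weights_iff)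
      then show ?thesis using j by (auto simp: i_def weights_iff elim!: Ints_cases)
    qed
    have i2: "real i \<le> 2 * k" using kj j by (simp add: weights_iff)
    note R = rep_word_letter[OF t k] rep_letter_eq[OF t k]
    show "act K (\<psi> (Word [g])) (?W j) = (\<lambda>a. \<Sum>l\<in>weights k. rep_word t k (Word [g]) l j * ?W l a)"
    proof (cases g)
      case Let_q
      have "(\<Sum>l\<in>weights k. rep_word t k (Word [g]) l j * ?W l a)
         = (\<Sum>l\<in>weights k. if l = j then complex_of_real (exp (t * j)) * ?W j a else 0)" for a
        by (rule sum.cong) (auto simp: Let_q R)
      moreover have "Q (?w i) = (\<lambda>a. complex_of_real (exp (t * j)) * ?w i a)"
        by (simp only: Qw kj) simp
      ultimately show ?thesis using j by (simp add: i_def Let_q)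
    next
      case Let_qinv
      have "(\<Sum>l\<in>weights k. rep_word t k (Word [g]) l j * ?W l a)
         = (\<Sum>l\<in>weights k. if l = j then complex_of_real (exp (- t * j)) * ?W j a else 0)" for a
        by (rule sum.cong) (auto simp: Let_qinv R)
      moreover have "Q' (?w i) = (\<lambda>a. complex_of_real (exp (- t * j)) * ?w i a)"
      proof -
        have "?w i = (\<lambda>a. complex_of_real (exp (t * j)) * Q' (?w i) a)"
          using Q_inverse[OF sup, of i] kj by (simp add: Qw act_scale)
        then have "(\<lambda>a. complex_of_real (exp (- t * j)) * ?w i a)
          = (\<lambda>a. complex_of_real (exp (- t * j)) * (complex_of_real (exp (t * j)) * Q' (?w i) a))" by metis
        then show ?thesis by (simp only: exp_pow_simps)
      qed
      ultimately show ?thesis using j by (simp add: i_def Let_qinv)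
    next
      case Let_e
      have "(\<Sum>l\<in>weights k. rep_word t k (Word [g]) l j * ?W l a)
         = (\<Sum>l\<in>weights k. if l = j + 1 then complex_of_real (rung t k j) * ?W (j + 1) a else 0)" for a
        by (rule sum.cong) (use j in \<open>auto simp: Let_e R\<close>)
      then have s: "(\<lambda>a. \<Sum>l\<in>weights k. rep_word t k (Word [g]) l j * ?W l a)
         = (\<lambda>a. complex_of_real (rung t k j) * ?W (j + 1) a)"
        using weights_Suc[OF k j] by (cases "j = k") auto
      show ?thesis
      proof (cases i)
        case 0
        then show ?thesis unfolding s using kj Ev by (simp add: i_def Let_e)
      next
        case (Suc i')
        have "real i' + 1 = k - j" using kj Suc by simp
        then have "k - (j + 1) = real i'" "j = k - real i' - 1" by simp_all
        then have W: "?W (j + 1) = ?w i'" by simp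
        have "real i' + 1 \<le> 2 * k" "real i' \<le> 2 * k" using i2 Suc by simp_all
        then show ?thesis unfolding s W using Ew[of i'] Suc \<open>j = k - real i' - 1\<close> by (simp add: i_def Let_e)
      qed
    next
      case Let_f
      have "(\<Sum>l\<in>weights k. rep_word t k (Word [g]) l j * ?W l a)
         = (\<Sum>l\<in>weights k. if l = j - 1 then complex_of_real (rung t k (j - 1)) * ?W (j - 1) a else 0)" for a
        by (rule sum.cong) (use j in \<open>auto simp: Let_f R\<close>)
      then have s: "(\<lambda>a. \<Sum>l\<in>weights k. rep_word t k (Word [g]) l j * ?W l a)
         = (\<lambda>a. complex_of_real (rung t k (j - 1)) * ?W (j - 1) a)"
        using weights_pred[OF k j] by (cases "j = - k") auto
      show ?thesis
      proof (cases "j = - k")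
        case True
        then have "rung t k (j - 1) = 0" and kj: "k - j = 2 * k" by simp_all
        then show ?thesis unfolding s kj by (simp add: Let_f Fbot del: descend.simps)
      next
        case False
        then have "j - 1 \<in> weights k" using weights_pred[OF k j] by simp
        then have i: "real i + 1 \<le> 2 * k" using kj by (simp add: weights_iff)
        have "k - (j - 1) = real (Suc i)" using kj by simp
        then have W: "?W (j - 1) = ?w (Suc i)" by (simp only: floor_of_nat nat_int)
        have "k - real i - 1 = j - 1" using kj by simp
        with Fw[OF i] have "F (?w i) = (\<lambda>a. complex_of_real (rung t k (j - 1)) * ?w (Suc i) a)" by (simp only:)
        then show ?thesis unfolding s by (simp only: W Let_f i_def[symmetric])
      qed
    qed
  qed (rule sup)
qed

end

lemma At_rep_rep_word:
  assumes "t > 0" "n \<in> spins"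
  shows "At_rep t (weights n) (rep_word t n)"
  by (intro At_rep.intro At_rep_axioms.intro matrix_rep_rep_word star_rep_rep_word rep_relators assms)

lemma rep2_rel_ideal2:
  assumes "t > 0" "n \<in> spins" "m \<in> spins" "y \<in> rel_ideal2 t"
  shows "lin (pair_rep (rep_word t n) (rep_word t m)) y = 0"
proof -
  interpret a: At_rep t "weights n" "rep_word t n" using assms by (rule_tac At_rep_rep_word)
  interpret b: At_rep t "weights m" "rep_word t m" using assms by (rule_tac At_rep_rep_word)
  let ?P = "pair_rep (rep_word t n) (rep_word t m)"
  interpret matrix_rep "weights n \<times> weights m" ?P
    by (rule matrix_rep_pair[OF a.matrix_rep_axioms b.matrix_rep_axioms])
  \<comment> \<open>The generators of \<open>rel_ideal2\<close> go to \<pi>_n(x) \<otimes> 1 and 1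
    \<otimes> \<pi>_m(x), which vanish for x in \<open>rel_ideal\<close>.\<close>
  have *: "lin ?P (leg1 x) = mat_tensor (lin (rep_word t n) x) (mat_one (weights m))"
    "lin ?P (leg2 x) = mat_tensor (mat_one (weights n)) (lin (rep_word t m) x)" for x
  proof (induction x rule: poly_mapping_single_induct)
    case (single w c)
    { case 1 show ?case by (auto simp: leg_single lin_single pair_rep_def b.one mat_tensor_def fun_eq_iff) }
    { case 2 show ?case by (auto simp: leg_single lin_single pair_rep_def a.one mat_tensor_def fun_eq_iff) }
  next
    case (add x y)
    { case 1 show ?case using add by (auto simp: leg_add lin_add mat_tensor_def fun_eq_iff distrib_right) }
    { case 2 show ?case using add by (auto simp: leg_add lin_add mat_tensor_def fun_eq_iff distrib_left) }
  qed (auto simp: mat_tensor_def fun_eq_iff)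
  have "rel_ideal2 t \<subseteq> {y. lin ?P y = 0}"
    unfolding rel_ideal2_def
  proof (rule Idl_minimal[OF two_sided_kernel])
    show "(\<lambda>x. free_tensor x 1) ` rel_ideal t \<union> free_tensor 1 ` rel_ideal t \<subseteq> {y. lin ?P y = 0}"
      using *[unfolded leg1_def leg2_def] a.rel_ideal_0 b.rel_ideal_0
      by (auto simp: mat_tensor_def fun_eq_iff)
  qed
  then show ?thesis using assms(4) by blast
qed

abbreviation rep2_word :: "real \<Rightarrow> real \<Rightarrow> real \<Rightarrow> word \<Rightarrow> (real \<times> real) matr"
  where "rep2_word t n m \<equiv> cprod (rep_word t n) (rep_word t m)"

lemma At_rep_rep2_word:
  assumes "t > 0" "n \<in> spins" "m \<in> spins"
  shows "At_rep t (weights n \<times> weights m) (rep2_word t n m)"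
proof (intro At_rep.intro At_rep_axioms.intro)
  show "lin (rep2_word t n m) r = 0" if "r \<in> relators t" for r
    unfolding lin_cprod using that by (intro rep2_rel_ideal2[OF assms] comult_relators)
qed (use assms in \<open>auto intro!: matrix_rep_cprod star_rep_cprod matrix_rep_rep_word star_rep_rep_word\<close>)

section \<open>Realising families of matrices\<close>

text \<open>The coefficients are products of i consecutive values of \<open>rung\<close>; all that
  matters later is that they are nonzero.\<close>

lemma lin_e_power:
  assumes t: "t > 0" and k: "k \<in> spins"
  shows "\<exists>c. (\<forall>q. q \<in> weights k \<and> q + real i \<in> weights k \<longrightarrow> c q > 0) \<and>
    lin (rep_word t k) (gen Let_e ^ i) =
      (\<lambda>p q. if p \<in> weights k \<and> q \<in> weights k \<and> p = q + real i then complex_of_real (c q) else 0)"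
proof (induction i)
  case 0
  show ?case
    by (rule exI[of _ "\<lambda>_. 1"])
      (auto simp: matrix_rep.lin_1[OF matrix_rep_rep_word[OF t k]] mat_one_def fun_eq_iff)
next
  case (Suc i)
  then obtain c where c: "\<And>q. q \<in> weights k \<Longrightarrow> q + real i \<in> weights k \<Longrightarrow> c q > 0"
    and lin: "lin (rep_word t k) (gen Let_e ^ i) =
      (\<lambda>p q. if p \<in> weights k \<and> q \<in> weights k \<and> p = q + real i then complex_of_real (c q) else 0)"
    by blast
  have w: "q + real i \<in> weights k" "q + real i < k" "- k - 1 < q + real i"
    if "q \<in> weights k" "q + real (Suc i) \<in> weights k" for q
  proof -
    have "q + real (Suc i) - 1 \<in> weights k"
      by (rule weights_pred[OF k that(2)]) (use that in \<open>auto simp: weights_iff\<close>)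
    then show "q + real i \<in> weights k" by simp
  qed (use that in \<open>auto simp: weights_iff\<close>)
  show ?case
  proof (intro exI conjI allI impI)
    fix q assume "q \<in> weights k \<and> q + real (Suc i) \<in> weights k"
    then show "rung t k (q + real i) * c q > 0"
      using c[of q] w[of q] rung_pos[OF t, of k "q + real i"] by simp
  next
    show "lin (rep_word t k) (gen Let_e ^ Suc i) = (\<lambda>p q. if p \<in> weights k \<and> q \<in> weights k \<and>
       p = q + real (Suc i) then complex_of_real (rung t k (q + real i) * c q) else 0)"
      using w by (auto simp: matrix_rep.lin_mult[OF matrix_rep_rep_word[OF t k]] lin lin_gen
        rep_word_letter[OF t k] rep_letter_relations[OF t k] fun_eq_iff algebra_simps)
  qed
qed

lemma lin_f_power:
  assumes t: "t > 0" and k: "k \<in> spins"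
  shows "\<exists>c. (\<forall>q. q \<in> weights k \<and> q - real i \<in> weights k \<longrightarrow> c q > 0) \<and>
    lin (rep_word t k) (gen Let_f ^ i) =
      (\<lambda>p q. if p \<in> weights k \<and> q \<in> weights k \<and> p = q - real i then complex_of_real (c q) else 0)"
proof (induction i)
  case 0
  show ?case
    by (rule exI[of _ "\<lambda>_. 1"])
      (auto simp: matrix_rep.lin_1[OF matrix_rep_rep_word[OF t k]] mat_one_def fun_eq_iff)
next
  case (Suc i)
  then obtain c where c: "\<And>q. q \<in> weights k \<Longrightarrow> q - real i \<in> weights k \<Longrightarrow> c q > 0"
    and lin: "lin (rep_word t k) (gen Let_f ^ i) =
      (\<lambda>p q. if p \<in> weights k \<and> q \<in> weights k \<and> p = q - real i then complex_of_real (c q) else 0)"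
    by blast
  have w: "q - real i \<in> weights k" "q - real (Suc i) < k" "- k - 1 < q - real (Suc i)"
    if "q \<in> weights k" "q - real (Suc i) \<in> weights k" for q
  proof -
    have "q - real (Suc i) + 1 \<in> weights k"
      by (rule weights_Suc[OF k that(2)]) (use that in \<open>auto simp: weights_iff\<close>)
    then show "q - real i \<in> weights k" by simp
  qed (use that in \<open>auto simp: weights_iff\<close>)
  have w': "p + 1 \<in> weights k" if "p \<in> weights k" "p + (1 + real i) \<in> weights k" for p
    using w(1)[OF that(2)] that by simp
  show ?case
  proof (intro exI conjI allI impI)
    fix q assume "q \<in> weights k \<and> q - real (Suc i) \<in> weights k"
    then show "rung t k (q - real (Suc i)) * c q > 0"
      using c[of q] w[of q] rung_pos[OF t, of k "q - real (Suc i)"] by simp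
  next
    show "lin (rep_word t k) (gen Let_f ^ Suc i) = (\<lambda>p q. if p \<in> weights k \<and> q \<in> weights k \<and>
       p = q - real (Suc i) then complex_of_real (rung t k (q - real (Suc i)) * c q) else 0)"
      using w w' by (auto simp: matrix_rep.lin_mult[OF matrix_rep_rep_word[OF t k]] lin lin_gen
        rep_word_letter[OF t k] rep_letter_relations[OF t k] fun_eq_iff algebra_simps)
  qed
qed

lemma weight_diff_nat:
  assumes "k \<in> spins" "p \<in> weights k" "q \<in> weights k" "q \<le> p"
  shows "real (nat \<lfloor>p - q\<rfloor>) = p - q"
proof -
  have "p - q \<in> \<int>" using assms Ints_diff[of "k + p" "k + q"] by (auto simp: weights_iff)
  then show ?thesis using assms(4) by (auto elim!: Ints_cases)
qed

text \<open>\<open>e\<^bsup>2k\<^esup>\<close> maps the lowest vector of \<open>\<H>\<^sub>k\<close> to a multiple of the highest one, kills all other basis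
  vectors of \<open>\<H>\<^sub>k\<close> and vanishes on all smaller \<open>\<H>\<^sub>k'\<close>; multiplying by powers of \<open>f\<close> moves this
  matrix unit to any position.\<close>

lemma matrix_unit_realised:
  assumes t: "t > 0" and k: "k \<in> spins" and p: "p \<in> weights k" and q: "q \<in> weights k"
  shows "\<exists>x. lin (rep_word t k) x = (\<lambda>i j. if i = p \<and> j = q then 1 else 0) \<and>
    (\<forall>k'\<in>spins. k' < k \<longrightarrow> lin (rep_word t k') x = 0)"
proof -
  note rep = matrix_rep_rep_word[OF t k]
  \<comment> \<open>f^b takes \<xi>(k,q) down to the bottom, e^N with N = 2k lifts the bottom to the
    top, and f^a brings the top down to \<xi>(k,p).\<close>
  define N a b where "N = nat \<lfloor>k - (- k)\<rfloor>" and "a = nat \<lfloor>k - p\<rfloor>" and "b = nat \<lfloor>q - (- k)\<rfloor>"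
  note ends = weights_top[OF k] weights_bot[OF k]
  have N: "real N = 2 * k" and a: "real a = k - p" and b: "real b = q + k"
    using weight_diff_nat[OF k ends] weight_diff_nat[OF k ends(1) p] weight_diff_nat[OF k q ends(2)] p q k
    by (auto simp: N_def a_def b_def weights_iff spins_iff)
  define x where "x = gen Let_f ^ a * (gen Let_e ^ N * gen Let_f ^ b)"
  obtain ce where ce: "\<And>q. q \<in> weights k \<Longrightarrow> q + real N \<in> weights k \<Longrightarrow> ce q > 0"
    and e: "lin (rep_word t k) (gen Let_e ^ N) =
      (\<lambda>p q. if p \<in> weights k \<and> q \<in> weights k \<and> p = q + real N then complex_of_real (ce q) else 0)"
    using lin_e_power[OF t k, of N] by blast
  obtain ca where ca: "\<And>q. q \<in> weights k \<Longrightarrow> q - real a \<in> weights k \<Longrightarrow> ca q > 0"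
    and fa: "lin (rep_word t k) (gen Let_f ^ a) =
      (\<lambda>p q. if p \<in> weights k \<and> q \<in> weights k \<and> p = q - real a then complex_of_real (ca q) else 0)"
    using lin_f_power[OF t k, of a] by blast
  obtain cb where cb: "\<And>q. q \<in> weights k \<Longrightarrow> q - real b \<in> weights k \<Longrightarrow> cb q > 0"
    and fb: "lin (rep_word t k) (gen Let_f ^ b) =
      (\<lambda>p q. if p \<in> weights k \<and> q \<in> weights k \<and> p = q - real b then complex_of_real (cb q) else 0)"
    using lin_f_power[OF t k, of b] by blast
  define C where "C = complex_of_real (ca k * (ce (- k) * cb q))"
  have "C \<noteq> 0"
    using ca[of k] ce[of "- k"] cb[of q] ends p q by (simp add: C_def a b N)
  have edge: "i \<in> weights k \<and> j \<in> weights k \<and> i = j + 2 * k \<longleftrightarrow> i = k \<and> j = - k" for i j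
    using ends by (auto simp: weights_iff)
  have ef: "lin (rep_word t k) (gen Let_e ^ N * gen Let_f ^ b) =
      (\<lambda>i j. if i = k \<and> j = q then complex_of_real (ce (- k) * cb q) else 0)"
  proof (intro ext)
    fix i j
    have "lin (rep_word t k) (gen Let_e ^ N * gen Let_f ^ b) i j = (\<Sum>l\<in>weights k. if - k = l then
       (if i = k \<and> j = q then complex_of_real (ce (- k) * cb q) else 0) else 0)"
      unfolding matrix_rep.lin_mult[OF rep, of "gen Let_e ^ N"] mat_mult_def
      by (rule sum.cong) (use ends q in \<open>auto simp: e fb N b edge\<close>)
    then show "lin (rep_word t k) (gen Let_e ^ N * gen Let_f ^ b) i j =
        (if i = k \<and> j = q then complex_of_real (ce (- k) * cb q) else 0)"
      using ends by simp
  qed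
  have x: "lin (rep_word t k) x = (\<lambda>i j. if i = p \<and> j = q then C else 0)"
  proof (intro ext)
    fix i j
    have "lin (rep_word t k) x i j = (\<Sum>l\<in>weights k. if k = l then
       (if i = p \<and> j = q then C else 0) else 0)"
      unfolding x_def matrix_rep.lin_mult[OF rep, of "gen Let_f ^ a"] mat_mult_def
      by (rule sum.cong) (use ends p in \<open>auto simp: fa ef a C_def\<close>)
    then show "lin (rep_word t k) x i j = (if i = p \<and> j = q then C else 0)"
      using ends by simp
  qed
  \<comment> \<open>Weights of a smaller spin k' differ by at most 2k' < N.\<close>
  have x0: "lin (rep_word t k') x = 0" if k': "k' \<in> spins" "k' < k" for k'
  proof -
    note rep' = matrix_rep_rep_word[OF t k'(1)]
    obtain c where "lin (rep_word t k') (gen Let_e ^ N) =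
      (\<lambda>p q. if p \<in> weights k' \<and> q \<in> weights k' \<and> p = q + real N then complex_of_real (c q) else 0)"
      using lin_e_power[OF t k'(1), of N] by blast
    also have "\<dots> = 0" using k'(2) by (auto simp: fun_eq_iff N weights_iff)
    finally show ?thesis by (simp add: x_def matrix_rep.lin_mult[OF rep'])
  qed
  show ?thesis
    by (rule exI[of _ "scalar (inverse C) * x"])
      (use x0 in \<open>auto simp: lin_scalar x \<open>C \<noteq> 0\<close> fun_eq_iff\<close>)
qed

lemma matrix_realised:
  assumes t: "t > 0" and k: "k \<in> spins" and b: "\<And>p q. b p q \<noteq> 0 \<Longrightarrow> p \<in> weights k \<and> q \<in> weights k"
  shows "\<exists>x. lin (rep_word t k) x = b \<and> (\<forall>k'\<in>spins. k' < k \<longrightarrow> lin (rep_word t k') x = 0)"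
proof -
  let ?K = "weights k"
  define U where "U p q = (SOME x. lin (rep_word t k) x = (\<lambda>i j. if i = p \<and> j = q then 1 else 0) \<and>
    (\<forall>k'\<in>spins. k' < k \<longrightarrow> lin (rep_word t k') x = 0))" for p q
  have U_ex: "lin (rep_word t k) (U p q) = (\<lambda>i j. if i = p \<and> j = q then 1 else 0) \<and>
    (\<forall>k'\<in>spins. k' < k \<longrightarrow> lin (rep_word t k') (U p q) = 0)" if "p \<in> ?K" "q \<in> ?K" for p q
    unfolding U_def by (rule someI_ex) (rule matrix_unit_realised[OF t k that])
  then have U: "\<And>p q. p \<in> ?K \<Longrightarrow> q \<in> ?K \<Longrightarrow>
      lin (rep_word t k) (U p q) = (\<lambda>i j. if i = p \<and> j = q then 1 else 0)"
    and U0: "\<And>p q k'. p \<in> ?K \<Longrightarrow> q \<in> ?K \<Longrightarrow> k' \<in> spins \<Longrightarrow> k' < k \<Longrightarrow> lin (rep_word t k') (U p q) = 0"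
    by blast+
  define x where "x = (\<Sum>p\<in>?K. \<Sum>q\<in>?K. scalar (b p q) * U p q)"
  have lin_x: "lin \<psi> x i j = (\<Sum>p\<in>?K. \<Sum>q\<in>?K. b p q * lin \<psi> (U p q) i j)" for \<psi> :: "word \<Rightarrow> real matr" and i j
    by (simp add: x_def lin_sum lin_scalar)
  have "lin (rep_word t k) x i j = b i j" for i j
  proof -
    have "lin (rep_word t k) x i j = (\<Sum>p\<in>?K. \<Sum>q\<in>?K. if j = q then (if i = p then b i j else 0) else 0)"
      unfolding lin_x by (intro sum.cong refl) (auto simp: U)
    also have "\<dots> = (if i \<in> ?K \<and> j \<in> ?K then b i j else 0)"
      by (cases "j \<in> ?K") simp_all
    finally show ?thesis using b[of i j] by auto
  qed
  moreover have "lin (rep_word t k') x i j = 0" if "k' \<in> spins" "k' < k" for k' i j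
    unfolding lin_x using U0 that by (intro sum.neutral ballI) simp
  ultimately show ?thesis by (intro exI[of _ x]) (auto simp: fun_eq_iff)
qed

text \<open>The system is triangular: the matrix at spin N/2 can be corrected by an element that
  vanishes on all smaller spins, so the values already attained stay.\<close>

lemma family_realised:
  assumes t: "t > 0" and b: "b \<in> dprod spins weights"
  shows "\<exists>x. \<forall>k\<in>spins. 2 * k < real N \<longrightarrow> lin (rep_word t k) x = b k"
proof (induction N)
  case 0
  show ?case by (auto simp: spins_iff)
next
  case (Suc N)
  then obtain x where x: "\<And>k. k \<in> spins \<Longrightarrow> 2 * k < real N \<Longrightarrow> lin (rep_word t k) x = b k" by blast
  define k0 where "k0 = real N / 2"
  have k0: "k0 \<in> spins" by (auto simp: k0_def spins_def)
  have "\<exists>y. lin (rep_word t k0) y = b k0 - lin (rep_word t k0) x \<and>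
      (\<forall>k'\<in>spins. k' < k0 \<longrightarrow> lin (rep_word t k') y = 0)"
  proof (rule matrix_realised[OF t k0])
    fix p q assume "(b k0 - lin (rep_word t k0) x) p q \<noteq> 0"
    then have "b k0 p q \<noteq> 0 \<or> lin (rep_word t k0) x p q \<noteq> 0" by auto
    then show "p \<in> weights k0 \<and> q \<in> weights k0"
      using b matrix_rep.lin_supp[OF matrix_rep_rep_word[OF t k0], of x p q] by (auto simp: dprod_def)
  qed
  then obtain y where y: "lin (rep_word t k0) y = b k0 - lin (rep_word t k0) x"
    and y0: "\<And>k. k \<in> spins \<Longrightarrow> k < k0 \<Longrightarrow> lin (rep_word t k) y = 0" by blast
  show ?case
  proof (intro exI[of _ "x + y"] ballI impI)
    fix k assume k: "k \<in> spins" "2 * k < real (Suc N)"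
    then obtain i :: nat where i: "k = real i / 2" by (auto simp: spins_def)
    with k have "i < Suc N" by simp
    then consider "i < N" | "i = N" by linarith
    then show "lin (rep_word t k) (x + y) = b k"
    proof cases
      case 1
      then have "k < k0" "2 * k < real N" by (simp_all add: i k0_def)
      then show ?thesis by (simp add: x[OF k(1)] y0[OF k(1)] lin_add)
    next
      case 2
      then have "k = k0" by (simp add: i k0_def)
      then show ?thesis by (simp add: lin_add y)
    qed
  qed
qed

section \<open>The Clebsch-Gordan decomposition\<close>

text \<open>The slices of the vector are written as matrices with a dummy column, so that
  \<open>rep_letter_relations\<close> evaluates each leg.\<close>

lemma act_tensor:
  assumes "finite K" "finite L"
  shows "act (K \<times> L) (mat_tensor x y) z (a, b) = mat_mult K x (\<lambda>c _. mat_mult L y (\<lambda>d _. z (c, d)) b b) a a"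
  by (simp add: act_def mat_tensor_def mat_mult_def sum_distrib_left mult.assoc sum.cartesian_product)
    (simp add: case_prod_unfold mult.assoc)

lemma act_add: "act K (x + y) v a = act K x v a + act K y v a"
  by (simp add: act_def distrib_right sum.distrib)

locale tensor_rep =
  fixes t n m :: real
  assumes t: "t > 0" and n: "n \<in> spins" and m: "m \<in> spins"
begin

sublocale At_rep t "weights n \<times> weights m" "rep2_word t n m"
  by (rule At_rep_rep2_word[OF t n m])

abbreviation "K \<equiv> weights n \<times> weights m"

lemma Q_apply: "(a, b) \<in> K \<Longrightarrow> Q z (a, b) = complex_of_real (exp (t * (a + b))) * z (a, b)"
  by (simp add: cprod_letter act_tensor rep_word_letter t n m rep_letter_relations distrib_left exp_add)

lemma E_apply:
  "(a, b) \<in> K \<Longrightarrow> E z (a, b) = complex_of_real (exp (t * a) * rung t m (b - 1)) * z (a, b - 1)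
    + complex_of_real (rung t n (a - 1) * exp (- t * b)) * z (a - 1, b)"
  by (simp add: cprod_letter act_add act_tensor rep_word_letter t n m rep_letter_relations)

text \<open>The matrices are real, so f is the transpose of e and not only its adjoint. This permits
  a bilinear pairing, free of conjugations.\<close>

lemma E_transpose:
  "(\<Sum>c\<in>K. E z c * w c) = (\<Sum>c\<in>K. z c * F w c)"
proof -
  have transpose: "rep2_word t n m (Word [Let_f]) a c = rep2_word t n m (Word [Let_e]) c a" for a c
    by (cases a; cases c)
      (auto simp: cprod_letter mat_tensor_def rep_word_letter t n m rep_letter_eq)
  have "(\<Sum>c\<in>K. E z c * w c) = (\<Sum>c\<in>K. \<Sum>d\<in>K. rep2_word t n m (Word [Let_e]) c d * z d * w c)"
    by (simp add: act_def sum_distrib_right)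
  also have "\<dots> = (\<Sum>d\<in>K. \<Sum>c\<in>K. rep2_word t n m (Word [Let_e]) c d * z d * w c)"
    by (rule sum.swap)
  also have "\<dots> = (\<Sum>d\<in>K. z d * F w d)"
    by (simp add: act_def sum_distrib_left transpose mult_ac)
  finally show ?thesis .
qed

definition homogeneous :: "real \<Rightarrow> (real \<times> real \<Rightarrow> complex) \<Rightarrow> bool"
  where "homogeneous j z \<longleftrightarrow> (\<forall>a b. z (a, b) \<noteq> 0 \<longrightarrow> a + b = j)"

lemma E_homogeneous:
  assumes "homogeneous j z"
  shows "homogeneous (j + 1) (E z)"
  unfolding homogeneous_def
proof (intro allI impI)
  fix a b assume *: "E z (a, b) \<noteq> 0"
  then have "(a, b) \<in> K" using act_supported[of "Word [Let_e]" z] by (auto simp: supported_def)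
  then have "z (a, b - 1) \<noteq> 0 \<or> z (a - 1, b) \<noteq> 0" using * E_apply[of a b z] by auto
  then have "a + (b - 1) = j \<or> a - 1 + b = j" using assms unfolding homogeneous_def by blast
  then show "a + b = j + 1" by auto
qed

lemma weight_below_top:
  assumes "k \<in> spins" "b \<in> weights k"
  obtains i :: nat where "b = k - real i"
proof
  show "b = k - real (nat \<lfloor>k - b\<rfloor>)"
    using assms(2) by (subst weight_diff_nat[OF assms(1) weights_top[OF assms(1)] assms(2)]) (simp_all add: weights_iff)
qed

lemma weight_above_bot:
  assumes "k \<in> spins" "b \<in> weights k"
  obtains i :: nat where "b = - k + real i"
proof
  show "b = - k + real (nat \<lfloor>b - (- k)\<rfloor>)"
    using assms(2) by (subst weight_diff_nat[OF assms weights_bot[OF assms(1)]]) (simp_all add: weights_iff)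
qed

text \<open>A highest weight vector of weight j is determined by its entry at (j-m, m): the equation
  e z = 0 at (a, b+1) expresses z (a, b) through z (a-1, b+1), with a nonzero factor
  \<open>rung t m b\<close>.\<close>

lemma highest_weight_zero:
  assumes z: "supported K z" "homogeneous j z" "E z = (\<lambda>_. 0)"
    and edge: "z (j - m, m) = 0"
  shows "z = (\<lambda>_. 0)"
proof -
  have "z (j - (m - real i), m - real i) = 0" for i
  proof (induction i)
    case (Suc i)
    define b a where "b = m - real (Suc i)" and "a = j - b"
    show ?case
    proof (rule ccontr)
      assume "z (j - (m - real (Suc i)), m - real (Suc i)) \<noteq> 0"
      then have nz: "z (a, b) \<noteq> 0" by (simp add: a_def b_def)
      then have K: "(a, b) \<in> K" using z(1) by (auto simp: supported_def)
      have "b \<noteq> m" by (simp add: b_def)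
      then have K': "(a, b + 1) \<in> K" using K weights_Suc[OF m, of b] by auto
      have "z (a - 1, b + 1) = 0" using Suc by (simp add: a_def b_def algebra_simps)
      then have "complex_of_real (exp (t * a) * rung t m b) * z (a, b) = 0"
        using E_apply[OF K', of z] z(3) by simp
      moreover have "rung t m b > 0"
        using K by (intro rung_pos[OF t]) (auto simp: weights_iff b_def)
      ultimately show False using nz by simp
    qed
  qed (simp add: edge)
  moreover have "\<exists>i. b = m - real i" if "z (a, b) \<noteq> 0" for a b
  proof -
    have "b \<in> weights m" using that z(1) by (auto simp: supported_def)
    then show ?thesis using weight_below_top[OF m] by metis
  qed
  ultimately have "z (a, b) = 0" for a b
    using z(2) by (metis add_diff_cancel_right' homogeneous_def)
  then show ?thesis by (simp add: fun_eq_iff)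
qed

text \<open>The recursion is run from the other end: e z = 0 at (a+1, b) expresses z (a, b) through
  z (a+1, b-1). As j < n - m forces a < n, the factor \<open>rung t n a\<close> is nonzero, and at b
  = -m there is nothing on the other side.\<close>

lemma highest_weight_small:
  assumes z: "supported K z" "homogeneous j z" "E z = (\<lambda>_. 0)" and "j < n - m"
  shows "z = (\<lambda>_. 0)"
proof -
  have "z (j - (- m + real i), - m + real i) = 0" for i
  proof (induction i)
    case 0
    show ?case
    proof (rule ccontr)
      assume nz: "z (j - (- m + real 0), - m + real 0) \<noteq> 0"
      then have K: "(j + m, - m) \<in> K" using z(1) by (auto simp: supported_def)
      then have K': "(j + m + 1, - m) \<in> K" using weights_Suc[OF n, of "j + m"] assms(4) by auto
      have "complex_of_real (rung t n (j + m) * exp (- t * (- m))) * z (j + m, - m) = 0"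
        using E_apply[OF K', of z] z(3) by simp
      moreover have "rung t n (j + m) > 0"
        using K assms(4) by (intro rung_pos[OF t]) (auto simp: weights_iff)
      ultimately show False using nz by simp
    qed
  next
    case (Suc i)
    define b a where "b = - m + real (Suc i)" and "a = j - b"
    show ?case
    proof (rule ccontr)
      assume "z (j - (- m + real (Suc i)), - m + real (Suc i)) \<noteq> 0"
      then have nz: "z (a, b) \<noteq> 0" by (simp add: a_def b_def)
      then have K: "(a, b) \<in> K" using z(1) by (auto simp: supported_def)
      have "a < n" using assms(4) by (simp add: a_def b_def)
      then have K': "(a + 1, b) \<in> K" using K weights_Suc[OF n, of a] by auto
      have "z (a + 1, b - 1) = 0" using Suc by (simp add: a_def b_def algebra_simps)
      then have "complex_of_real (rung t n a * exp (- t * b)) * z (a, b) = 0"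
        using E_apply[OF K', of z] z(3) by simp
      moreover have "rung t n a > 0"
        using K \<open>a < n\<close> by (intro rung_pos[OF t]) (auto simp: weights_iff)
      ultimately show False using nz by simp
    qed
  qed
  moreover have "\<exists>i. b = - m + real i" if "z (a, b) \<noteq> 0" for a b
  proof -
    have "b \<in> weights m" using that z(1) by (auto simp: supported_def)
    then show ?thesis using weight_above_bot[OF m] by metis
  qed
  ultimately have "z (a, b) = 0" for a b
    using z(2) by (metis add_diff_cancel_right' homogeneous_def)
  then show ?thesis by (simp add: fun_eq_iff)
qed

text \<open>The recursion is e h = 0 at (a, b) = (j-m+i+1, m-i), solved for the coefficient at (a,
  b-1). Up to normalisation these are the quantum Clebsch-Gordan coefficients of the top vector of
  spin j.\<close>

primrec hw_coeff :: "real \<Rightarrow> nat \<Rightarrow> real"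
  where
    "hw_coeff j 0 = 1"
  | "hw_coeff j (Suc i) = - (hw_coeff j i * rung t n (j - m + real i) * exp (- t * (m - real i)))
      / (exp (t * (j - m + real i + 1)) * rung t m (m - real i - 1))"

definition hw_vector :: "real \<Rightarrow> real \<times> real \<Rightarrow> complex"
  where "hw_vector j = (\<lambda>(a, b). if (a, b) \<in> K \<and> a + b = j
    then complex_of_real (hw_coeff j (nat \<lfloor>m - b\<rfloor>)) else 0)"

lemma hw_vector_supported: "supported K (hw_vector j)"
  and hw_vector_homogeneous: "homogeneous j (hw_vector j)"
  by (auto simp: supported_def homogeneous_def hw_vector_def split: if_splits)

lemma cg_spins_weight:
  assumes "j \<in> cg_spins n m"
  shows "j - m \<in> weights n" "j \<ge> n - m"
proof -
  obtain a b c :: int where abc: "2 * n = of_int a" "2 * m = of_int b" "j - \<bar>n - m\<bar> = of_int c"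
    using assms n m by (auto simp: spins_iff cg_spins_iff elim!: Ints_cases)
  have "n + (j - m) = of_int (if n \<ge> m then a - b + c else c)"
    using abc by (simp add: abs_if split: if_splits)
  then have "n + (j - m) \<in> \<int>" by (metis Ints_of_int)
  then show "j - m \<in> weights n" "j \<ge> n - m"
    using assms by (auto simp: weights_iff cg_spins_iff)
qed

lemma hw_vector_top: "j \<in> cg_spins n m \<Longrightarrow> hw_vector j (j - m, m) = 1"
  using cg_spins_weight(1) weights_top[OF m] by (simp add: hw_vector_def)

lemma E_hw_vector:
  assumes j: "j \<in> cg_spins n m"
  shows "E (hw_vector j) = (\<lambda>_. 0)"
proof -
  have "E (hw_vector j) (a, b) = 0" for a b
  proof (rule ccontr)
    assume nz: "E (hw_vector j) (a, b) \<noteq> 0"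
    have "a + b = j + 1"
      using E_homogeneous[OF hw_vector_homogeneous] nz by (auto simp: homogeneous_def)
    have K: "(a, b) \<in> K"
      using nz act_supported[of "Word [Let_e]" "hw_vector j"] by (auto simp: supported_def)
    obtain i where i: "b = m - real i" using weight_below_top[OF m] K by auto
    have a: "a = j - m + real i + 1" using \<open>a + b = j + 1\<close> i by simp
    have h1: "hw_vector j (a - 1, b) = complex_of_real (hw_coeff j i)" if "a \<noteq> - n"
      using that K weights_pred[OF n, of a] a i by (simp add: hw_vector_def)
    have h2: "hw_vector j (a, b - 1) = complex_of_real (hw_coeff j (Suc i))" if "b \<noteq> - m"
    proof -
      have "(a, b - 1) \<in> K" using that K weights_pred[OF m, of b] by auto
      moreover have "m - (b - 1) = real (Suc i)" using i by simp
      then have "nat \<lfloor>m - (b - 1)\<rfloor> = Suc i" by (simp only: floor_of_nat nat_int)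
      ultimately show ?thesis using \<open>a + b = j + 1\<close> by (simp add: hw_vector_def)
    qed
    \<comment> \<open>At b = -m the single remaining term could not be cancelled; j \<ge> n - m
      rules this out, since a would exceed n.\<close>
    have "b \<noteq> - m"
    proof
      assume b: "b = - m"
      then have "a = j + m + 1" using \<open>a + b = j + 1\<close> by simp
      moreover have "a \<le> n" using K by (simp add: weights_iff)
      ultimately show False using cg_spins_weight(2)[OF j] by simp
    qed
    then have "b - 1 \<in> weights m" using K weights_pred[OF m, of b] by auto
    then have pos: "rung t m (b - 1) > 0" using K by (intro rung_pos[OF t]) (auto simp: weights_iff)
    have "complex_of_real (exp (t * a) * rung t m (b - 1)) * hw_vector j (a, b - 1)
      = - complex_of_real (rung t n (a - 1) * exp (- t * b) * hw_coeff j i)"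
    proof -
      have "hw_coeff j (Suc i) = - (hw_coeff j i * rung t n (a - 1) * exp (- t * b)) / (exp (t * a) * rung t m (b - 1))"
        by (simp add: i a)
      then have "exp (t * a) * rung t m (b - 1) * hw_coeff j (Suc i) = - (rung t n (a - 1) * exp (- t * b) * hw_coeff j i)"
        using pos by (simp add: mult_ac)
      then show ?thesis unfolding h2[OF \<open>b \<noteq> - m\<close>] by (simp only: flip: of_real_mult of_real_minus)
    qed
    moreover have "complex_of_real (rung t n (a - 1) * exp (- t * b)) * hw_vector j (a - 1, b)
      = complex_of_real (rung t n (a - 1) * exp (- t * b) * hw_coeff j i)"
    \<comment> \<open>For a = -n the entry at a - 1 lies outside the weights, but its coefficient is
      \<open>rung t n (- n - 1) = 0\<close>.\<close>
    proof (cases "a = - n")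
      case False
      show ?thesis by (simp only: h1[OF False] of_real_mult)
    qed simp
    ultimately show False using nz E_apply[OF K, of "hw_vector j"] by simp
  qed
  then show ?thesis by (simp add: fun_eq_iff)
qed

definition cg_map :: "real \<Rightarrow> real \<Rightarrow> real \<times> real \<Rightarrow> complex"
  where "cg_map k j = descend k (hw_vector k) (nat \<lfloor>k - j\<rfloor>)"

lemma cg_map_top: "cg_map k k = hw_vector k"
  by (simp add: cg_map_def)

lemma cg_map_intertwiner:
  assumes k: "k \<in> cg_spins n m"
  shows "intertwiner K (rep2_word t n m) (weights k) (rep_word t k) (cg_map k)"
  unfolding cg_map_def
proof (rule highest_weight_intertwiner)
  show "k \<in> spins" by (rule cg_spins_spin[OF n m k])
  have "Q (hw_vector k) (a, b) = complex_of_real (exp (t * k)) * hw_vector k (a, b)" for a b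
  proof (cases "(a, b) \<in> K")
    case True
    then show ?thesis using hw_vector_homogeneous[of k] by (auto simp: Q_apply homogeneous_def)
  next
    case False
    then have "Q (hw_vector k) (a, b) = 0" "hw_vector k (a, b) = 0"
      using hw_vector_supported[of k] act_supported[of "Word [Let_q]" "hw_vector k"]
      unfolding supported_def by blast+
    then show ?thesis by simp
  qed
  then show "Q (hw_vector k) = (\<lambda>a. complex_of_real (exp (t * k)) * hw_vector k a)" by (simp add: fun_eq_iff)
qed (use k in \<open>simp_all add: hw_vector_supported E_hw_vector\<close>)

lemma cg_map_apply:
  assumes k: "k \<in> cg_spins n m" and j: "j \<in> weights k"
  shows "act K (lin (rep2_word t n m) x) (cg_map k j) = (\<lambda>a. \<Sum>i\<in>weights k. lin (rep_word t k) x i j * cg_map k i a)"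
  using cg_map_intertwiner[OF k] j by (auto simp: intertwiner_def)

text \<open>Compare the eigenvalues of q on the two sides; exp(t x) determines x because t >
  0.\<close>

lemma cg_map_homogeneous:
  assumes k: "k \<in> cg_spins n m" and j: "j \<in> weights k" and ab: "(a, b) \<in> K" and nz: "cg_map k j (a, b) \<noteq> 0"
  shows "a + b = j"
proof -
  have ks: "k \<in> spins" by (rule cg_spins_spin[OF n m k])
  have "Q (cg_map k j) (a, b) = (\<Sum>i\<in>weights k. rep_letter t k Let_q i j * cg_map k i (a, b))"
    using cg_map_apply[OF k j, of "gen Let_q"] by (simp add: lin_gen rep_word_letter[OF t ks])
  also have "\<dots> = (\<Sum>i\<in>weights k. if i = j then complex_of_real (exp (t * j)) * cg_map k j (a, b) else 0)"
    by (rule sum.cong) (auto simp: rep_letter_eq[OF t ks])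
  also have "\<dots> = complex_of_real (exp (t * j)) * cg_map k j (a, b)" using j by simp
  finally have "exp (t * (a + b)) = exp (t * j)" using nz by (simp add: Q_apply[OF ab])
  then show ?thesis using t by simp
qed

text \<open>Vectors orthogonal, for the bilinear pairing, to all the images of the intertwiners vanish. They form
  a subspace stable under \<open>e\<close> and under projection to weight spaces, so a nonzero one would yield a
  highest weight vector in this subspace; but highest weight vectors are multiples of \<open>hw_vector\<close>.\<close>

definition annihilates :: "(real \<times> real \<Rightarrow> complex) \<Rightarrow> bool"
  where "annihilates z \<longleftrightarrow> (\<forall>k\<in>cg_spins n m. \<forall>j\<in>weights k. (\<Sum>c\<in>K. z c * cg_map k j c) = 0)"

text \<open>Pairing e z with a vector is pairing z with f of that vector, which lies in the same
  copy of H_k.\<close>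

lemma annihilates_E:
  assumes "annihilates z"
  shows "annihilates (E z)"
  unfolding annihilates_def
proof (intro ballI)
  fix k j assume k: "k \<in> cg_spins n m" and j: "j \<in> weights k"
  have "(\<Sum>c\<in>K. E z c * cg_map k j c) = (\<Sum>c\<in>K. z c * (\<Sum>i\<in>weights k. lin (rep_word t k) (gen Let_f) i j * cg_map k i c))"
    unfolding E_transpose using cg_map_apply[OF k j, of "gen Let_f"] by (simp add: lin_gen)
  also have "\<dots> = (\<Sum>c\<in>K. \<Sum>i\<in>weights k. lin (rep_word t k) (gen Let_f) i j * (z c * cg_map k i c))"
    by (simp add: sum_distrib_left mult_ac)
  also have "\<dots> = (\<Sum>i\<in>weights k. lin (rep_word t k) (gen Let_f) i j * (\<Sum>c\<in>K. z c * cg_map k i c))"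
    by (subst sum.swap) (simp add: sum_distrib_left)
  also have "\<dots> = 0" using assms k by (intro sum.neutral) (auto simp: annihilates_def)
  finally show "(\<Sum>c\<in>K. E z c * cg_map k j c) = 0" .
qed

text \<open>If the entry at (j-m, m) vanishes or j < n - m, then z = 0 without any orthogonality.
  Otherwise j is in I_nm and z is a multiple of the vector already known, with which it pairs to
  0.\<close>

lemma highest_weight_annihilator:
  assumes z: "supported K z" "homogeneous j z" "E z = (\<lambda>_. 0)" "annihilates z" and i: "j = n + m - real i"
  shows "z = (\<lambda>_. 0)"
proof -
  consider "z (j - m, m) = 0" | "j < n - m" | "j \<ge> n - m" "j - m \<in> weights n"
    using z(1) by (force simp: supported_def)
  then show ?thesis
  proof cases
    case 3
    have "j \<ge> m - n" using 3 by (auto simp: weights_iff)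
    \<comment> \<open>The form n + m - i of the weight provides the integrality required by
      \<open>cg_spins\<close>.\<close>
    moreover have "j - \<bar>n - m\<bar> \<in> \<int>"
    proof -
      have "2 * m \<in> \<int>" "2 * n \<in> \<int>" using m n by (auto simp: spins_iff)
      then have "2 * m - real i \<in> \<int>" "2 * n - real i \<in> \<int>" by simp_all
      then show ?thesis by (auto simp: i abs_if algebra_simps)
    qed
    ultimately have j: "j \<in> cg_spins n m" using 3 i by (auto simp: cg_spins_iff)
    have top: "(j - m, m) \<in> K" using cg_spins_weight(1)[OF j] weights_top[OF m] by simp
    have js: "j \<in> spins" by (rule cg_spins_spin[OF n m j])
    define c where "c = z (j - m, m)"
    \<comment> \<open>Subtracting the right multiple clears the edge entry, so the remainder is
      0.\<close>
    define z' where "z' = (\<lambda>a. z a - c * hw_vector j a)"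
    have "E z' = (\<lambda>a. E z a - c * E (hw_vector j) a)"
      by (simp add: z'_def act_def fun_eq_iff right_diff_distrib sum_subtractf)
        (simp add: sum_distrib_left mult_ac)
    then have "E z' = (\<lambda>_. 0)" by (simp add: z(3) E_hw_vector[OF j])
    moreover have "supported K z'" "homogeneous j z'"
    proof -
      have "z' p \<noteq> 0 \<Longrightarrow> z p \<noteq> 0 \<or> hw_vector j p \<noteq> 0" for p by (auto simp: z'_def)
      then show "supported K z'" "homogeneous j z'"
        using z(1,2) hw_vector_supported[of j] hw_vector_homogeneous[of j]
        unfolding supported_def homogeneous_def by blast+
    qed
    moreover have "z' (j - m, m) = 0" by (simp add: z'_def c_def hw_vector_top[OF j])
    ultimately have "z' = (\<lambda>_. 0)" using highest_weight_zero by blast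
    then have zc: "z = (\<lambda>a. c * hw_vector j a)" by (simp add: z'_def fun_eq_iff)
    have "(\<Sum>a\<in>K. z a * cg_map j j a) = 0"
      using z(4) j weights_top[OF js] by (simp add: annihilates_def)
    then have prod: "c * (\<Sum>a\<in>K. hw_vector j a * hw_vector j a) = 0"
      by (simp add: zc cg_map_top sum_distrib_left mult.assoc)
    \<comment> \<open>The coefficients of \<open>hw_vector\<close> are real, so its bilinear square
      is a sum of squares, and the entry at (j-m, m) equals 1.\<close>
    have norm: "(\<Sum>a\<in>K. hw_vector j a * hw_vector j a) = complex_of_real (\<Sum>a\<in>K. (Re (hw_vector j a))\<^sup>2)"
      by (simp add: of_real_sum) (auto intro!: sum.cong simp: hw_vector_def power2_eq_square)
    have "(\<Sum>a\<in>K. (Re (hw_vector j a))\<^sup>2) > 0"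
      by (rule sum_pos2[OF _ top]) (simp_all add: hw_vector_top[OF j])
    with prod have "c = 0" unfolding norm mult_eq_0_iff of_real_eq_0_iff by simp
    then show ?thesis by (simp add: zc)
  qed (use highest_weight_zero[OF z(1-3)] highest_weight_small[OF z(1-3)] in blast)+
qed

lemma annihilator_zero:
  assumes "supported K z" "annihilates z"
  shows "z = (\<lambda>_. 0)"
proof -
  \<comment> \<open>Induction over the weights downward from n + m. Applying e raises the weight, so
    e z vanishes: above the top weight for lack of basis vectors, below it by the induction
    hypothesis.\<close>
  have hom: "\<forall>z. supported K z \<longrightarrow> annihilates z \<longrightarrow> homogeneous (n + m - real i) z \<longrightarrow> z = (\<lambda>_. 0)" for i
  proof (induction i)
    case 0
    show ?case
    proof (intro allI impI)
      fix z assume z: "supported K z" "annihilates z" "homogeneous (n + m - real 0) z"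
      have "E z (a, b) = 0" for a b
      proof (rule ccontr)
        assume nz: "E z (a, b) \<noteq> 0"
        then have "(a, b) \<in> K" using act_supported[of "Word [Let_e]" z] by (auto simp: supported_def)
        moreover have "a + b = n + m + 1" using nz E_homogeneous[OF z(3)] by (auto simp: homogeneous_def)
        ultimately show False by (auto simp: weights_iff)
      qed
      then have "E z = (\<lambda>_. 0)" by (simp add: fun_eq_iff)
      then show "z = (\<lambda>_. 0)" using highest_weight_annihilator[OF z(1,3) _ z(2)] by blast
    qed
  next
    case (Suc i)
    show ?case
    proof (intro allI impI)
      fix z assume z: "supported K z" "annihilates z" "homogeneous (n + m - real (Suc i)) z"
      have "n + m - real (Suc i) + 1 = n + m - real i" by simp
      with E_homogeneous[OF z(3)] have "homogeneous (n + m - real i) (E z)" by (simp only:)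
      then have "E z = (\<lambda>_. 0)" using Suc act_supported annihilates_E[OF z(2)] by blast
      then show "z = (\<lambda>_. 0)" using highest_weight_annihilator[OF z(1,3) _ z(2)] by blast
    qed
  qed
  have "z (a, b) = 0" for a b
  proof (rule ccontr)
    assume nz: "z (a, b) \<noteq> 0"
    then have K: "(a, b) \<in> K" using assms(1) by (auto simp: supported_def)
    \<comment> \<open>The weight component of z through a nonzero entry. It still annihilates the
      copies because every \<open>cg_map k j\<close> lies in a single weight space.\<close>
    define z' where "z' = (\<lambda>(c, d). if c + d = a + b then z (c, d) else 0)"
    obtain i i' where "a = n - real i" "b = m - real i'"
      using K weight_below_top[OF n] weight_below_top[OF m] by (metis mem_Sigma_iff)
    then have ab: "a + b = n + m - real (i + i')" by simp
    have "supported K z'" "homogeneous (a + b) z'"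
      using assms(1) by (auto simp: z'_def supported_def homogeneous_def split: if_splits)
    moreover have "annihilates z'"
      unfolding annihilates_def
    proof (intro ballI)
      fix k j assume k: "k \<in> cg_spins n m" and j: "j \<in> weights k"
      have "(\<Sum>c\<in>K. z' c * cg_map k j c) = (\<Sum>c\<in>K. if j = a + b then z c * cg_map k j c else 0)"
      proof (rule sum.cong)
        fix c assume "c \<in> K"
        then show "z' c * cg_map k j c = (if j = a + b then z c * cg_map k j c else 0)"
          using cg_map_homogeneous[OF k j, of "fst c" "snd c"]
          by (cases "cg_map k j c = 0") (auto simp: z'_def)
      qed simp
      also have "\<dots> = 0" using assms(2) k j by (cases "j = a + b") (auto simp: annihilates_def)
      finally show "(\<Sum>c\<in>K. z' c * cg_map k j c) = 0" .
    qed
    ultimately have "z' = (\<lambda>_. 0)" using hom[of "i + i'"] unfolding ab by blast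
    moreover have "z' (a, b) \<noteq> 0" using nz by (simp add: z'_def)
    ultimately show False by simp
  qed
  then show ?thesis by (simp add: fun_eq_iff)
qed

text \<open>Applied to the image of an intertwiner, the matrix of x acts through \<pi>_k(x) = 0;
  hence each of its rows annihilates all the copies. This is the uniqueness behind the
  \<open>THE\<close> in \<open>phi\<close>.\<close>

lemma tensor_kernel:
  assumes "\<And>k. k \<in> cg_spins n m \<Longrightarrow> lin (rep_word t k) x = 0"
  shows "lin (rep2_word t n m) x = 0"
proof -
  have "(\<lambda>c. lin (rep2_word t n m) x p c) = (\<lambda>_. 0)" for p
  proof (rule annihilator_zero)
    show "supported K (\<lambda>c. lin (rep2_word t n m) x p c)"
      using lin_supp by (auto simp: supported_def)
    show "annihilates (\<lambda>c. lin (rep2_word t n m) x p c)"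
      unfolding annihilates_def
    proof (intro ballI)
      fix k j assume k: "k \<in> cg_spins n m" and j: "j \<in> weights k"
      have "(\<Sum>c\<in>K. lin (rep2_word t n m) x p c * cg_map k j c) = act K (lin (rep2_word t n m) x) (cg_map k j) p"
        by (simp add: act_def)
      also have "\<dots> = 0" by (simp add: cg_map_apply[OF k j] assms[OF k])
      finally show "(\<Sum>c\<in>K. lin (rep2_word t n m) x p c * cg_map k j c) = 0" .
    qed
  qed
  then show ?thesis by (simp add: fun_eq_iff)
qed

end

section \<open>The coproduct of the discrete quantum group\<close>

lemma fam_sum_apply: "(\<Sum>a\<in>A. f a) i p q = (\<Sum>a\<in>A. f a i p q)"
  for f :: "'a \<Rightarrow> ('i, 'b) fam"
  by (induction A rule: infinite_finite_induct) auto

lemma module_fscale: "Modules.module (fscale :: complex \<Rightarrow> ('i, 'b) fam \<Rightarrow> ('i, 'b) fam)"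
  by standard (simp_all add: fscale_def fun_eq_iff algebra_simps)

lemma dsumI:
  assumes "\<And>i p q. x i p q \<noteq> 0 \<Longrightarrow> i \<in> I \<and> p \<in> B i \<and> q \<in> B i" "finite J" "\<And>i p q. x i p q \<noteq> 0 \<Longrightarrow> i \<in> J"
  shows "x \<in> dsum I B"
proof -
  have "{i. x i \<noteq> 0} \<subseteq> J" using assms(3) by (auto simp: fun_eq_iff)
  then show ?thesis using assms finite_subset by (auto simp: dsum_def dprod_def)
qed

lemma dsum_dprod: "x \<in> dsum I B \<Longrightarrow> x \<in> dprod I B"
  by (simp add: dsum_def)

lemma dsum_nz: "x \<in> dsum I B \<Longrightarrow> x i p q \<noteq> 0 \<Longrightarrow> i \<in> I \<and> p \<in> B i \<and> q \<in> B i"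
  by (simp add: dsum_def dprod_def)

lemma dsum_finite: "x \<in> dsum I B \<Longrightarrow> finite {i. x i \<noteq> 0}"
  by (simp add: dsum_def)

lemma dsum_add: "x \<in> dsum I B \<Longrightarrow> y \<in> dsum I B \<Longrightarrow> x + y \<in> dsum I B"
  by (rule dsumI[where J = "{i. x i \<noteq> 0} \<union> {i. y i \<noteq> 0}"])
    (auto dest: dsum_nz dsum_finite simp: fun_eq_iff, (metis add.right_neutral dsum_nz)+)

lemma dsum_scale: "x \<in> dsum I B \<Longrightarrow> fscale c x \<in> dsum I B"
  by (rule dsumI[where J = "{i. x i \<noteq> 0}"]) (auto dest: dsum_nz dsum_finite simp: fscale_def fun_eq_iff)

lemma fmult_nz:
  assumes "fmult B x y i p q \<noteq> 0"
  obtains k where "x i p k \<noteq> 0" "y i k q \<noteq> 0"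
proof -
  have "\<exists>k. x i p k * y i k q \<noteq> 0"
    using assms unfolding fmult_def mat_mult_def by (metis (mono_tags, lifting) sum.neutral)
  then show ?thesis using that by auto
qed

lemma dsum_fmult: "x \<in> dsum I B \<Longrightarrow> y \<in> dsum I B \<Longrightarrow> fmult B x y \<in> dsum I B"
  by (rule dsumI[where J = "{i. x i \<noteq> 0}"])
    (auto elim!: fmult_nz dest: dsum_nz dsum_finite simp: fun_eq_iff)

lemma dsum_fstar: "x \<in> dsum I B \<Longrightarrow> fstar x \<in> dsum I B"
  by (rule dsumI[where J = "{i. x i \<noteq> 0}"]) (auto dest: dsum_nz dsum_finite simp: fstar_def fun_eq_iff)

lemma star_algebra_dsum: "star_algebra fscale (dsum I B) (fmult B) fstar"
  unfolding star_algebra_def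
proof (intro conjI ballI)
  show "Modules.module (fscale :: complex \<Rightarrow> ('a, 'b) fam \<Rightarrow> ('a, 'b) fam)" by (rule module_fscale)
  show "Modules.module.subspace fscale (dsum I B)"
    unfolding module.subspace_def[OF module_fscale]
    by (auto simp: dsum_add dsum_scale intro!: dsumI[where J = "{}"])
  show "fmult B x y \<in> dsum I B" "fstar x \<in> dsum I B" if "x \<in> dsum I B" "y \<in> dsum I B" for x y
    using that by (simp_all add: dsum_fmult dsum_fstar)
  show "fmult B (fmult B x y) z = fmult B x (fmult B y z)" for x y z
    by (simp add: fmult_def mat_mult_assoc)
  show "linear_map_on fscale fscale (dsum I B) (fmult B x)"
    "linear_map_on fscale fscale (dsum I B) (\<lambda>y. fmult B y x)" for x
    by (auto simp: linear_map_on_def fmult_def mat_mult_def fscale_def fun_eq_iff algebra_simps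
      sum.distrib sum_distrib_left)
  show "linear_map_on fscale (\<lambda>c. fscale (cnj c)) (dsum I B) fstar"
    by (auto simp: linear_map_on_def fstar_def fscale_def fun_eq_iff)
  show "fstar (fmult B x y) = fmult B (fstar y) (fstar x)" for x y
    by (simp add: fstar_def fmult_def mat_mult_def fun_eq_iff mult.commute)
  show "fstar (fstar x) = x" for x :: "('a, 'b) fam"
    by (simp add: fstar_def)
qed

text \<open>A family with finitely many nonzero entries is a finite combination of tensors of matrix
  units; T collects the positions of these entries.\<close>

lemma tensor_squareI:
  assumes nz: "\<And>i j p r q s. Y (i, j) (p, r) (q, s) \<noteq> 0 \<Longrightarrow>
      i \<in> I \<and> j \<in> I \<and> p \<in> B i \<and> q \<in> B i \<and> r \<in> B j \<and> s \<in> B j"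
    and fin: "finite J" "\<And>ij. Y ij \<noteq> 0 \<Longrightarrow> ij \<in> J" and B: "\<And>i. i \<in> I \<Longrightarrow> finite (B i)"
  shows "Y \<in> tensor_square I B"
proof -
  define unit :: "'a \<Rightarrow> 'b \<Rightarrow> 'b \<Rightarrow> ('a, 'b) fam"
    where "unit i p q = (\<lambda>i' p' q'. if i' = i \<and> p' = p \<and> q' = q then 1 else 0)" for i p q
  define T where "T = {(ij, pr, qs). Y ij pr qs \<noteq> 0}"
  have "T \<subseteq> (SIGMA ij:J \<inter> I \<times> I. (B (fst ij) \<times> B (snd ij)) \<times> (B (fst ij) \<times> B (snd ij)))"
    using nz fin(2) by (auto simp: T_def fun_eq_iff) blast+
  then have finT: "finite T"
    by (rule finite_subset) (use fin(1) B in auto)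
  have "Y = (\<Sum>(ij, pr, qs)\<in>T. fscale (Y ij pr qs)
      (ftensor (unit (fst ij) (fst pr) (fst qs)) (unit (snd ij) (snd pr) (snd qs))))" (is "_ = ?S")
  proof (intro ext)
    fix ij pr qs
    have "?S ij pr qs = (\<Sum>\<tau>\<in>T. if (ij, pr, qs) = \<tau> then Y ij pr qs else 0)"
      unfolding fam_sum_apply
      by (rule sum.cong)
        (auto simp: fscale_def ftensor_def mat_tensor_def unit_def split: prod.splits)
    also have "\<dots> = Y ij pr qs" using finT by (simp add: T_def)
    finally show "Y ij pr qs = ?S ij pr qs" by simp
  qed
  also have "\<dots> \<in> tensor_square I B"
    unfolding tensor_square_def
  proof (rule module.span_sum[OF module_fscale])
    fix \<tau> assume \<tau>: "\<tau> \<in> T"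
    obtain i j p r q s where eq: "\<tau> = ((i, j), (p, r), (q, s))" by (metis prod.exhaust)
    have "i \<in> I \<and> j \<in> I \<and> p \<in> B i \<and> q \<in> B i \<and> r \<in> B j \<and> s \<in> B j"
      using nz \<tau> by (simp add: T_def eq)
    moreover have "unit i p q \<in> dsum I B" if "i \<in> I" "p \<in> B i" "q \<in> B i" for i p q
      by (rule dsumI[where J = "{i}"]) (use that in \<open>auto simp: unit_def split: if_splits\<close>)
    ultimately have "unit i p q \<in> dsum I B" "unit j r s \<in> dsum I B" by blast+
    then show "(case \<tau> of (ij, pr, qs) \<Rightarrow> fscale (Y ij pr qs)
        (ftensor (unit (fst ij) (fst pr) (fst qs)) (unit (snd ij) (snd pr) (snd qs))))
      \<in> module.span fscale {ftensor a b |a b. a \<in> dsum I B \<and> b \<in> dsum I B}"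
      unfolding eq prod.case fst_conv snd_conv
      by (intro module.span_scale[OF module_fscale] module.span_base[OF module_fscale]) auto
  qed
  finally show ?thesis .
qed

section \<open>Entries of products with identity legs\<close>

lemma fone_eq: "fone I B i p q = (if i \<in> I \<and> p \<in> B i \<and> p = q then 1 else 0)"
  by (auto simp: fone_def mat_one_def)

lemma cover_right_apply:
  assumes "\<And>i. finite (B i)"
  shows "cover_right I B \<Delta> a b (i, j) (p, r) (q, s) =
    (if i \<in> I \<and> q \<in> B i then \<Sum>k\<in>B j. \<Delta> a (i, j) (p, r) (q, k) * b j k s else 0)"
proof -
  have "cover_right I B \<Delta> a b (i, j) (p, r) (q, s) =
    (\<Sum>u\<in>B i. \<Sum>k\<in>B j. \<Delta> a (i, j) (p, r) (u, k) * (fone I B i u q * b j k s))"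
    by (simp add: cover_right_def fmult_def mat_mult_def pair_family_def ftensor_def mat_tensor_def sum.cartesian_product)
      (simp add: case_prod_unfold)
  also have "\<dots> = (\<Sum>u\<in>B i. if q = u then (if i \<in> I then \<Sum>k\<in>B j. \<Delta> a (i, j) (p, r) (q, k) * b j k s else 0) else 0)"
    by (rule sum.cong) (auto simp: fone_eq)
  also have "\<dots> = (if i \<in> I \<and> q \<in> B i then \<Sum>k\<in>B j. \<Delta> a (i, j) (p, r) (q, k) * b j k s else 0)"
    using assms by (simp add: sum.delta')
  finally show ?thesis .
qed

lemma cover_left_apply:
  assumes "\<And>i. finite (B i)"
  shows "cover_left I B \<Delta> c a (i, j) (p, r) (q, s) =
    (if j \<in> I \<and> r \<in> B j then \<Sum>u\<in>B i. c i p u * \<Delta> a (i, j) (u, r) (q, s) else 0)"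
proof -
  have "cover_left I B \<Delta> c a (i, j) (p, r) (q, s) =
    (\<Sum>u\<in>B i. \<Sum>k\<in>B j. c i p u * fone I B j r k * \<Delta> a (i, j) (u, k) (q, s))"
    by (simp add: cover_left_def fmult_def mat_mult_def pair_family_def ftensor_def mat_tensor_def sum.cartesian_product)
      (simp add: case_prod_unfold)
  also have "\<dots> = (\<Sum>u\<in>B i. \<Sum>k\<in>B j. if r = k then (if j \<in> I then c i p u * \<Delta> a (i, j) (u, r) (q, s) else 0) else 0)"
    by (intro sum.cong refl) (auto simp: fone_eq)
  also have "\<dots> = (if j \<in> I \<and> r \<in> B j then \<Sum>u\<in>B i. c i p u * \<Delta> a (i, j) (u, r) (q, s) else 0)"
    using assms by (cases "j \<in> I \<and> r \<in> B j") (auto intro!: sum.neutral)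
  finally show ?thesis .
qed

lemma triple_right_apply:
  assumes "\<And>i. finite (B i)"
  shows "fmult (pair_family B (pair_family B B)) Y (ftensor (fone I B) (ftensor (fone I B) b)) (i, j, l) (p, p', p'') (q, q', q'') =
    (if i \<in> I \<and> j \<in> I \<and> q \<in> B i \<and> q' \<in> B j then \<Sum>k\<in>B l. Y (i, j, l) (p, p', p'') (q, q', k) * b l k q'' else 0)"
proof -
  have "fmult (pair_family B (pair_family B B)) Y (ftensor (fone I B) (ftensor (fone I B) b)) (i, j, l) (p, p', p'') (q, q', q'') =
    (\<Sum>u\<in>B i. \<Sum>v\<in>B j. \<Sum>k\<in>B l. Y (i, j, l) (p, p', p'') (u, v, k) * (fone I B i u q * (fone I B j v q' * b l k q'')))"
    by (simp add: fmult_def mat_mult_def pair_family_def ftensor_def mat_tensor_def sum.cartesian_product)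
      (simp add: case_prod_unfold)
  also have "\<dots> = (\<Sum>u\<in>B i. if q = u then \<Sum>v\<in>B j. if q' = v then (if i \<in> I \<and> j \<in> I then \<Sum>k\<in>B l. Y (i, j, l) (p, p', p'') (q, q', k) * b l k q'' else 0) else 0 else 0)"
    by (auto simp: fone_eq intro!: sum.cong)
  also have "\<dots> = (if i \<in> I \<and> j \<in> I \<and> q \<in> B i \<and> q' \<in> B j then \<Sum>k\<in>B l. Y (i, j, l) (p, p', p'') (q, q', k) * b l k q'' else 0)"
    using assms by (simp add: sum.delta')
  finally show ?thesis .
qed

lemma triple_left_apply:
  assumes "\<And>i. finite (B i)"
  shows "fmult (pair_family B (pair_family B B)) (ftensor c (ftensor (fone I B) (fone I B))) Y (i, j, l) (p, p', p'') (q, q', q'') =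
    (if j \<in> I \<and> l \<in> I \<and> p' \<in> B j \<and> p'' \<in> B l then \<Sum>k\<in>B i. c i p k * Y (i, j, l) (k, p', p'') (q, q', q'') else 0)"
proof -
  have "fmult (pair_family B (pair_family B B)) (ftensor c (ftensor (fone I B) (fone I B))) Y (i, j, l) (p, p', p'') (q, q', q'') =
    (\<Sum>k\<in>B i. \<Sum>u\<in>B j. \<Sum>v\<in>B l. c i p k * (fone I B j p' u * fone I B l p'' v) * Y (i, j, l) (k, u, v) (q, q', q''))"
    by (simp add: fmult_def mat_mult_def pair_family_def ftensor_def mat_tensor_def sum.cartesian_product)
      (simp add: case_prod_unfold)
  also have "\<dots> = (\<Sum>k\<in>B i. \<Sum>u\<in>B j. if p' = u then \<Sum>v\<in>B l. if p'' = v then (if j \<in> I \<and> l \<in> I then c i p k * Y (i, j, l) (k, p', p'') (q, q', q'') else 0) else 0 else 0)"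
    by (auto simp: fone_eq intro!: sum.cong)
  also have "\<dots> = (if j \<in> I \<and> l \<in> I \<and> p' \<in> B j \<and> p'' \<in> B l then \<Sum>k\<in>B i. c i p k * Y (i, j, l) (k, p', p'') (q, q', q'') else 0)"
    using assms by (cases "j \<in> I \<and> l \<in> I \<and> p' \<in> B j \<and> p'' \<in> B l") (auto intro!: sum.neutral)
  finally show ?thesis .
qed

lemma finite_spins: "finite {n \<in> spins. n \<le> N}"
proof -
  have "{n \<in> spins. n \<le> N} \<subseteq> (\<lambda>i. real i / 2) ` {..nat \<lceil>2 * N\<rceil>}"
  proof
    fix n assume "n \<in> {n \<in> spins. n \<le> N}"
    then obtain i :: nat where i: "n = real i / 2" "n \<le> N" by (auto simp: spins_def)
    then have "real i \<le> 2 * N" by simp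
    then have "i \<le> nat \<lceil>2 * N\<rceil>" by linarith
    then show "n \<in> (\<lambda>i. real i / 2) ` {..nat \<lceil>2 * N\<rceil>}" using i by auto
  qed
  then show ?thesis by (rule finite_subset) simp
qed

section \<open>Evaluating \<open>Delta_A\<close> on representatives in the free algebra\<close>

context
  fixes t :: real
  assumes t: "t > 0"
begin

lemma rep_coset:
  assumes "n \<in> spins"
  shows "rep t n (rel_ideal t +>\<^bsub>ring_of_type_algebra\<^esub> x) = lin (rep_word t n) x"
  unfolding rep_def rep_free_eq
proof (rule on_coset_eq[OF two_sided_rel_ideal(1)])
  fix y z assume "y - z \<in> rel_ideal t"
  then have "lin (rep_word t n) (y - z) = 0"
    using At_rep.rel_ideal_0[OF At_rep_rep_word[OF t assms]] by blast
  then show "lin (rep_word t n) y = lin (rep_word t n) z" by (simp only: lin_diff right_minus_eq)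
qed

lemma comult_coset:
  "comult t (rel_ideal t +>\<^bsub>ring_of_type_algebra\<^esub> x) = rel_ideal2 t +>\<^bsub>ring_of_type_algebra\<^esub> comult_free x"
  unfolding comult_def
proof (rule on_coset_eq[OF two_sided_rel_ideal(1)])
  fix y z assume "y - z \<in> rel_ideal t"
  then have "comult_free y - comult_free z \<in> rel_ideal2 t"
    using comult_rel_ideal[of "y - z" t] by (simp add: comult_free_diff)
  then show "rel_ideal2 t +>\<^bsub>ring_of_type_algebra\<^esub> comult_free y = rel_ideal2 t +>\<^bsub>ring_of_type_algebra\<^esub> comult_free z"
    by (rule type_coset_eq[OF two_sided_rel_ideal(2)])
qed

lemma rep2_coset:
  assumes "n \<in> spins" "m \<in> spins"
  shows "rep2 t n m (rel_ideal2 t +>\<^bsub>ring_of_type_algebra\<^esub> y) = lin (pair_rep (rep_word t n) (rep_word t m)) y"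
  unfolding rep2_def rep2_free_eq
proof (rule on_coset_eq[OF two_sided_rel_ideal(2)])
  fix y z assume "y - z \<in> rel_ideal2 t"
  then have "lin (pair_rep (rep_word t n) (rep_word t m)) (y - z) = 0"
    by (rule rep2_rel_ideal2[OF t assms])
  then show "lin (pair_rep (rep_word t n) (rep_word t m)) y = lin (pair_rep (rep_word t n) (rep_word t m)) z"
    by (simp only: lin_diff right_minus_eq)
qed

text \<open>Existence of the described matrix is witnessed by x; two witnesses differ by an element
  killed by all the relevant \<pi>_k, so \<open>tensor_kernel\<close> gives uniqueness.\<close>

lemma phi_eq:
  assumes n: "n \<in> spins" and m: "m \<in> spins" and x: "\<And>k. k \<in> cg_spins n m \<Longrightarrow> lin (rep_word t k) x = b k"
  shows "phi t n m b = lin (rep2_word t n m) x"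
proof -
  have carrier: "carrier (At t) = range (\<lambda>x. rel_ideal t +>\<^bsub>ring_of_type_algebra\<^esub> x)"
    by (auto simp: At_def FactRing_def A_RCOSETS_def' ring_of_type_algebra_def)
  have "rep2 t n m (comult t (rel_ideal t +>\<^bsub>ring_of_type_algebra\<^esub> y)) = lin (rep2_word t n m) y" for y
    by (simp add: comult_coset rep2_coset[OF n m] lin_cprod)
  moreover have "rep t k (rel_ideal t +>\<^bsub>ring_of_type_algebra\<^esub> y) = lin (rep_word t k) y" if "k \<in> cg_spins n m" for k y
    by (rule rep_coset[OF cg_spins_spin[OF n m that]])
  ultimately have "(\<exists>x\<in>carrier (At t). (\<forall>k\<in>cg_spins n m. rep t k x = b k) \<and> y = rep2 t n m (comult t x)) \<longleftrightarrow>
      (\<exists>x. (\<forall>k\<in>cg_spins n m. lin (rep_word t k) x = b k) \<and> y = lin (rep2_word t n m) x)" for y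
    unfolding carrier by auto
  then have "phi t n m b = (THE y. \<exists>x. (\<forall>k\<in>cg_spins n m. lin (rep_word t k) x = b k) \<and> y = lin (rep2_word t n m) x)"
    by (simp only: phi_def)
  also have "\<dots> = lin (rep2_word t n m) x"
  proof (rule the_equality)
    fix y assume "\<exists>x. (\<forall>k\<in>cg_spins n m. lin (rep_word t k) x = b k) \<and> y = lin (rep2_word t n m) x"
    then obtain x' where x': "\<forall>k\<in>cg_spins n m. lin (rep_word t k) x' = b k" "y = lin (rep2_word t n m) x'" by blast
    interpret tensor_rep t n m by standard (fact t n m)+
    have "lin (rep2_word t n m) (x' - x) = 0"
      using x x' by (intro tensor_kernel) (simp add: lin_diff)
    then show "y = lin (rep2_word t n m) x" by (simp only: x' lin_diff right_minus_eq)
  qed (use x in auto)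
  finally show ?thesis .
qed

text \<open>The interface for everything that follows: a component may be computed from any x
  representing a on I_nm, chosen afresh for each (n, m).\<close>

lemma Delta_A_eq:
  assumes "n \<in> spins" "m \<in> spins" "\<And>k. k \<in> cg_spins n m \<Longrightarrow> lin (rep_word t k) x = a k"
  shows "Delta_A t a (n, m) = lin (rep2_word t n m) x"
  using phi_eq[OF assms(1,2), of x "\<lambda>k. if k \<in> cg_spins n m then a k else 0"] assms by (simp add: Delta_A_def)

lemma Delta_A_outside: "\<not> (n \<in> spins \<and> m \<in> spins) \<Longrightarrow> Delta_A t a (n, m) = 0"
  by (auto simp: Delta_A_def)

lemma realise:
  assumes "a \<in> dprod spins weights"
  obtains x where "\<And>k. k \<in> spins \<Longrightarrow> k \<le> N \<Longrightarrow> lin (rep_word t k) x = a k"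
proof -
  obtain x where x: "\<forall>k\<in>spins. 2 * k < real (nat \<lceil>2 * N\<rceil> + 1) \<longrightarrow> lin (rep_word t k) x = a k"
    using family_realised[OF t assms] by blast
  have "2 * k < real (nat \<lceil>2 * N\<rceil> + 1)" if "k \<le> N" for k
    using that by linarith
  then show thesis using x that by blast
qed

lemma Delta_A_realise:
  assumes "a \<in> dprod spins weights" "n \<in> spins" "m \<in> spins"
  obtains x where "\<And>k. k \<in> cg_spins n m \<Longrightarrow> lin (rep_word t k) x = a k"
    "Delta_A t a (n, m) = lin (rep2_word t n m) x"
proof -
  obtain x where x: "\<And>k. k \<in> spins \<Longrightarrow> k \<le> n + m \<Longrightarrow> lin (rep_word t k) x = a k"
    using realise[OF assms(1)] by blast
  then have "lin (rep_word t k) x = a k" if "k \<in> cg_spins n m" for k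
    using that cg_spins_spin[OF assms(2,3) that] by (simp add: cg_spins_iff)
  with Delta_A_eq[OF assms(2,3)] show thesis using that by blast
qed

lemma Delta_A_nz:
  assumes "a \<in> dprod spins weights" "Delta_A t a (n, m) (p, r) (q, s) \<noteq> 0"
  shows "n \<in> spins" "m \<in> spins" "p \<in> weights n" "q \<in> weights n" "r \<in> weights m" "s \<in> weights m"
    "\<exists>k\<in>cg_spins n m. a k \<noteq> 0"
proof -
  have "n \<in> spins \<and> m \<in> spins"
  proof (rule ccontr)
    assume "\<not> (n \<in> spins \<and> m \<in> spins)"
    then show False using assms(2) by (simp add: Delta_A_outside)
  qed
  then show n: "n \<in> spins" and m: "m \<in> spins" by auto
  obtain x where x: "Delta_A t a (n, m) = lin (rep2_word t n m) x"
    using Delta_A_realise[OF assms(1) n m] by blast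
  have "matrix_rep (weights n \<times> weights m) (rep2_word t n m)"
    by (intro matrix_rep_cprod matrix_rep_rep_word t n m)
  from matrix_rep.lin_supp[OF this, of x "(p, r)" "(q, s)"]
  show "p \<in> weights n" "q \<in> weights n" "r \<in> weights m" "s \<in> weights m"
    using assms(2) x by auto
  show "\<exists>k\<in>cg_spins n m. a k \<noteq> 0"
  proof (rule ccontr)
    assume "\<not> (\<exists>k\<in>cg_spins n m. a k \<noteq> 0)"
    \<comment> \<open>If a vanishes on I_nm, the element 0 represents it there.\<close>
    then have "Delta_A t a (n, m) = lin (rep2_word t n m) 0"
      by (intro Delta_A_eq[OF n m]) simp
    then show False using assms(2) by simp
  qed
qed

text \<open>In this and the next three lemmas the operation on families is mirrored by the one on
  representing elements: sum, scalar multiple, product and \<open>free_star\<close>.\<close>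

lemma Delta_A_add:
  assumes "a \<in> dprod spins weights" "b \<in> dprod spins weights"
  shows "Delta_A t (a + b) = Delta_A t a + Delta_A t b"
proof
  fix nm :: "real \<times> real"
  obtain n m where nm: "nm = (n, m)" by (cases nm)
  show "Delta_A t (a + b) nm = (Delta_A t a + Delta_A t b) nm"
  proof (cases "n \<in> spins \<and> m \<in> spins")
    case True
    then have n: "n \<in> spins" and m: "m \<in> spins" by auto
    obtain x where x: "\<And>k. k \<in> cg_spins n m \<Longrightarrow> lin (rep_word t k) x = a k"
      "Delta_A t a (n, m) = lin (rep2_word t n m) x" using Delta_A_realise[OF assms(1) n m] by blast
    obtain y where y: "\<And>k. k \<in> cg_spins n m \<Longrightarrow> lin (rep_word t k) y = b k"
      "Delta_A t b (n, m) = lin (rep2_word t n m) y" using Delta_A_realise[OF assms(2) n m] by blast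
    have "Delta_A t (a + b) (n, m) = lin (rep2_word t n m) (x + y)"
      by (rule Delta_A_eq[OF n m]) (simp add: lin_add x y)
    then show ?thesis by (simp add: nm lin_add x y)
  qed (simp add: nm Delta_A_outside)
qed

lemma Delta_A_scale:
  assumes "a \<in> dprod spins weights"
  shows "Delta_A t (fscale c a) = fscale c (Delta_A t a)"
proof
  fix nm :: "real \<times> real"
  obtain n m where nm: "nm = (n, m)" by (cases nm)
  show "Delta_A t (fscale c a) nm = fscale c (Delta_A t a) nm"
  proof (cases "n \<in> spins \<and> m \<in> spins")
    case True
    then have n: "n \<in> spins" and m: "m \<in> spins" by auto
    obtain x where x: "\<And>k. k \<in> cg_spins n m \<Longrightarrow> lin (rep_word t k) x = a k"
      "Delta_A t a (n, m) = lin (rep2_word t n m) x" using Delta_A_realise[OF assms(1) n m] by blast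
    have "Delta_A t (fscale c a) (n, m) = lin (rep2_word t n m) (scalar c * x)"
      by (rule Delta_A_eq[OF n m]) (simp add: lin_scalar x fscale_def)
    then show ?thesis by (simp add: nm lin_scalar x fscale_def)
  qed (simp add: nm Delta_A_outside fscale_def fun_eq_iff)
qed

lemma Delta_A_fmult:
  assumes "a \<in> dprod spins weights" "b \<in> dprod spins weights"
  shows "Delta_A t (fmult weights a b) = fmult (pair_family weights weights) (Delta_A t a) (Delta_A t b)"
proof
  fix nm :: "real \<times> real"
  obtain n m where nm: "nm = (n, m)" by (cases nm)
  show "Delta_A t (fmult weights a b) nm = fmult (pair_family weights weights) (Delta_A t a) (Delta_A t b) nm"
  proof (cases "n \<in> spins \<and> m \<in> spins")
    case True
    then have n: "n \<in> spins" and m: "m \<in> spins" by auto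
    have rep: "matrix_rep (weights n \<times> weights m) (rep2_word t n m)"
      by (intro matrix_rep_cprod matrix_rep_rep_word t n m)
    obtain x where x: "\<And>k. k \<in> cg_spins n m \<Longrightarrow> lin (rep_word t k) x = a k"
      "Delta_A t a (n, m) = lin (rep2_word t n m) x" using Delta_A_realise[OF assms(1) n m] by blast
    obtain y where y: "\<And>k. k \<in> cg_spins n m \<Longrightarrow> lin (rep_word t k) y = b k"
      "Delta_A t b (n, m) = lin (rep2_word t n m) y" using Delta_A_realise[OF assms(2) n m] by blast
    have "Delta_A t (fmult weights a b) (n, m) = lin (rep2_word t n m) (x * y)"
    proof (rule Delta_A_eq[OF n m])
      fix k assume k: "k \<in> cg_spins n m"
      show "lin (rep_word t k) (x * y) = fmult weights a b k"
        by (simp add: matrix_rep.lin_mult[OF matrix_rep_rep_word[OF t cg_spins_spin[OF n m k]]] x y k fmult_def)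
    qed
    then show ?thesis by (simp add: nm matrix_rep.lin_mult[OF rep] x y fmult_def pair_family_def)
  qed (simp add: nm Delta_A_outside fmult_def)
qed

lemma Delta_A_fstar:
  assumes "a \<in> dprod spins weights"
  shows "Delta_A t (fstar a) = fstar (Delta_A t a)"
proof
  fix nm :: "real \<times> real"
  obtain n m where nm: "nm = (n, m)" by (cases nm)
  show "Delta_A t (fstar a) nm = fstar (Delta_A t a) nm"
  proof (cases "n \<in> spins \<and> m \<in> spins")
    case True
    then have n: "n \<in> spins" and m: "m \<in> spins" by auto
    have star: "star_rep (rep2_word t n m)"
      by (rule star_rep_cprod[OF matrix_rep_rep_word[OF t n] matrix_rep_rep_word[OF t m]
        star_rep_rep_word[OF t n] star_rep_rep_word[OF t m]])
    obtain x where x: "\<And>k. k \<in> cg_spins n m \<Longrightarrow> lin (rep_word t k) x = a k"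
      "Delta_A t a (n, m) = lin (rep2_word t n m) x" using Delta_A_realise[OF assms(1) n m] by blast
    have "Delta_A t (fstar a) (n, m) = lin (rep2_word t n m) (free_star x)"
    proof (rule Delta_A_eq[OF n m])
      fix k assume k: "k \<in> cg_spins n m"
      show "lin (rep_word t k) (free_star x) = fstar a k"
        by (simp add: lin_free_star[OF star_rep_rep_word[OF t cg_spins_spin[OF n m k]]] x k fstar_def fun_eq_iff)
    qed
    then show ?thesis by (simp add: nm lin_free_star[OF star] x fstar_def fun_eq_iff)
  qed (simp add: nm Delta_A_outside fstar_def fun_eq_iff)
qed

lemma dsum_bound:
  assumes "a \<in> dsum spins weights"
  obtains N where "\<And>k. a k \<noteq> 0 \<Longrightarrow> k \<le> N"
  using dsum_finite[OF assms] by (metis (mono_tags, lifting) Max_ge mem_Collect_eq)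

text \<open>b bounds one index by M. A nonzero component of \<Delta>(a) at (i, j) needs a spin l
  \<le> N with |i - j| \<le> l, which bounds the other index by N + M.\<close>

lemma Delta_A_covers:
  assumes a: "a \<in> dsum spins weights" and b: "b \<in> dsum spins weights"
  shows "cover_right spins weights (Delta_A t) a b \<in> tensor_square spins weights"
    and "cover_left spins weights (Delta_A t) b a \<in> tensor_square spins weights"
proof -
  obtain N where N: "\<And>k. a k \<noteq> 0 \<Longrightarrow> k \<le> N" using dsum_bound[OF a] by blast
  obtain M where M: "\<And>k. b k \<noteq> 0 \<Longrightarrow> k \<le> M" using dsum_bound[OF b] by blast
  \<comment> \<open>N may be negative, for example when a = 0, so neither set need contain the
    other.\<close>
  let ?J = "{k \<in> spins. k \<le> N + M} \<union> {k \<in> spins. k \<le> M}"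
  have J: "finite (?J \<times> ?J)" using finite_spins by auto
  have r: "i \<in> spins \<and> j \<in> spins \<and> p \<in> weights i \<and> q \<in> weights i \<and> r \<in> weights j \<and> s \<in> weights j \<and> (i, j) \<in> ?J \<times> ?J"
    if nz: "cover_right spins weights (Delta_A t) a b (i, j) (p, r) (q, s) \<noteq> 0" for i j p r q s
  proof -
    have "(\<Sum>k\<in>weights j. Delta_A t a (i, j) (p, r) (q, k) * b j k s) \<noteq> 0"
      using nz by (simp add: cover_right_apply split: if_splits)
    then obtain k where "Delta_A t a (i, j) (p, r) (q, k) * b j k s \<noteq> 0"
      by (metis (mono_tags, lifting) sum.neutral)
    then have D: "Delta_A t a (i, j) (p, r) (q, k) \<noteq> 0" and bk: "b j k s \<noteq> 0" by auto
    obtain l where l: "l \<in> cg_spins i j" "a l \<noteq> 0" using Delta_A_nz(7)[OF dsum_dprod[OF a] D] by blast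
    have "b j \<noteq> 0" using bk by auto
    then have "j \<le> M" "i \<le> N + M" using M[of j] N[OF l(2)] l(1) by (auto simp: cg_spins_iff)
    then show ?thesis using Delta_A_nz[OF dsum_dprod[OF a] D] dsum_nz[OF b bk] by auto
  qed
  have l: "i \<in> spins \<and> j \<in> spins \<and> p \<in> weights i \<and> q \<in> weights i \<and> r \<in> weights j \<and> s \<in> weights j \<and> (i, j) \<in> ?J \<times> ?J"
    if nz: "cover_left spins weights (Delta_A t) b a (i, j) (p, r) (q, s) \<noteq> 0" for i j p r q s
  proof -
    have "(\<Sum>u\<in>weights i. b i p u * Delta_A t a (i, j) (u, r) (q, s)) \<noteq> 0"
      using nz by (simp add: cover_left_apply split: if_splits)
    then obtain u where "b i p u * Delta_A t a (i, j) (u, r) (q, s) \<noteq> 0"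
      by (metis (mono_tags, lifting) sum.neutral)
    then have D: "Delta_A t a (i, j) (u, r) (q, s) \<noteq> 0" and bk: "b i p u \<noteq> 0" by auto
    obtain l where l: "l \<in> cg_spins i j" "a l \<noteq> 0" using Delta_A_nz(7)[OF dsum_dprod[OF a] D] by blast
    have "b i \<noteq> 0" using bk by auto
    then have "i \<le> M" "j \<le> N + M" using M[of i] N[OF l(2)] l(1) by (auto simp: cg_spins_iff)
    then show ?thesis using Delta_A_nz[OF dsum_dprod[OF a] D] dsum_nz[OF b bk] by auto
  qed
  have nz: "\<exists>p r q s. Y ij (p, r) (q, s) \<noteq> 0" if "Y ij \<noteq> 0" for Y :: "(real \<times> real, real \<times> real) fam" and ij
    using that by (auto simp: fun_eq_iff)
  show "cover_right spins weights (Delta_A t) a b \<in> tensor_square spins weights"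
  proof (rule tensor_squareI[OF _ J])
    fix ij assume "cover_right spins weights (Delta_A t) a b ij \<noteq> 0"
    then show "ij \<in> ?J \<times> ?J" using nz[of _ ij] r by (cases ij) blast
  qed (use r in auto)
  show "cover_left spins weights (Delta_A t) b a \<in> tensor_square spins weights"
  proof (rule tensor_squareI[OF _ J])
    fix ij assume "cover_left spins weights (Delta_A t) b a ij \<noteq> 0"
    then show "ij \<in> ?J \<times> ?J" using nz[of _ ij] l by (cases ij) blast
  qed (use l in auto)
qed

text \<open>Both sides have the component (c \<otimes> 1 \<otimes> 1) T (1 \<otimes> 1 \<otimes> b),
  where T is the triple tensor representation of an x representing a; \<open>cprod_assoc\<close>
  identifies its two bracketings.\<close>

lemma Delta_A_coassoc:
  assumes a: "a \<in> dsum spins weights" and b: "b \<in> dsum spins weights" and c: "c \<in> dsum spins weights"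
  shows "fmult (pair_family weights (pair_family weights weights))
        (apply2 (Delta_A t) (cover_left spins weights (Delta_A t) c a))
        (ftensor (fone spins weights) (ftensor (fone spins weights) b)) =
      fmult (pair_family weights (pair_family weights weights))
        (ftensor c (ftensor (fone spins weights) (fone spins weights)))
        (reassoc (apply1 (Delta_A t) (cover_right spins weights (Delta_A t) a b)))"
    (is "?L = ?R")
proof -
  let ?cl = "cover_left spins weights (Delta_A t) c a" and ?cr = "cover_right spins weights (Delta_A t) a b"
  have "?L (n, m, l) (r, r', r'') (s, s', s'') = ?R (n, m, l) (r, r', r'') (s, s', s'')"
    for n m l r r' r'' s s' s''
  proof (cases "n \<in> spins \<and> m \<in> spins \<and> l \<in> spins")
    case True
    then have n: "n \<in> spins" and m: "m \<in> spins" and l: "l \<in> spins" by auto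
    note reps = matrix_rep_rep_word[OF t]
    \<comment> \<open>The bound n + m + l covers every I_nj with j in I_ml and every I_jl with j in
      I_nm, so the same x serves both sides.\<close>
    obtain x where x: "\<And>k. k \<in> spins \<Longrightarrow> k \<le> n + m + l \<Longrightarrow> lin (rep_word t k) x = a k"
      using realise[OF dsum_dprod[OF a]] by blast
    define T where "T = lin (cprod (rep_word t n) (rep2_word t m l)) x"
    have T_supp: "u \<in> weights n \<and> u' \<in> weights m \<and> u'' \<in> weights l \<and> v \<in> weights n \<and> v' \<in> weights m \<and> v'' \<in> weights l"
      if "T (u, u', u'') (v, v', v'') \<noteq> 0" for u u' u'' v v' v''
      using matrix_rep.lin_supp[OF matrix_rep_cprod[OF reps[OF n] matrix_rep_cprod[OF reps[OF m] reps[OF l]]], of x "(u, u', u'')" "(v, v', v'')"]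
        that by (auto simp: T_def)
    have T: "T (u, u', u'') (v, v', v'') = lin (cprod (rep2_word t n m) (rep_word t l)) x ((u, u'), u'') ((v, v'), v'')"
      for u u' u'' v v' v''
      unfolding T_def lin_def using cprod_assoc[OF reps[OF n] reps[OF m] reps[OF l]] by simp
    have D2: "Delta_A t (slice2 ?cl n r s) (m, l) (r', r'') (s', k) = (\<Sum>u\<in>weights n. c n r u * T (u, r', r'') (s, s', k))" for k
    proof -
      \<comment> \<open>A combination of slices of \<Delta>(x) that represents the slice of (c
        \<otimes> 1)\<Delta>(a) at every spin j in I_ml simultaneously.\<close>
      define y where "y = (\<Sum>u\<in>weights n. scalar (c n r u) * slice_left (\<lambda>w. rep_word t n w u s) (comult_free x))"
      \<comment> \<open>Generic in \<chi>, since it is used for \<pi>_j as well as for the tensor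
        product on H_m \<otimes> H_l, whose labels have a different type.\<close>
      have lin_y: "lin \<chi> y p q = (\<Sum>u\<in>weights n. c n r u * lin (cprod (rep_word t n) \<chi>) x (u, p) (s, q))"
        for \<chi> :: "word \<Rightarrow> 'z matr" and p q
        by (simp add: y_def lin_sum lin_scalar lin_cprod_slice_left)
      have "Delta_A t (slice2 ?cl n r s) (m, l) = lin (rep2_word t m l) y"
      proof (rule Delta_A_eq[OF m l], intro ext)
        fix j p q assume j: "j \<in> cg_spins m l"
        have js: "j \<in> spins" by (rule cg_spins_spin[OF m l j])
        have "Delta_A t a (n, j) = lin (rep2_word t n j) x"
        proof (rule Delta_A_eq[OF n js])
          fix k assume k: "k \<in> cg_spins n j"
          show "lin (rep_word t k) x = a k"
            using k j by (intro x cg_spins_spin[OF n js k]) (auto simp: cg_spins_iff)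
        qed
        moreover have "lin (rep2_word t n j) x (u, p) (s, q) = 0" if "p \<notin> weights j" for u
          using matrix_rep.lin_supp[OF matrix_rep_cprod[OF reps[OF n] reps[OF js]], of x "(u, p)" "(s, q)"] that by auto
        ultimately show "lin (rep_word t j) y p q = slice2 ?cl n r s j p q"
          using js by (simp add: lin_y slice2_def cover_left_apply)
      qed
      then show ?thesis by (simp add: lin_y T_def)
    qed
    have D1: "Delta_A t (slice1 ?cr l r'' s'') (n, m) (u, r') (s, s') = (\<Sum>k\<in>weights l. T (u, r', r'') (s, s', k) * b l k s'')" for u
    proof -
      define y where "y = (\<Sum>k\<in>weights l. scalar (b l k s'') * slice_right (\<lambda>w. rep_word t l w r'' k) (comult_free x))"
      have lin_y: "lin \<chi> y p q = (\<Sum>k\<in>weights l. lin (cprod \<chi> (rep_word t l)) x (p, r'') (q, k) * b l k s'')"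
        for \<chi> :: "word \<Rightarrow> 'z matr" and p q
        by (simp add: y_def lin_sum lin_scalar lin_cprod_slice_right mult.commute)
      have "Delta_A t (slice1 ?cr l r'' s'') (n, m) = lin (rep2_word t n m) y"
      proof (rule Delta_A_eq[OF n m], intro ext)
        fix j p q assume j: "j \<in> cg_spins n m"
        have js: "j \<in> spins" by (rule cg_spins_spin[OF n m j])
        have "Delta_A t a (j, l) = lin (rep2_word t j l) x"
        proof (rule Delta_A_eq[OF js l])
          fix k assume k: "k \<in> cg_spins j l"
          show "lin (rep_word t k) x = a k"
            using k j by (intro x cg_spins_spin[OF js l k]) (auto simp: cg_spins_iff)
        qed
        moreover have "lin (rep2_word t j l) x (p, r'') (q, k) = 0" if "q \<notin> weights j" for k
          using matrix_rep.lin_supp[OF matrix_rep_cprod[OF reps[OF js] reps[OF l]], of x "(p, r'')" "(q, k)"] that by auto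
        ultimately show "lin (rep_word t j) y p q = slice1 ?cr l r'' s'' j p q"
          using js by (simp add: lin_y slice1_def cover_right_apply)
      qed
      then show ?thesis by (simp add: lin_y T)
    qed
    \<comment> \<open>The restrictions that the identity legs put on the labels are already implied
      by the support of T.\<close>
    have zero: "T (u, r', r'') (s, s', k) = 0" if "\<not> (s \<in> weights n \<and> s' \<in> weights m) \<or> \<not> (r' \<in> weights m \<and> r'' \<in> weights l)" for u k
      using T_supp[of u r' r'' s s' k] that by blast
    have "?L (n, m, l) (r, r', r'') (s, s', s'') = (\<Sum>k\<in>weights l. (\<Sum>u\<in>weights n. c n r u * T (u, r', r'') (s, s', k)) * b l k s'')"
      using True zero by (simp add: triple_right_apply apply2_def D2)
    also have "\<dots> = (\<Sum>k\<in>weights l. \<Sum>u\<in>weights n. c n r u * (T (u, r', r'') (s, s', k) * b l k s''))"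
      by (simp add: sum_distrib_right mult.assoc)
    also have "\<dots> = (\<Sum>u\<in>weights n. c n r u * (\<Sum>k\<in>weights l. T (u, r', r'') (s, s', k) * b l k s''))"
      by (subst sum.swap) (simp add: sum_distrib_left)
    also have "\<dots> = ?R (n, m, l) (r, r', r'') (s, s', s'')"
      using True zero by (simp add: triple_left_apply reassoc_def apply1_def D1)
    finally show ?thesis .
  next
    case False
    \<comment> \<open>A label that is not a spin makes some factor on each side vanish: an identity
      component, b or c.\<close>
    have "b l k q = 0" if "l \<notin> spins" for k q using dsum_nz[OF b] that by blast
    moreover have "c n p k = 0" if "n \<notin> spins" for p k using dsum_nz[OF c] that by blast
    ultimately show ?thesis using False by (auto simp: triple_left_apply triple_right_apply)
  qed
  then show ?thesis by (intro ext) (metis prod.exhaust)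
qed

lemma is_coproduct_Delta_A: "is_coproduct spins weights (Delta_A t)"
  unfolding is_coproduct_def linear_map_on_def
proof (intro conjI ballI allI)
  fix a assume "a \<in> dsum spins weights"
  then have a: "a \<in> dprod spins weights" by (rule dsum_dprod)
  show "Delta_A t a \<in> dprod (spins \<times> spins) (pair_family weights weights)"
    using Delta_A_nz[OF a] by (auto simp: dprod_def[of "spins \<times> spins"] pair_family_def)
qed (simp_all add: dsum_dprod Delta_A_add Delta_A_scale Delta_A_fmult Delta_A_fstar Delta_A_covers Delta_A_coassoc)

end

section \<open>Counit and antipode\<close>

context
  fixes t :: real
  assumes t: "t > 0"
begin

text \<open>On the one-dimensional space H_0 the representation is the counit of the Hopf
  algebra.\<close>

lemma rep_word_0_letter: "rep_word t 0 (Word [g]) 0 0 = (if g = Let_q \<or> g = Let_qinv then 1 else 0)"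
proof -
  have "(0::real) \<in> spins" by (simp add: spins_iff)
  from rep_word_letter[OF t this] rep_letter_eq[OF t this] show ?thesis
    by (cases g) (auto simp: weights_0)
qed

text \<open>The counit law on generators: with q and q' acting as 1 and e, f as 0 in one leg, a
  single term of each coproduct survives.\<close>

lemma lin_cprod_trivial:
  assumes n: "n \<in> spins"
  shows "lin (rep2_word t 0 n) x (0, p) (0, q) = lin (rep_word t n) x p q"
    and "lin (rep2_word t n 0) x (p, 0) (q, 0) = lin (rep_word t n) x p q"
proof -
  have 0: "(0::real) \<in> spins" by (simp add: spins_iff)
  have r0: "matrix_rep {0} (rep_word t 0)" using matrix_rep_rep_word[OF t 0] by (simp add: weights_0)
  note rn = matrix_rep_rep_word[OF t n]
  have "rep2_word t 0 n w P Q = rep_word t n w (snd P) (snd Q)"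
    if "P \<in> {0} \<times> weights n" "Q \<in> {0} \<times> weights n" for w P Q
  proof (rule matrix_rep_relabel[OF matrix_rep_cprod[OF r0 rn] rn _ _ that])
    show "bij_betw snd ({0::real} \<times> weights n) (weights n)"
      by (rule bij_betw_byWitness[where f' = "Pair 0"]) auto
    show "rep2_word t 0 n (Word [g]) P Q = rep_word t n (Word [g]) (snd P) (snd Q)"
      if "P \<in> {0} \<times> weights n" "Q \<in> {0} \<times> weights n" for g P Q
      using that by (cases g) (auto simp: cprod_letter mat_tensor_def rep_word_0_letter)
  qed
  from this[of "(0, p)" "(0, q)"] have "rep2_word t 0 n w (0, p) (0, q) = rep_word t n w p q" for w
    using matrix_rep.supp[OF matrix_rep_cprod[OF r0 rn], of w "(0, p)" "(0, q)"]
      matrix_rep.supp[OF rn, of w p q] by fastforce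
  then show "lin (rep2_word t 0 n) x (0, p) (0, q) = lin (rep_word t n) x p q"
    by (simp add: lin_def)
  have "rep2_word t n 0 w P Q = rep_word t n w (fst P) (fst Q)"
    if "P \<in> weights n \<times> {0}" "Q \<in> weights n \<times> {0}" for w P Q
  proof (rule matrix_rep_relabel[OF matrix_rep_cprod[OF rn r0] rn _ _ that])
    show "bij_betw fst (weights n \<times> {0::real}) (weights n)"
      by (rule bij_betw_byWitness[where f' = "\<lambda>p. (p, 0)"]) auto
    show "rep2_word t n 0 (Word [g]) P Q = rep_word t n (Word [g]) (fst P) (fst Q)"
      if "P \<in> weights n \<times> {0}" "Q \<in> weights n \<times> {0}" for g P Q
      using that by (cases g) (auto simp: cprod_letter mat_tensor_def rep_word_0_letter)
  qed
  from this[of "(p, 0)" "(q, 0)"] have "rep2_word t n 0 w (p, 0) (q, 0) = rep_word t n w p q" for w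
    using matrix_rep.supp[OF matrix_rep_cprod[OF rn r0], of w "(p, 0)" "(q, 0)"]
      matrix_rep.supp[OF rn, of w p q] by fastforce
  then show "lin (rep2_word t n 0) x (p, 0) (q, 0) = lin (rep_word t n) x p q"
    by (simp add: lin_def)
qed

lemma Delta_A_trivial:
  assumes a: "a \<in> dprod spins weights" and n: "n \<in> spins"
  shows "Delta_A t a (0, n) (0, p) (0, q) = a n p q"
    and "Delta_A t a (n, 0) (p, 0) (q, 0) = a n p q"
proof -
  have 0: "(0::real) \<in> spins" by (simp add: spins_iff)
  obtain x where "lin (rep_word t n) x = a n" "Delta_A t a (0, n) = lin (rep2_word t 0 n) x"
    using Delta_A_realise[OF t a 0 n] cg_spins_0(1)[OF n] by auto
  then show "Delta_A t a (0, n) (0, p) (0, q) = a n p q"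
    by (simp add: lin_cprod_trivial[OF n])
  obtain y where "lin (rep_word t n) y = a n" "Delta_A t a (n, 0) = lin (rep2_word t n 0) y"
    using Delta_A_realise[OF t a n 0] cg_spins_0(2)[OF n] by auto
  then show "Delta_A t a (n, 0) (p, 0) (q, 0) = a n p q"
    by (simp add: lin_cprod_trivial[OF n])
qed

definition counit :: "(real, real) fam \<Rightarrow> complex"
  where "counit a = a 0 0 0"

lemma is_counit_counit: "is_counit spins weights (Delta_A t) counit"
  unfolding is_counit_def
proof (intro conjI ballI)
  show "linear_map_on fscale (*) (dsum spins weights) counit"
    by (simp add: linear_map_on_def counit_def fscale_def)
next
  fix a b :: "(real, real) fam" assume a: "a \<in> dsum spins weights" and b: "b \<in> dsum spins weights"
  show "functional1 counit (cover_right spins weights (Delta_A t) a b) = fmult weights a b"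
  proof (intro ext)
    fix k r s
    have "functional1 counit (cover_right spins weights (Delta_A t) a b) k r s
        = (\<Sum>j\<in>weights k. Delta_A t a (0, k) (0, r) (0, j) * b k j s)"
      by (simp add: functional1_def counit_def slice1_def cover_right_apply spins_iff weights_0)
    also have "\<dots> = fmult weights a b k r s"
    proof (cases "k \<in> spins")
      case True
      then show ?thesis by (simp add: Delta_A_trivial[OF dsum_dprod[OF a]] fmult_def mat_mult_def)
    next
      case False
      then have "b k j s = 0" for j using dsum_nz[OF b] by blast
      then show ?thesis by (simp add: fmult_def mat_mult_def)
    qed
    finally show "functional1 counit (cover_right spins weights (Delta_A t) a b) k r s = fmult weights a b k r s" .
  qed
next
  fix a c :: "(real, real) fam" assume a: "a \<in> dsum spins weights" and c: "c \<in> dsum spins weights"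
  show "functional2 counit (cover_left spins weights (Delta_A t) c a) = fmult weights c a"
  proof (intro ext)
    fix k r s
    have "functional2 counit (cover_left spins weights (Delta_A t) c a) k r s
        = (\<Sum>j\<in>weights k. c k r j * Delta_A t a (k, 0) (j, 0) (s, 0))"
      by (simp add: functional2_def counit_def slice2_def cover_left_apply spins_iff weights_0)
    also have "\<dots> = fmult weights c a k r s"
    proof (cases "k \<in> spins")
      case True
      then show ?thesis by (simp add: Delta_A_trivial[OF dsum_dprod[OF a]] fmult_def mat_mult_def)
    next
      case False
      then have "c k r j = 0" for j using dsum_nz[OF c] by blast
      then show ?thesis by (simp add: fmult_def mat_mult_def)
    qed
    finally show "functional2 counit (cover_left spins weights (Delta_A t) c a) k r s = fmult weights c a k r s" .
  qed
qed

text \<open>On \<open>A\<^sub>n\<close> the antipode of \<open>\<AA>\<^sub>t\<close>, given by \<open>q \<mapsto> q\<^sup>-\<^sup>1\<close>, \<open>e \<mapsto> - \<lambda>\<^sup>-\<^sup>1 e\<close>, \<open>f \<mapsto> - \<lambda> f\<close>, is the transposition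
  followed by conjugation with \<open>\<xi>(n, j) \<mapsto> antipode_coeff n (- j) \<xi>(n, - j)\<close>.\<close>

definition antipode_coeff :: "real \<Rightarrow> real \<Rightarrow> real"
  where "antipode_coeff n j = (- exp (- t)) powi \<lfloor>n + j\<rfloor>"

definition antipode :: "(real, real) fam \<Rightarrow> (real, real) fam"
  where "antipode a = (\<lambda>n p q. complex_of_real (antipode_coeff n p / antipode_coeff n q) * a n (- q) (- p))"

lemma antipode_coeff_nonzero [simp]: "antipode_coeff n j \<noteq> 0"
  by (simp add: antipode_coeff_def)

lemma antipode_coeff_step: "antipode_coeff n (j + 1) = - exp (- t) * antipode_coeff n j"
proof -
  have "\<lfloor>n + (j + 1)\<rfloor> = \<lfloor>n + j\<rfloor> + 1" by linarith
  then show ?thesis by (simp add: antipode_coeff_def power_int_add)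
qed

text \<open>The exponents n + j and n - j add up to 2n. This turns division by a coefficient into
  multiplication by the reflected one.\<close>

lemma antipode_coeff_reflect:
  assumes "n \<in> spins" "j \<in> weights n"
  shows "antipode_coeff n j * antipode_coeff n (- j) = antipode_coeff n n"
proof -
  obtain k l where kl: "n + j = of_int k" "n + - j = of_int l"
    using assms(2) weights_uminus[OF assms] by (metis Ints_cases weights_iff)
  then have "n + n = of_int (k + l)" by simp
  then have "\<lfloor>n + n\<rfloor> = k + l" by (simp only: floor_of_int)
  then show ?thesis unfolding antipode_coeff_def kl by (simp add: power_int_add)
qed

text \<open>The antipode equations amount to the fact that \<open>invariant_vector\<close> spans a trivial subrepresentation of
  \<open>\<pi>\<^sub>n \<otimes> \<pi>\<^sub>n\<close>.\<close>

definition invariant_vector :: "real \<Rightarrow> real \<times> real \<Rightarrow> complex"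
  where "invariant_vector n = (\<lambda>(a, b). if a \<in> weights n \<and> b = - a then complex_of_real (antipode_coeff n a) else 0)"

text \<open>The vector has weight 0 and is killed by e, so it is a highest weight vector for k = 0,
  and the one-dimensional intertwiner states the invariance.\<close>

lemma invariant_vector_invariant:
  assumes n: "n \<in> spins"
  shows "act (weights n \<times> weights n) (lin (rep2_word t n n) x) (invariant_vector n)
    = (\<lambda>a. lin (rep_word t 0) x 0 0 * invariant_vector n a)"
proof -
  interpret tensor_rep t n n by standard (fact t n)+
  let ?w = "invariant_vector n"
  have 0: "(0::real) \<in> spins" by (simp add: spins_iff)
  have w: "supported K ?w"
    by (auto simp: supported_def invariant_vector_def weights_uminus[OF n] split: if_splits)
  have Q: "Q ?w = (\<lambda>a. complex_of_real (exp (t * 0)) * ?w a)"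
  proof (rule ext, clarify)
    fix a b
    show "Q ?w (a, b) = complex_of_real (exp (t * 0)) * ?w (a, b)"
    proof (cases "(a, b) \<in> K")
      case True
      then show ?thesis by (simp add: Q_apply) (simp add: invariant_vector_def)
    next
      case False
      then have "Q ?w (a, b) = 0" "?w (a, b) = 0"
        using w act_supported[of "Word [Let_q]" ?w] unfolding supported_def by blast+
      then show ?thesis by simp
    qed
  qed
  have E: "E ?w = (\<lambda>a. 0)"
  proof (rule ext, clarify)
    fix a b
    show "E ?w (a, b) = 0"
    proof (cases "(a, b) \<in> K")
      case True
      show ?thesis
      proof (cases "b = 1 - a")
        case False
        then show ?thesis using E_apply[OF True, of ?w] by (simp add: invariant_vector_def)
      next
        case b: True
        \<comment> \<open>Here b - 1 = -a, and the ladder is symmetric. The two terms of e w thus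
          share a factor, and since exp(t a) exp(-t) = exp(-t b) they cancel precisely for the ratio
          -exp(-t) of consecutive coefficients.\<close>
        have r: "rung t n (b - 1) = rung t n (a - 1)"
          using rung_reflect[of t n "a - 1"] by (simp add: b)
        have "rung t n (a - 1) = 0 \<or> a - 1 \<in> weights n"
          using weights_pred[OF n, of a] True by (cases "a = - n") auto
        then have "E ?w (a, b) = complex_of_real (rung t n (a - 1) *
            (exp (t * a) * antipode_coeff n a + exp (- t * b) * antipode_coeff n (a - 1)))"
          using E_apply[OF True, of ?w] True unfolding r
          by (auto simp: invariant_vector_def b algebra_simps)
        also have "antipode_coeff n a = - exp (- t) * antipode_coeff n (a - 1)"
          using antipode_coeff_step[of n "a - 1"] by simp
        also have "exp (t * a) * (- exp (- t) * antipode_coeff n (a - 1)) = - exp (- t * b) * antipode_coeff n (a - 1)"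
          by (simp add: b algebra_simps flip: exp_add)
        finally show ?thesis by simp
      qed
    next
      case False
      then show ?thesis using act_supported[of "Word [Let_e]" ?w] unfolding supported_def by blast
    qed
  qed
  have "intertwiner K (rep2_word t n n) (weights 0) (rep_word t 0) (\<lambda>j. descend 0 ?w (nat \<lfloor>0 - j\<rfloor>))"
    by (rule highest_weight_intertwiner[OF 0 w Q E])
  then show ?thesis by (simp add: intertwiner_def weights_0)
qed

text \<open>The adjoint form of the invariance: apply the previous lemma to the adjoint of x and
  conjugate, the coefficients of the vector being real.\<close>

lemma invariant_covector:
  assumes n: "n \<in> spins"
  shows "(\<Sum>c\<in>weights n \<times> weights n. invariant_vector n c * lin (rep2_word t n n) x c a)
    = lin (rep_word t 0) x 0 0 * invariant_vector n a"
proof -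
  have 0: "(0::real) \<in> spins" by (simp add: spins_iff)
  note star = lin_free_star[OF star_rep_cprod[OF matrix_rep_rep_word[OF t n] matrix_rep_rep_word[OF t n]
    star_rep_rep_word[OF t n] star_rep_rep_word[OF t n]]]
  have real: "cnj (invariant_vector n c) = invariant_vector n c" for c
    by (cases c) (simp add: invariant_vector_def)
  have "(\<Sum>c\<in>weights n \<times> weights n. lin (rep2_word t n n) (free_star x) a c * invariant_vector n c)
      = lin (rep_word t 0) (free_star x) 0 0 * invariant_vector n a"
    using fun_cong[OF invariant_vector_invariant[OF n, of "free_star x"], of a] by (simp add: act_def)
  then have "cnj (\<Sum>c\<in>weights n \<times> weights n. cnj (lin (rep2_word t n n) x c a) * invariant_vector n c)
      = cnj (cnj (lin (rep_word t 0) x 0 0) * invariant_vector n a)"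
    by (simp only: star lin_free_star[OF star_rep_rep_word[OF t 0]])
  then show ?thesis by (simp add: real mult.commute)
qed

lemma sum_antidiagonal:
  assumes "n \<in> spins"
  shows "(\<Sum>c\<in>weights n \<times> weights n. invariant_vector n c * g c)
    = (\<Sum>k\<in>weights n. complex_of_real (antipode_coeff n k) * g (k, - k))"
proof -
  have "(\<Sum>c\<in>weights n \<times> weights n. invariant_vector n c * g c)
      = (\<Sum>k\<in>weights n. \<Sum>l\<in>weights n. invariant_vector n (k, l) * g (k, l))"
    by (simp add: sum.cartesian_product)
  also have "\<dots> = (\<Sum>k\<in>weights n. \<Sum>l\<in>weights n. if l = - k then complex_of_real (antipode_coeff n k) * g (k, - k) else 0)"
    by (intro sum.cong) (auto simp: invariant_vector_def)
  also have "\<dots> = (\<Sum>k\<in>weights n. complex_of_real (antipode_coeff n k) * g (k, - k))"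
    using weights_uminus[OF assms] by (intro sum.cong) auto
  finally show ?thesis .
qed

lemma sum_weights_uminus:
  assumes "n \<in> spins"
  shows "(\<Sum>k\<in>weights n. g (- k)) = (\<Sum>k\<in>weights n. g k)"
  by (rule sum.reindex_bij_witness[where i = uminus and j = uminus]) (auto simp: weights_uminus[OF assms])

lemma is_antipode_antipode: "is_antipode spins weights (Delta_A t) counit antipode"
  unfolding is_antipode_def
proof (intro conjI ballI)
  fix a assume a: "a \<in> dsum spins weights"
  show "antipode a \<in> dsum spins weights"
  proof (rule dsumI)
    show "finite {i. a i \<noteq> 0}" by (rule dsum_finite[OF a])
    fix n p q assume "antipode a n p q \<noteq> 0"
    then have nz: "a n (- q) (- p) \<noteq> 0" by (simp add: antipode_def)
    then show "n \<in> {i. a i \<noteq> 0}" by auto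
    show "n \<in> spins \<and> p \<in> weights n \<and> q \<in> weights n"
      using dsum_nz[OF a nz] by (auto simp: weights_uminus_iff)
  qed
next
  show "linear_map_on fscale fscale (dsum spins weights) antipode"
    by (simp add: linear_map_on_def antipode_def fscale_def fun_eq_iff algebra_simps)
next
  fix a b :: "(real, real) fam" assume a: "a \<in> dsum spins weights" and b: "b \<in> dsum spins weights"
  show "mult_map weights (apply1 antipode (cover_right spins weights (Delta_A t) a b)) = fscale (counit a) b"
  proof (intro ext)
    fix n p s
    show "mult_map weights (apply1 antipode (cover_right spins weights (Delta_A t) a b)) n p s = fscale (counit a) b n p s"
    proof (cases "n \<in> spins \<and> p \<in> weights n")
      case True
      then have n: "n \<in> spins" and p: "p \<in> weights n" by auto
      obtain x where x: "\<And>k. k \<in> cg_spins n n \<Longrightarrow> lin (rep_word t k) x = a k"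
        "Delta_A t a (n, n) = lin (rep2_word t n n) x" using Delta_A_realise[OF t dsum_dprod[OF a] n n] by blast
      \<comment> \<open>Spin 0 occurs in I_nn, so the trivial representation of x returns the counit
        of a.\<close>
      have "0 \<in> cg_spins n n" using n by (simp add: cg_spins_iff spins_iff)
      then have eps: "lin (rep_word t 0) x 0 0 = counit a" by (simp add: x counit_def)
      \<comment> \<open>The antipode transposes and reflects the first leg, so multiplying the legs
        contracts the row index along the antidiagonal. After reflecting the coefficients this is
        the invariant covector applied to the column (-p, v).\<close>
      have inner: "(\<Sum>k\<in>weights n. complex_of_real (antipode_coeff n p / antipode_coeff n k) * lin (rep2_word t n n) x (- k, k) (- p, v))
        = (if v = p then counit a else 0)" for v
      proof -
        have "(\<Sum>k\<in>weights n. complex_of_real (antipode_coeff n p / antipode_coeff n k) * lin (rep2_word t n n) x (- k, k) (- p, v))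
          = (\<Sum>k\<in>weights n. complex_of_real (antipode_coeff n p / antipode_coeff n n) *
              (complex_of_real (antipode_coeff n (- k)) * lin (rep2_word t n n) x (- k, - (- k)) (- p, v)))"
        proof (rule sum.cong)
          fix k assume "k \<in> weights n"
          then have "antipode_coeff n p / antipode_coeff n k = antipode_coeff n p / antipode_coeff n n * antipode_coeff n (- k)"
            using antipode_coeff_reflect[OF n, of k, symmetric] by simp
          then show "complex_of_real (antipode_coeff n p / antipode_coeff n k) * lin (rep2_word t n n) x (- k, k) (- p, v)
            = complex_of_real (antipode_coeff n p / antipode_coeff n n) *
              (complex_of_real (antipode_coeff n (- k)) * lin (rep2_word t n n) x (- k, - (- k)) (- p, v))"
            by simp
        qed simp
        also have "\<dots> = complex_of_real (antipode_coeff n p / antipode_coeff n n) *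
            (\<Sum>c\<in>weights n \<times> weights n. invariant_vector n c * lin (rep2_word t n n) x c (- p, v))"
          unfolding sum_antidiagonal[OF n] sum_distrib_left by (rule sum_weights_uminus[OF n])
        also have "\<dots> = complex_of_real (antipode_coeff n p / antipode_coeff n n) * (counit a * invariant_vector n (- p, v))"
          by (simp add: invariant_covector[OF n] eps)
        also have "\<dots> = (if v = p then counit a else 0)"
          using p antipode_coeff_reflect[OF n p, symmetric] by (auto simp: invariant_vector_def weights_uminus_iff[OF n])
        finally show ?thesis .
      qed
      have "mult_map weights (apply1 antipode (cover_right spins weights (Delta_A t) a b)) n p s
        = (\<Sum>k\<in>weights n. complex_of_real (antipode_coeff n p / antipode_coeff n k) *
            (\<Sum>v\<in>weights n. lin (rep2_word t n n) x (- k, k) (- p, v) * b n v s))"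
        using n p by (simp add: mult_map_def apply1_def antipode_def slice1_def cover_right_apply x weights_uminus_iff)
      also have "\<dots> = (\<Sum>v\<in>weights n. (\<Sum>k\<in>weights n. complex_of_real (antipode_coeff n p / antipode_coeff n k) *
            lin (rep2_word t n n) x (- k, k) (- p, v)) * b n v s)"
        unfolding sum_distrib_left sum_distrib_right mult.assoc by (rule sum.swap)
      also have "\<dots> = (\<Sum>v\<in>weights n. if v = p then counit a * b n p s else 0)"
        unfolding inner by (rule sum.cong) auto
      finally show ?thesis using p by (simp add: fscale_def)
    next
      case False
      then have b0: "b n p s = 0" using dsum_nz[OF b] by blast
      have "n \<notin> spins \<or> - p \<notin> weights n" using False weights_uminus_iff by auto
      then show ?thesis
        by (auto simp: mult_map_def apply1_def antipode_def slice1_def cover_right_apply fscale_def b0)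
    qed
  qed
next
  fix a c :: "(real, real) fam" assume a: "a \<in> dsum spins weights" and c: "c \<in> dsum spins weights"
  show "mult_map weights (apply2 antipode (cover_left spins weights (Delta_A t) c a)) = fscale (counit a) c"
  proof (intro ext)
    fix n p s
    show "mult_map weights (apply2 antipode (cover_left spins weights (Delta_A t) c a)) n p s = fscale (counit a) c n p s"
    proof (cases "n \<in> spins \<and> s \<in> weights n")
      case True
      then have n: "n \<in> spins" and s: "s \<in> weights n" by auto
      obtain x where x: "\<And>k. k \<in> cg_spins n n \<Longrightarrow> lin (rep_word t k) x = a k"
        "Delta_A t a (n, n) = lin (rep2_word t n n) x" using Delta_A_realise[OF t dsum_dprod[OF a] n n] by blast
      have "0 \<in> cg_spins n n" using n by (simp add: cg_spins_iff spins_iff)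
      then have eps: "lin (rep_word t 0) x 0 0 = counit a" by (simp add: x counit_def)
      \<comment> \<open>Now the column index is contracted, which is the matrix applied to the
        invariant vector.\<close>
      have inner: "(\<Sum>k\<in>weights n. complex_of_real (antipode_coeff n k / antipode_coeff n s) * lin (rep2_word t n n) x (u, - s) (k, - k))
        = (if u = s then counit a else 0)" for u
      proof -
        have "(\<Sum>k\<in>weights n. complex_of_real (antipode_coeff n k / antipode_coeff n s) * lin (rep2_word t n n) x (u, - s) (k, - k))
          = inverse (complex_of_real (antipode_coeff n s)) * (\<Sum>k\<in>weights n. complex_of_real (antipode_coeff n k) * lin (rep2_word t n n) x (u, - s) (k, - k))"
          by (simp add: sum_distrib_left divide_inverse mult_ac)
        also have "\<dots> = inverse (complex_of_real (antipode_coeff n s)) * (\<Sum>c\<in>weights n \<times> weights n. lin (rep2_word t n n) x (u, - s) c * invariant_vector n c)"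
          unfolding sum_antidiagonal[OF n, symmetric] by (simp add: mult.commute)
        also have "\<dots> = inverse (complex_of_real (antipode_coeff n s)) * (counit a * invariant_vector n (u, - s))"
          using fun_cong[OF invariant_vector_invariant[OF n, of x], of "(u, - s)"] by (simp add: act_def eps)
        also have "\<dots> = (if u = s then counit a else 0)"
          using s by (auto simp: invariant_vector_def)
        finally show ?thesis .
      qed
      have "mult_map weights (apply2 antipode (cover_left spins weights (Delta_A t) c a)) n p s
        = (\<Sum>k\<in>weights n. complex_of_real (antipode_coeff n k / antipode_coeff n s) *
            (\<Sum>u\<in>weights n. c n p u * lin (rep2_word t n n) x (u, - s) (k, - k)))"
        using n s by (simp add: mult_map_def apply2_def antipode_def slice2_def cover_left_apply x weights_uminus_iff)
      also have "\<dots> = (\<Sum>k\<in>weights n. \<Sum>u\<in>weights n. c n p u * (complex_of_real (antipode_coeff n k / antipode_coeff n s) *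
            lin (rep2_word t n n) x (u, - s) (k, - k)))"
        by (simp add: sum_distrib_left mult_ac)
      also have "\<dots> = (\<Sum>u\<in>weights n. c n p u * (\<Sum>k\<in>weights n. complex_of_real (antipode_coeff n k / antipode_coeff n s) *
            lin (rep2_word t n n) x (u, - s) (k, - k)))"
        by (subst sum.swap) (simp add: sum_distrib_left)
      also have "\<dots> = (\<Sum>u\<in>weights n. if u = s then counit a * c n p s else 0)"
        unfolding inner by (rule sum.cong) auto
      finally show ?thesis using s by (simp add: fscale_def)
    next
      case False
      then have c0: "c n p s = 0" using dsum_nz[OF c] by blast
      have "n \<notin> spins \<or> - s \<notin> weights n" using False weights_uminus_iff by auto
      then show ?thesis
        by (auto simp: mult_map_def apply2_def antipode_def slice2_def cover_left_apply fscale_def c0)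
    qed
  qed
qed

lemma discrete_quantum_group_Delta_A: "discrete_quantum_group spins weights (Delta_A t)"
  unfolding discrete_quantum_group_def
proof (intro conjI exI)
  show "full_matrix_family spins weights"
    using weights_top by (force simp: full_matrix_family_def)
  show "is_coproduct spins weights (Delta_A t)" by (rule is_coproduct_Delta_A[OF t])
  show "is_counit spins weights (Delta_A t) counit" by (rule is_counit_counit)
  show "is_antipode spins weights (Delta_A t) counit antipode" by (rule is_antipode_antipode)
qed

end

theorem theorem4p22:
  fixes t :: real
  assumes "t > 0"
  shows "star_algebra fscale (dsum spins weights) (fmult weights) fstar \<and>
    discrete_quantum_group spins weights (Delta_A t)"
  using star_algebra_dsum discrete_quantum_group_Delta_A[OF assms] by blast

end
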